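(* Let $B^-_3$ be the anti-Jordan quadruple system over $\mathbb{Q}$ of all skew-symmetric $3\times3$ matrices under the anti-tetrad $[a,b,c,d]=abcd-dcba$, and let $\mathbb{K}=\mathbb{Q}(\beta)$ with $\beta=1+\sqrt{-3}$. Then its universal associative envelope satisfies $U(B^-_3)\otimes_{\mathbb{Q}}\mathbb{K}\cong\mathbb{K}\oplus M_3(\mathbb{K})\oplus M_3(\mathbb{K})\oplus M_3(\mathbb{K})$ as associative algebras. Hence, up to isomorphism, $B^-_3$ has four finite dimensional irreducible representations over $\mathbb{K}$: the 1-dimensional trivial representation, the 3-dimensional natural representation, and two other 3-dimensional representations.
   Context: Let $J$ be a subspace of a matrix algebra over $\mathbb{Q}$ closed under the anti-tetrad, with basis $B$. Its universal associative envelope is $U(J)=\mathbb{Q}\langle B\rangle/I(G)$, where $\mathbb{Q}\langle B\rangle$ is the free unital associative algebra on $B$ and $I(G)$ is the two-sided ideal generated by the elements $abcd-dcba-[a,b,c,d]$ for $a,b,c,d\in B$, with $[a,b,c,d]\in J$ computed in $J$ and written as a linear combination of $B$. A representation of $J$ over $\mathbb{K}$ on a $\mathbb{K}$-vector space $V$ is a $\mathbb{Q}$-linear map $\rho\colon J\to\mathrm{End}_{\mathbb{K}}(V)$ with $\rho([a,b,c,d])=\rho(a)\rho(b)\rho(c)\rho(d)-\rho(d)\rho(c)\rho(b)\rho(a)$; equivalently, a unital left $U(J)\otimes_{\mathbb{Q}}\mathbb{K}$-module. The trivial representation is $\rho=0$ on a 1-dimensional space; the natural representation is the inclusion of $J$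 in the matrix algebra acting on column vectors over $\mathbb{K}$. *)

theory Defs
  imports
    "HOL-Analysis.Analysis"
    "HOL-Library.Poly_Mapping"
    "HOL-Algebra.Algebraic_Closure_Type"
    "HOL-Algebra.Chinese_Remainder"
    "HOL-Algebra.Generated_Fields"
    "HOL-Algebra.Module"
begin

section \<open>The field \<open>\<rat>(\<beta>)\<close>\<close>

definition beta :: complex where
  "beta = 1 + csqrt (-3)"

typedef Qbeta = "generate_field (ring_of_type_algebra :: complex ring) {beta}"
  using generate_field.one by blast

setup_lifting type_definition_Qbeta

lemma complex_ring_simps:
  fixes x y :: complex
  shows "\<one>\<^bsub>ring_of_type_algebra\<^esub> = (1 :: complex)"
    "\<zero>\<^bsub>ring_of_type_algebra\<^esub> = (0 :: complex)"
    "x \<oplus>\<^bsub>ring_of_type_algebra\<^esub> y = x + y"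
    "x \<otimes>\<^bsub>ring_of_type_algebra\<^esub> y = x * y"
    "\<ominus>\<^bsub>ring_of_type_algebra\<^esub> x = - x"
    "x \<noteq> 0 \<Longrightarrow> inv\<^bsub>ring_of_type_algebra\<^esub> x = inverse x"
proof -
  let ?C = "ring_of_type_algebra :: complex ring"
  interpret C: field ?C by (rule field_from_type_algebra)
  show "\<one>\<^bsub>?C\<^esub> = (1 :: complex)" "\<zero>\<^bsub>?C\<^esub> = (0 :: complex)"
    and add: "x \<oplus>\<^bsub>?C\<^esub> y = x + y" and "x \<otimes>\<^bsub>?C\<^esub> y = x * y" for x y
    by (simp_all add: ring_of_type_algebra_def)
  show "\<ominus>\<^bsub>?C\<^esub> x = - x"
    by (rule C.minus_equality) (simp_all add: ring_of_type_algebra_def)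
  show "inv\<^bsub>?C\<^esub> x = inverse x" if "x \<noteq> 0"
    using that by (intro C.comm_inv_char) (simp_all add: ring_of_type_algebra_def)
qed

lemma zero_mem_Qbeta: "0 \<in> generate_field (ring_of_type_algebra :: complex ring) {beta}"
  using field.zero_in_generate[OF field_from_type_algebra[where 'a = complex]]
  by (metis complex_ring_simps(2))

instantiation Qbeta :: field
begin

lift_definition zero_Qbeta :: Qbeta is "0" by (rule zero_mem_Qbeta)
lift_definition one_Qbeta :: Qbeta is "1"
  using generate_field.one by (metis complex_ring_simps(1))
lift_definition plus_Qbeta :: "Qbeta \<Rightarrow> Qbeta \<Rightarrow> Qbeta" is "(+)"
  using generate_field.eng_add by (metis complex_ring_simps(3))
lift_definition times_Qbeta :: "Qbeta \<Rightarrow> Qbeta \<Rightarrow> Qbeta" is "(*)"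
  using generate_field.eng_mult by (metis complex_ring_simps(4))
lift_definition uminus_Qbeta :: "Qbeta \<Rightarrow> Qbeta" is "uminus"
  using generate_field.a_inv by (metis complex_ring_simps(5))
lift_definition inverse_Qbeta :: "Qbeta \<Rightarrow> Qbeta" is "inverse"
  using generate_field.m_inv zero_mem_Qbeta
  by (metis complex_ring_simps(2,6) inverse_zero)
definition minus_Qbeta :: "Qbeta \<Rightarrow> Qbeta \<Rightarrow> Qbeta" where "minus_Qbeta x y = x + - y"
definition divide_Qbeta :: "Qbeta \<Rightarrow> Qbeta \<Rightarrow> Qbeta" where "divide_Qbeta x y = x * inverse y"

instance
  by standard
    (simp_all add: minus_Qbeta_def divide_Qbeta_def, (transfer, simp add: algebra_simps)+)

end

instance Qbeta :: field_char_0
proof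
  have "Rep_Qbeta (of_nat n) = of_nat n" for n
    by (induction n) (simp_all add: zero_Qbeta.rep_eq one_Qbeta.rep_eq plus_Qbeta.rep_eq)
  then show "inj (of_nat :: nat \<Rightarrow> Qbeta)"
    by (metis injI of_nat_eq_iff)
qed

section \<open>Associative algebras, as records of type \<open>module\<close>\<close>

text \<open>The locale \<open>algebra\<close> of HOL-Algebra requires commutative multiplication, so only the
  record type is used.  Scalars range over a whole type.\<close>

definition algebra_iso :: "('k, 'a) module \<Rightarrow> ('k, 'b) module \<Rightarrow> bool" where
  "algebra_iso A C \<longleftrightarrow>
     (\<exists>f \<in> ring_iso A C. \<forall>k. \<forall>x \<in> carrier A. f (k \<odot>\<^bsub>A\<^esub> x) = k \<odot>\<^bsub>C\<^esub> f x)"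

definition quotient_algebra :: "('k, 'a) module \<Rightarrow> 'a set \<Rightarrow> ('k, 'a set) module" where
  "quotient_algebra A I = ring.extend (A Quot I)
     (module.fields (\<lambda>k S. \<Union>x\<in>S. I +>\<^bsub>A\<^esub> (k \<odot>\<^bsub>A\<^esub> x)))"

definition direct_sum_algebra ::
  "('k, 'a) module \<Rightarrow> ('k, 'b) module \<Rightarrow> ('k, 'a \<times> 'b) module" (infixr \<open>\<oplus>\<^sub>a\<close> 65) where
  "A \<oplus>\<^sub>a C = ring.extend (RDirProd A C)
     (module.fields (\<lambda>k (x, y). (k \<odot>\<^bsub>A\<^esub> x, k \<odot>\<^bsub>C\<^esub> y)))"

definition field_algebra :: "('k::field, 'k) module" where
  "field_algebra = ring.extend ring_of_type_algebra (module.fields (*))"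

definition rat_algebra :: "(rat, 'k::field_char_0) module" where
  "rat_algebra = ring.extend ring_of_type_algebra (module.fields (\<lambda>q x. of_rat q * x))"

definition mscale :: "'a::semiring_1 \<Rightarrow> 'a^'n^'m \<Rightarrow> 'a^'n^'m" where
  "mscale c A = map_matrix ((*) c) A"

definition matrix_algebra :: "('k::field, 'k^'n^'n) module" where
  "matrix_algebra =
     \<lparr>carrier = UNIV, monoid.mult = (**), one = mat 1, zero = 0, add = (+), smult = mscale\<rparr>"

definition monoid_algebra ::
  "('m, 'z) monoid_scheme \<Rightarrow> ('k::comm_ring_1, 'm \<Rightarrow>\<^sub>0 'k) module" where
  "monoid_algebra M =
     \<lparr>carrier = {p. Poly_Mapping.keys p \<subseteq> carrier M},
      monoid.mult = (\<lambda>p q. \<Sum>x\<in>Poly_Mapping.keys p. \<Sum>y\<in>Poly_Mapping.keys q.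
        Poly_Mapping.single (x \<otimes>\<^bsub>M\<^esub> y) (Poly_Mapping.lookup p x * Poly_Mapping.lookup q y)),
      one = Poly_Mapping.single \<one>\<^bsub>M\<^esub> 1,
      zero = 0,
      add = (+),
      smult = (\<lambda>k. Poly_Mapping.map ((*) k))\<rparr>"

definition free_algebra :: "'x set \<Rightarrow> ('k::comm_ring_1, 'x list \<Rightarrow>\<^sub>0 'k) module" where
  "free_algebra G = monoid_algebra \<lparr>carrier = lists G, monoid.mult = (@), one = []\<rparr>"

subsection \<open>Tensor products of \<open>\<rat>\<close>-algebras and extension of scalars\<close>

text \<open>The space with basis the set \<open>A \<times> C\<close> is the monoid algebra of the multiplicative monoid
  \<open>A \<times> C\<close>.  The span of the bilinearity relations is already a two-sided ideal, because
  multiplying a relation by a pair \<open>(x, y)\<close> gives a relation again; so the quotient below is the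
  usual tensor product with its usual multiplication.\<close>

definition tensor_relations ::
  "(rat, 'a) module \<Rightarrow> (rat, 'c) module \<Rightarrow> ('a \<times> 'c \<Rightarrow>\<^sub>0 rat) set" where
  "tensor_relations A C =
     {Poly_Mapping.single (a \<oplus>\<^bsub>A\<^esub> a', c) 1 - Poly_Mapping.single (a, c) 1
        - Poly_Mapping.single (a', c) 1
       | a a' c. a \<in> carrier A \<and> a' \<in> carrier A \<and> c \<in> carrier C} \<union>
     {Poly_Mapping.single (a, c \<oplus>\<^bsub>C\<^esub> c') 1 - Poly_Mapping.single (a, c) 1
        - Poly_Mapping.single (a, c') 1
       | a c c'. a \<in> carrier A \<and> c \<in> carrier C \<and> c' \<in> carrier C} \<union>
     {Poly_Mapping.single (q \<odot>\<^bsub>A\<^esub> a, c) 1 - Poly_Mapping.single (a, c) q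
       | q a c. a \<in> carrier A \<and> c \<in> carrier C} \<union>
     {Poly_Mapping.single (a, q \<odot>\<^bsub>C\<^esub> c) 1 - Poly_Mapping.single (a, c) q
       | q a c. a \<in> carrier A \<and> c \<in> carrier C}"

definition tensor_ideal ::
  "(rat, 'a) module \<Rightarrow> (rat, 'c) module \<Rightarrow> ('a \<times> 'c \<Rightarrow>\<^sub>0 rat) set" where
  "tensor_ideal A C = Idl\<^bsub>monoid_algebra (A \<times>\<times> C)\<^esub> (tensor_relations A C)"

definition tensor_algebra ::
  "(rat, 'a) module \<Rightarrow> (rat, 'c) module \<Rightarrow> (rat, ('a \<times> 'c \<Rightarrow>\<^sub>0 rat) set) module" where
  "tensor_algebra A C = quotient_algebra (monoid_algebra (A \<times>\<times> C)) (tensor_ideal A C)"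

definition pure_tensor ::
  "(rat, 'a) module \<Rightarrow> (rat, 'c) module \<Rightarrow> 'a \<Rightarrow> 'c \<Rightarrow> ('a \<times> 'c \<Rightarrow>\<^sub>0 rat) set" where
  "pure_tensor A C a c =
     tensor_ideal A C +>\<^bsub>monoid_algebra (A \<times>\<times> C)\<^esub> Poly_Mapping.single (a, c) 1"

text \<open>\<open>A \<otimes>\<^sub>\<rat> K\<close> as a \<open>K\<close>-algebra: a scalar \<open>k\<close> acts as multiplication by \<open>1 \<otimes> k\<close>.\<close>

definition extend_scalars ::
  "(rat, 'a) module \<Rightarrow> ('k::field_char_0, ('a \<times> 'k \<Rightarrow>\<^sub>0 rat) set) module" where
  "extend_scalars A = (let T = tensor_algebra A rat_algebra in
     ring.extend (ring.truncate T)
       (module.fields (\<lambda>k S. pure_tensor A rat_algebra \<one>\<^bsub>A\<^esub> k \<otimes>\<^bsub>T\<^esub> S)))"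

section \<open>The anti-tetrad and universal associative envelopes\<close>

definition anti_tetrad ::
  "'a::ring_1^'n^'n \<Rightarrow> 'a^'n^'n \<Rightarrow> 'a^'n^'n \<Rightarrow> 'a^'n^'n \<Rightarrow> 'a^'n^'n" where
  "anti_tetrad a b c d = a ** b ** c ** d - d ** c ** b ** a"

definition skew_matrices :: "('a::ab_group_add^'n^'n) set" where
  "skew_matrices = {A. transpose A = - A}"

global_interpretation mat_vs: vector_space "mscale :: 'a::field \<Rightarrow> 'a^'n^'m \<Rightarrow> 'a^'n^'m"
  by standard (simp_all add: mscale_def vec_eq_iff algebra_simps)

lemma subspace_skew_matrices: "mat_vs.subspace (skew_matrices :: ('a::field^'n^'n) set)"
proof -
  have "transpose (x + y) = transpose x + transpose y"
    "transpose (mscale k x) = mscale k (transpose x)" "mscale k (- x) = - mscale k x"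
    "transpose (0 :: 'a^'n^'n) = 0"
    for x y :: "'a^'n^'n" and k
    by (simp_all add: transpose_def mscale_def vec_eq_iff)
  then show ?thesis
    by (simp add: mat_vs.subspace_def skew_matrices_def)
qed

lemma anti_tetrad_skew_matrices:
  fixes a b c d :: "'a::comm_ring_1^'n^'n"
  assumes "a \<in> skew_matrices" "b \<in> skew_matrices" "c \<in> skew_matrices" "d \<in> skew_matrices"
  shows "anti_tetrad a b c d \<in> skew_matrices"
proof -
  have neg: "(- x) ** y = - (x ** y)" "x ** (- y) = - (x ** y)" for x y :: "'a^'n^'n"
    by (simp_all add: matrix_matrix_mult_def vec_eq_iff sum_negf)
  have diff: "transpose (x - y) = transpose x - transpose y" for x y :: "'a^'n^'n"
    by (simp add: transpose_def vec_eq_iff)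
  show ?thesis
    using assms
    by (simp add: skew_matrices_def anti_tetrad_def diff matrix_transpose_mul neg matrix_mul_assoc)
qed

definition envelope_relations :: "(rat^'n^'n) set \<Rightarrow> ((rat^'n^'n) list \<Rightarrow>\<^sub>0 rat) set" where
  "envelope_relations B =
     {Poly_Mapping.single [a, b, c, d] 1 - Poly_Mapping.single [d, c, b, a] 1
        - (\<Sum>e\<in>B. Poly_Mapping.single [e] (mat_vs.representation B (anti_tetrad a b c d) e))
       | a b c d. a \<in> B \<and> b \<in> B \<and> c \<in> B \<and> d \<in> B}"

definition envelope :: "(rat^'n^'n) set \<Rightarrow> (rat, ((rat^'n^'n) list \<Rightarrow>\<^sub>0 rat) set) module" where
  "envelope B =
     quotient_algebra (free_algebra B) (Idl\<^bsub>free_algebra B\<^esub> (envelope_relations B))"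

section \<open>Representations\<close>

text \<open>A vector space is a whole type with a scalar multiplication.  A representation of \<open>J\<close> is
  a function on all matrices of which only the restriction to \<open>J\<close> matters.\<close>

definition quad_rep ::
  "(rat^'n^'n) set \<Rightarrow> ('k::field_char_0 \<Rightarrow> 'v::ab_group_add \<Rightarrow> 'v) \<Rightarrow>
   (rat^'n^'n \<Rightarrow> 'v \<Rightarrow> 'v) \<Rightarrow> bool" where
  "quad_rep J s \<rho> \<longleftrightarrow>
     vector_space s \<and>
     (\<forall>a\<in>J. Vector_Spaces.linear s s (\<rho> a)) \<and>
     (\<forall>a\<in>J. \<forall>b\<in>J. \<forall>v. \<rho> (a + b) v = \<rho> a v + \<rho> b v) \<and>
     (\<forall>q. \<forall>a\<in>J. \<forall>v. \<rho> (mscale q a) v = s (of_rat q) (\<rho> a v)) \<and>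
     (\<forall>a\<in>J. \<forall>b\<in>J. \<forall>c\<in>J. \<forall>d\<in>J. \<forall>v.
        \<rho> (anti_tetrad a b c d) v = \<rho> a (\<rho> b (\<rho> c (\<rho> d v))) - \<rho> d (\<rho> c (\<rho> b (\<rho> a v))))"

definition finite_dim :: "('k::field \<Rightarrow> 'v::ab_group_add \<Rightarrow> 'v) \<Rightarrow> bool" where
  "finite_dim s \<longleftrightarrow> (\<exists>S. finite S \<and> module.span s S = UNIV)"

definition fin_dim_irrep ::
  "(rat^'n^'n) set \<Rightarrow> ('k::field_char_0 \<Rightarrow> 'v::ab_group_add \<Rightarrow> 'v) \<Rightarrow>
   (rat^'n^'n \<Rightarrow> 'v \<Rightarrow> 'v) \<Rightarrow> bool" where
  "fin_dim_irrep J s \<rho> \<longleftrightarrow>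
     quad_rep J s \<rho> \<and> finite_dim s \<and> (UNIV :: 'v set) \<noteq> {0} \<and>
     (\<forall>W. module.subspace s W \<and> (\<forall>a\<in>J. \<rho> a ` W \<subseteq> W) \<longrightarrow> W = {0} \<or> W = UNIV)"

definition rep_equiv ::
  "(rat^'n^'n) set \<Rightarrow>
   ('k::field_char_0 \<Rightarrow> 'v::ab_group_add \<Rightarrow> 'v) \<Rightarrow> (rat^'n^'n \<Rightarrow> 'v \<Rightarrow> 'v) \<Rightarrow>
   ('k \<Rightarrow> 'w::ab_group_add \<Rightarrow> 'w) \<Rightarrow> (rat^'n^'n \<Rightarrow> 'w \<Rightarrow> 'w) \<Rightarrow> bool" where
  "rep_equiv J s \<rho> t \<sigma> \<longleftrightarrow>
     (\<exists>f. Vector_Spaces.linear s t f \<and> bij f \<and> (\<forall>a\<in>J. \<forall>v. f (\<rho> a v) = \<sigma> a (f v)))"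

definition trivial_rep :: "rat^'n^'n \<Rightarrow> 'k::field_char_0 \<Rightarrow> 'k" where
  "trivial_rep a v = 0"

definition natural_rep :: "rat^'n^'n \<Rightarrow> 'k::field_char_0^'n \<Rightarrow> 'k^'n" where
  "natural_rep a v = map_matrix of_rat a *v v"

text \<open>A predicate on pairs rather than an existential inside the classification: the type of the
  space to be classified cannot be quantified within the scope of an existential.  Inequivalence of
  the trivial and the natural representation is stated separately.\<close>

definition two_other_irreps ::
  "(rat^'n^'n \<Rightarrow> 'k::field_char_0^'n \<Rightarrow> 'k^'n) \<Rightarrow> (rat^'n^'n \<Rightarrow> 'k^'n \<Rightarrow> 'k^'n) \<Rightarrow> bool" where
  "two_other_irreps \<rho> \<sigma> \<longleftrightarrow>
     fin_dim_irrep skew_matrices (*s) \<rho> \<and>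
     fin_dim_irrep skew_matrices (*s) \<sigma> \<and>
     \<not> rep_equiv skew_matrices (*) (trivial_rep :: _ \<Rightarrow> 'k \<Rightarrow> 'k) (*s) \<rho> \<and>
     \<not> rep_equiv skew_matrices (*) (trivial_rep :: _ \<Rightarrow> 'k \<Rightarrow> 'k) (*s) \<sigma> \<and>
     \<not> rep_equiv skew_matrices (*s) natural_rep (*s) \<rho> \<and>
     \<not> rep_equiv skew_matrices (*s) natural_rep (*s) \<sigma> \<and>
     \<not> rep_equiv skew_matrices (*s) \<rho> (*s) \<sigma>"

end

theory Submission
  imports Defs
begin

text \<open>
  Let \<open>x, y, z\<close> be the images in a representation of the standard basis \<open>so3\<close> of the skew-symmetric
  matrices. The tetrad relations imply \<open>aba = 0\<close>, \<open>abc = - cba\<close>, \<open>abb = cca\<close> for distinct letters and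
  \<open>xxx = xyy + xzz\<close> (each is a short noncommutative combination of the relations, found by a Groebner
  basis computation). Hence \<open>S = - (xx + yy + zz) / 2\<close> is central with \<open>S\<^sup>3 x = x\<close>, and the elements
  \<open>F i j = x\<^sub>j x\<^sub>i + \<delta>\<^sub>i\<^sub>j S\<close> satisfy \<open>x\<^sub>k F i j = S\<^sup>2 (\<Sum>m. \<epsilon>\<^sub>k\<^sub>i\<^sub>m F m j)\<close>; up to the factor \<open>S\<close> they are
  matrix units. So the envelope is spanned by \<open>1\<close> and the 27 elements \<open>S\<^sup>m F i j\<close> with \<open>m < 3\<close>.

  If \<open>l\<^sup>3 = 1\<close>, then \<open>l\<close> times the natural representation is again a representation, because
  \<open>l\<^sup>4 = l\<close>; there \<open>S\<close> acts as \<open>l\<^sup>2\<close>. The field contains a primitive cube root of unity \<open>\<omega>\<close>, and a discrete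
  Fourier transform over \<open>1, \<omega>, \<omega>\<^sup>2\<close> shows that the 28 elements are mapped to a basis of the direct sum.
  On an irreducible representation on which \<open>J\<close> acts nontrivially, \<open>S\<close> acts as a scalar \<open>l\<^sup>2\<close>, and for
  fixed \<open>j\<close> and \<open>v\<close> the vectors \<open>F i j v\<close> span a copy of \<open>l\<close> times the natural representation.
\<close>

section \<open>Operators satisfying the tetrad relations\<close>

text \<open>On the natural representation \<open>so3 k\<close> is the cross product with the
  \<open>k\<close>-th unit vector, so \<open>so3 j ** so3 i\<close> is the matrix unit in position
  \<open>(i, j)\<close> minus \<open>kron i j\<close> times the identity. This is where
  \<open>F\<close> comes from: \<open>S\<close> is the Casimir sum, scaled to act there as the
  identity and vanishing on the trivial representation. The dimension of the envelope is pinned from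
  two sides: the operator identities bound it above by 28, and the independent images in the target
  bound it below, so confluence of a rewriting system never has to be proved. The obstacle is one of
  types: the operator identities concern linear maps on a whole type, whereas the envelope is a
  quotient of a proper subset of a type. Hence the quotient is modelled by the image of a linear
  projection \<open>proj\<close> along the ideal of relations, and multiplication by letters
  followed by \<open>proj\<close> satisfies the identities exactly. The same 28 elements settle both
  injectivity statements, for the envelope over the rationals and for its tensor product with the
  larger field, because their images are independent over the larger field.\<close>

definition eps :: "3 \<Rightarrow> 3 \<Rightarrow> 3 \<Rightarrow> 'a::ring_1" where
  "eps i j k =
     (if (i, j, k) \<in> {(1, 2, 3), (2, 3, 1), (3, 1, 2)} then 1
      else if (i, j, k) \<in> {(2, 1, 3), (3, 2, 1), (1, 3, 2)} then - 1 else 0)"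

lemma distinct_3: "(1::3) \<noteq> 2" "(2::3) \<noteq> 3" "(3::3) \<noteq> 1"
  by simp_all

definition kron :: "3 \<Rightarrow> 3 \<Rightarrow> 'a::ring_1" where
  "kron i j = (if i = j then 1 else 0)"

text \<open>The coefficients are the structure constants of the anti-tetrad in the basis
  \<open>so3\<close>, see \<open>anti_tetrad_so3\<close>. Abstract operators let one calculation
  serve both the classification and the regular representation of the envelope.\<close>

locale tetrad_operators = V: vector_space s
  for s :: "'k::field_char_0 \<Rightarrow> 'v::ab_group_add \<Rightarrow> 'v" +
  fixes L :: "3 \<Rightarrow> 'v \<Rightarrow> 'v"
  assumes linear_L: "\<And>a. Vector_Spaces.linear s s (L a)"
    and tetrad: "\<And>a b c d v. L a (L b (L c (L d v))) - L d (L c (L b (L a v))) =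
      - (\<Sum>e\<in>UNIV. s (kron a d * eps b c e + kron c d * eps a b e + kron a b * eps c d e) (L e v))"
begin

lemma L_simps [simp]:
  "L a (v + w) = L a v + L a w" "L a (v - w) = L a v - L a w" "L a (- v) = - L a v"
  "L a 0 = 0" "L a (s q v) = s q (L a v)"
proof -
  interpret L: Vector_Spaces.linear s s "L a" by (rule linear_L)
  show "L a (v + w) = L a v + L a w" "L a (v - w) = L a v - L a w" "L a (- v) = - L a v"
    "L a 0 = 0" "L a (s q v) = s q (L a v)"
    by (simp_all add: L.add L.diff L.neg L.zero L.scale)
qed

definition S :: "'v \<Rightarrow> 'v" where
  "S v = s (- 1 / 2) (\<Sum>k\<in>UNIV. L k (L k v))"

definition F :: "3 \<Rightarrow> 3 \<Rightarrow> 'v \<Rightarrow> 'v" where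
  "F i j v = L j (L i v) + s (kron i j) (S v)"

lemma double_cancel:
  fixes v w :: 'v
  assumes "v + v = w + w"
  shows "v = w"
proof -
  have "s (1 / 2) (v + v) = v" for v
    by (simp add: V.scale_right_distrib flip: V.scale_left_distrib)
  then show ?thesis using assms by metis
qed

section \<open>Consequences of the tetrad relations for cubic and quintic words\<close>

abbreviation (input) cyclic :: "3 \<Rightarrow> 3 \<Rightarrow> 3 \<Rightarrow> bool" where
  "cyclic a b c \<equiv> (a, b, c) \<in> {(1, 2, 3), (2, 3, 1), (3, 1, 2)}"

lemma cyclic_rotate: "cyclic a b c \<Longrightarrow> cyclic b c a"
  by auto

lemma cyclic_cases:
  assumes "a \<noteq> b" "b \<noteq> c" "a \<noteq> c"
  shows "cyclic a b c \<or> cyclic a c b"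
  using assms exhaust_3[of a] exhaust_3[of b] exhaust_3[of c] by auto

text \<open>These nine instances of \<open>tetrad\<close> suffice for all later relations. In the
  third and fourth the two surviving structure terms cancel, which is why they are
  homogeneous.\<close>

lemma tetrad_cyclic:
  assumes "cyclic i j k"
  defines "x \<equiv> L i" and "y \<equiv> L j" and "z \<equiv> L k"
  shows "x (x (x (y v))) = y (x (x (x v))) - z v"
    "x (x (x (z v))) = z (x (x (x v))) + y v"
    "x (x (y (x v))) = x (y (x (x v)))"
    "x (x (z (x v))) = x (z (x (x v)))"
    "x (x (y (z v))) = z (y (x (x v))) - x v"
    "x (x (z (y v))) = y (z (x (x v))) + x v"
    "x (y (y (y v))) = y (y (y (x v))) - z v"
    "x (z (y (y v))) = y (y (z (x v))) + y v"
    "x (y (z (x v))) = x (z (y (x v))) - x v"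
  unfolding x_def y_def z_def
  subgoal using assms(1) tetrad[of i i i j v] by (auto simp: sum_3 kron_def eps_def algebra_simps)
  subgoal using assms(1) tetrad[of i i i k v] by (auto simp: sum_3 kron_def eps_def algebra_simps)
  subgoal using assms(1) tetrad[of i i j i v] by (auto simp: sum_3 kron_def eps_def algebra_simps)
  subgoal using assms(1) tetrad[of i i k i v] by (auto simp: sum_3 kron_def eps_def algebra_simps)
  subgoal using assms(1) tetrad[of i i j k v] by (auto simp: sum_3 kron_def eps_def algebra_simps)
  subgoal using assms(1) tetrad[of i i k j v] by (auto simp: sum_3 kron_def eps_def algebra_simps)
  subgoal using assms(1) tetrad[of i j j j v] by (auto simp: sum_3 kron_def eps_def algebra_simps)
  subgoal using assms(1) tetrad[of i k j j v] by (auto simp: sum_3 kron_def eps_def algebra_simps)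
  subgoal using assms(1) tetrad[of i j k i v] by (auto simp: sum_3 kron_def eps_def algebra_simps)
  done

text \<open>Up to sign, the middle letter is a commutator of the cube of the outer letter with the
  third letter. After this substitution a homogeneous instance of \<open>tetrad_cyclic\<close> moves
  \<open>L c\<close> through the powers of \<open>L a\<close>, and the two terms cancel.\<close>

lemma aba_eq_0:
  assumes "a \<noteq> b"
  shows "L a (L b (L a v)) = 0"
proof -
  obtain c where c: "b \<noteq> c" "a \<noteq> c"
    using exhaust_3[of a] exhaust_3[of b] distinct_3 by metis
  consider "cyclic a b c" | "cyclic a c b"
    using cyclic_cases[OF assms c] by blast
  then show ?thesis
  proof cases
    case 1
    note rel = tetrad_cyclic[OF 1]
    have "L b w = L a (L a (L a (L c w))) - L c (L a (L a (L a w)))" for w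
      using rel(2)[of w] by simp
    then show ?thesis
      by (simp add: rel(4))
  next
    case 2
    note rel = tetrad_cyclic[OF 2]
    have "L b w = L c (L a (L a (L a w))) - L a (L a (L a (L c w)))" for w
      using rel(1)[of w] by simp
    then show ?thesis
      by (simp add: rel(3))
  qed
qed

text \<open>With \<open>L i\<close> replaced by a commutator of \<open>L k\<close> with the cube of
  \<open>L j\<close>, both sides become \<open>L k\<close>, the fourth power of \<open>L j\<close>,
  \<open>L k\<close>; the remaining terms contain \<open>L k (L j (L k w))\<close> and
  vanish.\<close>

lemma abc_cyclic:
  assumes "cyclic i j k"
  shows "L i (L j (L k v)) = - L k (L j (L i v))"
proof -
  have eq: "L i w = L k (L j (L j (L j w))) - L j (L j (L j (L k w)))" for w
    using tetrad_cyclic(1)[OF cyclic_rotate[OF assms], of w] by simp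
  have "j \<noteq> k" using assms by auto
  then show ?thesis
    unfolding eq by (simp add: aba_eq_0)
qed

lemma abc_anticomm:
  assumes "a \<noteq> b" "b \<noteq> c" "a \<noteq> c"
  shows "L a (L b (L c v)) = - L c (L b (L a v))"
proof -
  consider "cyclic a b c" | "cyclic c b a"
    using cyclic_cases[OF assms] by auto
  then show ?thesis
  proof cases
    case 2
    then show ?thesis using abc_cyclic[OF 2, of v] by simp
  qed (rule abc_cyclic)
qed

text \<open>One letter is substituted on each side by its expression through a tetrad relation;
  \<open>aba_eq_0\<close> then leaves a single word. In the first case both sides are
  \<open>- L a (L b (L b (L b (L c (L a v)))))\<close>.\<close>

lemma abb_eq_cca:
  assumes "a \<noteq> b" "b \<noteq> c" "a \<noteq> c"
  shows "L a (L b (L b v)) = L c (L c (L a v))"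
proof -
  consider "cyclic a b c" | "cyclic a c b"
    using cyclic_cases[OF assms] by blast
  then show ?thesis
  proof cases
    case 1
    note rel = tetrad_cyclic[OF 1]
    have b: "L b w = L a (L c (L b (L b w))) - L b (L b (L c (L a w)))" for w
      using rel(8)[of w] by simp
    have c: "L c w = L b (L b (L b (L a w))) - L a (L b (L b (L b w)))" for w
      using rel(7)[of w] by simp
    show ?thesis
      using assms by (subst b, subst c[of "L c (L a v)"]) (simp add: aba_eq_0)
  next
    case 2
    note rel = tetrad_cyclic[OF 2]
    have c: "L c w = L a (L b (L c (L c w))) - L c (L c (L b (L a w)))" for w
      using rel(8)[of w] by simp
    have b: "L b w = L c (L c (L c (L a w))) - L a (L c (L c (L c w)))" for w
      using rel(7)[of w] by simp
    show ?thesis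
      using assms by (subst c, subst b[of v]) (simp add: aba_eq_0)
  qed
qed

text \<open>The last relation of \<open>tetrad_cyclic\<close> writes \<open>L i w\<close> as a
  difference of two words. At \<open>w = L i (L i v)\<close> the first word equals
  \<open>L i (L k (L k v))\<close> and the second \<open>- L i (L j (L j v))\<close>.\<close>

lemma cube_cyclic:
  assumes "cyclic i j k"
  shows "L i (L i (L i v)) = L i (L j (L j v)) + L i (L k (L k v))"
proof -
  note rel = tetrad_cyclic[OF assms]
  have aba: "L i (L j (L i w)) = 0" "L i (L k (L i w)) = 0" for w
    using assms by (auto simp: aba_eq_0)
  have "L j v = L i (L i (L i (L k v))) - L k (L i (L i (L i v)))"
    using rel(2)[of v] by simp
  from arg_cong[OF this, of "\<lambda>u. L i (L j u)"]
  have 1: "L i (L j (L j v)) = - L i (L j (L k (L i (L i (L i v)))))"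
    by (simp add: aba)
  have "L k v = L j (L i (L i (L i v))) - L i (L i (L i (L j v)))"
    using rel(1)[of v] by simp
  from arg_cong[OF this, of "\<lambda>u. L i (L k u)"]
  have 2: "L i (L k (L k v)) = L i (L k (L j (L i (L i (L i v)))))"
    by (simp add: aba)
  show ?thesis
    using rel(9)[of "L i (L i v)"] by (simp add: 1 2)
qed

lemma S_cyclic:
  assumes "cyclic i j k"
  shows "S v = s (- 1 / 2) (L i (L i v) + L j (L j v) + L k (L k v))"
  using assms by (auto simp: S_def sum_3 add_ac)

lemma ex_cyclic: "\<exists>j k. cyclic i j k"
  using exhaust_3[of i] by auto

lemma S_simps [simp]:
  "S (v + w) = S v + S w" "S (v - w) = S v - S w" "S (- v) = - S v" "S 0 = 0" "S (s q v) = s q (S v)"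
  by (simp_all add: S_def sum.distrib sum_subtractf sum_negf V.scale_sum_right
      V.scale_right_distrib V.scale_right_diff_distrib mult.commute)

text \<open>By \<open>cube_cyclic\<close> and \<open>abb_eq_cca\<close> the three squares, composed
  with \<open>L i\<close> on either side, add up to twice the cube of \<open>L i\<close>. Comparing
  the two sides makes \<open>S\<close> central.\<close>

lemma S_L: "S (L i v) = - L i (L i (L i v))" and L_S: "L i (S v) = - L i (L i (L i v))"
proof -
  obtain j k where c: "cyclic i j k" using ex_cyclic by blast
  then have d: "i \<noteq> j" "j \<noteq> k" "i \<noteq> k" by auto
  note cube = cube_cyclic[OF c, of v, symmetric]
  have half: "s (- 1 / 2) (u + u) = - u" for u
  proof -
    have "s (- 1 / 2) (u + u) = s (- 1 / 2 + - 1 / 2) u"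
      by (simp only: V.scale_right_distrib V.scale_left_distrib)
    then show ?thesis by simp
  qed
  have "L i (L i (L i v)) + L i (L j (L j v)) + L i (L k (L k v)) =
      L i (L i (L i v)) + L i (L i (L i v))"
    using cube by (simp add: add.assoc)
  moreover have "L j (L j (L i v)) = L i (L k (L k v))" "L k (L k (L i v)) = L i (L j (L j v))"
    using d abb_eq_cca[of i k j v] abb_eq_cca[of i j k v] by simp_all
  ultimately show "S (L i v) = - L i (L i (L i v))" "L i (S v) = - L i (L i (L i v))"
    using half[of "L i (L i (L i v))"] by (simp_all add: S_cyclic[OF c] add_ac)
qed

lemma L_S_commute: "L i (S v) = S (L i v)"
  by (simp add: S_L L_S)

text \<open>Since \<open>S (L k v)\<close> is minus a cube, \<open>S (L k (F i j v))\<close> expands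
  into words of length five that begin with a cube. These are the reductions that \<open>L_F\<close>
  needs; the last two determine only twice the word, whence the factor 1/2.\<close>

lemma quintic_cyclic:
  assumes "cyclic i j k"
  defines "x \<equiv> L i" and "y \<equiv> L j" and "z \<equiv> L k"
  shows "x (x (x (x (y v)))) = - x (z v)" "x (x (x (x (z v)))) = x (y v)"
    "x (x (x (y (y v)))) = - z (y v)" "x (x (x (z (z v)))) = y (z v)"
    "x (x (x (x (x v)))) = y (z v) - z (y v)"
    "x (x (x (y (z v)))) = s (1 / 2) (y (y v) - x (x v) - z (z v))"
    "x (x (x (z (y v)))) = s (1 / 2) (x (x v) + y (y v) - z (z v))"
proof -
  have d: "i \<noteq> j" "j \<noteq> k" "i \<noteq> k" using assms by auto
  note rel = tetrad_cyclic[OF assms(1), folded x_def y_def z_def]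
  note lin = L_simps[of i, folded x_def] L_simps[of j, folded y_def] L_simps[of k, folded z_def]
  have half: "u = s (1 / 2) w" if "u + u = w" for u w
    unfolding that[symmetric] by (simp add: V.scale_right_distrib flip: V.scale_left_distrib)
  have aba: "x (y (x w)) = 0" "x (z (x w)) = 0" "y (x (y w)) = 0" "z (x (z w)) = 0" for w
    using d by (simp_all add: x_def y_def z_def aba_eq_0)
  have xxy: "x (x (y w)) = y (z (z w))" and xxz: "x (x (z w)) = z (y (y w))" for w
    using d abb_eq_cca[of j k i w] abb_eq_cca[of k j i w] by (simp_all add: x_def y_def z_def)
  show "x (x (x (x (y v)))) = - x (z v)" "x (x (x (x (z v)))) = x (y v)"
    by (simp_all add: rel(1)[of v] rel(2)[of v] aba lin)
  show 3: "x (x (x (y (y v)))) = - z (y v)"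
    unfolding rel(1)[of "y v"] unfolding xxy by (simp add: aba lin)
  show 4: "x (x (x (z (z v)))) = y (z v)"
    unfolding rel(2)[of "z v"] unfolding xxz by (simp add: aba lin)
  have "x (x (x (x (x v)))) = x (x (x (y (y v)))) + x (x (x (z (z v))))"
    using cube_cyclic[OF assms(1), of v, folded x_def y_def z_def] by (simp add: lin)
  then show "x (x (x (x (x v)))) = y (z v) - z (y v)"
    using 3 4 by simp
  \<comment> \<open>Two expressions for the same word contain \<open>y (z (x (x (x v))))\<close>
    with opposite signs; adding them eliminates it.\<close>
  have "x (x (x (y (z v)))) + x (x (x (y (z v)))) = y (y v) - x (x v) - z (z v)"
  proof -
    have "x (y (z v)) = - z (y (x v))"
      using d abc_anticomm[of i j k v] by (simp add: x_def y_def z_def)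
    then have "x (x (x (y (z v)))) = - x (x (z (y (x v))))"
      by (simp add: lin)
    also have "\<dots> = - y (z (x (x (x v)))) - x (x v)"
      by (simp add: rel(6) lin)
    finally have 1: "x (x (x (y (z v)))) = - y (z (x (x (x v)))) - x (x v)" .
    have "x (x (x (y (z v)))) = y (x (x (x (z v)))) - z (z v)"
      by (simp add: rel(1))
    also have "\<dots> = y (z (x (x (x v)))) + y (y v) - z (z v)"
      by (simp add: rel(2) lin)
    finally have 2: "x (x (x (y (z v)))) = y (z (x (x (x v)))) + y (y v) - z (z v)" .
    show ?thesis
      by (subst 1, subst 2) simp
  qed
  then show "x (x (x (y (z v)))) = s (1 / 2) (y (y v) - x (x v) - z (z v))"
    by (rule half)
  \<comment> \<open>The same elimination, now of \<open>z (y (x (x (x v))))\<close>.\<close>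
  have "x (x (x (z (y v)))) + x (x (x (z (y v)))) = x (x v) + y (y v) - z (z v)"
  proof -
    have 0: "z (y (x w)) = - x (y (z w))" for w
      using d abc_anticomm[of k j i w] by (simp add: x_def y_def z_def)
    have "x (x (x (z (y v)))) = x (y (z (x (x v)))) + x (x v)"
      by (simp add: rel(6) lin)
    also have "\<dots> = - z (y (x (x (x v)))) + x (x v)"
      by (simp add: 0)
    finally have 1: "x (x (x (z (y v)))) = - z (y (x (x (x v)))) + x (x v)" .
    have "x (x (x (z (y v)))) = z (x (x (x (y v)))) + y (y v)"
      by (simp add: rel(2))
    also have "\<dots> = z (y (x (x (x v)))) - z (z v) + y (y v)"
      by (simp add: rel(1) lin)
    finally have 2: "x (x (x (z (y v)))) = z (y (x (x (x v)))) - z (z v) + y (y v)" .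
    show ?thesis
      by (subst 1, subst 2) simp
  qed
  then show "x (x (x (z (y v)))) = s (1 / 2) (x (x v) + y (y v) - z (z v))"
    by (rule half)
qed

text \<open>The seventh power is expanded twice, with the relation for the fifth power applied to
  the inner and to the outer letters. In the sum all quartic words cancel and minus twice
  \<open>L i v\<close> remains.\<close>

lemma L_7: "L i (L i (L i (L i (L i (L i (L i v)))))) = - L i v"
proof -
  obtain j k where c: "cyclic i j k" using ex_cyclic by blast
  note rel = tetrad_cyclic[OF c]
  have "L i (L i (L i (L i (L i (L i (L i v)))))) + L i (L i (L i (L i (L i (L i (L i v)))))) =
      (L i (L i (L j (L k v))) - L i (L i (L k (L j v)))) +
      (L j (L k (L i (L i v))) - L k (L j (L i (L i v))))"
    using quintic_cyclic(5)[OF c, of v] quintic_cyclic(5)[OF c, of "L i (L i v)"] by simp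
  also have "\<dots> = - L i v + - L i v"
    by (simp add: rel(5,6))
  finally show ?thesis by (rule double_cancel)
qed

lemma S_pow3_L: "S (S (S (L i v))) = L i v"
  by (simp add: S_L L_7)

text \<open>Operator form of the product of \<open>so3 k\<close> with a matrix unit. Relative to the
  cyclic triple starting at \<open>k\<close> there are nine cases for \<open>i\<close> and
  \<open>j\<close>, each read off from \<open>quintic_cyclic\<close>.\<close>

lemma L_F: "S (L k (F i j v)) = (\<Sum>m\<in>UNIV. s (eps k i m) (F m j v))"
proof -
  obtain a b where c: "cyclic k a b" using ex_cyclic by blast
  then have d: "k \<noteq> a" "a \<noteq> b" "k \<noteq> b" by auto
  have ij: "i \<in> {k, a, b}" "j \<in> {k, a, b}"
    using d exhaust_3[of k] exhaust_3[of a] exhaust_3[of b] exhaust_3[of i] exhaust_3[of j] by auto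
  note q = quintic_cyclic[OF c]
  have eps: "eps k a b = 1" "eps k b a = - 1" "eps u u w = 0" "eps u w u = 0" "eps w u u = 0"
    for u w using c by (auto simp: eps_def)
  have U: "(UNIV :: 3 set) = {k, a, b}"
    using c UNIV_3 by auto
  \<comment> \<open>Subtracting half of the sum of squares gives exactly the shape with factor 1/2
    in which \<open>quintic_cyclic\<close> is stated.\<close>
  have diag: "F u u v = s (1 / 2) (L u (L u v) - L v1 (L v1 v) - L v2 (L v2 v))"
    if "cyclic u v1 v2" for u v1 v2
  proof -
    have "w - s (1 / 2) w = s (1 / 2) w" for w
    proof -
      have "w = s (1 / 2) w + s (1 / 2) w"
        by (simp flip: V.scale_left_distrib)
      then show ?thesis by (metis add_diff_cancel_right')
    qed
    then have half: "w - s (1 / 2) (w + p + q) = s (1 / 2) (w - p - q)" for w p q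
      by (simp add: V.scale_right_distrib V.scale_right_diff_distrib flip: diff_diff_eq)
    have "F u u v = L u (L u v) - s (1 / 2) (L u (L u v) + L v1 (L v1 v) + L v2 (L v2 v))"
      by (simp add: F_def kron_def S_cyclic[OF that])
    then show ?thesis
      by (simp add: half)
  qed
  have F: "u \<noteq> w \<Longrightarrow> F u w v = L w (L u v)" for u w
    by (simp add: F_def kron_def)
  have SLF: "S (L k (F u w v)) = - L k (L k (L k (L w (L u v)))) + s (kron u w) (L k (L k (L k (L k (L k v)))))"
    for u w
    by (simp add: F_def S_L L_S)
  show ?thesis
    unfolding SLF using ij d
    by (elim insertE emptyE; hypsubst)
      (simp_all add: U eps diag[OF c] diag[OF cyclic_rotate[OF c]]
        diag[OF cyclic_rotate[OF cyclic_rotate[OF c]]] F q kron_def aba_eq_0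
        V.scale_right_distrib V.scale_right_diff_distrib)
qed

text \<open>Only two summands survive; their difference is \<open>S\<close> applied to a commutator,
  which is the fifth power of \<open>L k\<close>, and \<open>L_7\<close> finishes. The formula shows
  that the vectors \<open>F i j v\<close> cannot all vanish unless \<open>L k v\<close>
  does.\<close>

lemma L_eq_S_F: "L k v = (\<Sum>i\<in>UNIV. \<Sum>m\<in>UNIV. s (eps k i m) (S (F m i v)))"
proof -
  obtain a b where c: "cyclic k a b" using ex_cyclic by blast
  have "(\<Sum>i\<in>UNIV. \<Sum>m\<in>UNIV. s (eps k i m) (S (F m i v))) = S (F b a v) - S (F a b v)"
    using c by (auto simp: sum_3 eps_def)
  also have "\<dots> = S (L a (L b v) - L b (L a v))"
    using c by (auto simp: F_def kron_def)
  also have "\<dots> = S (L k (L k (L k (L k (L k v)))))"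
    using quintic_cyclic(5)[OF c, of v] by simp
  also have "\<dots> = L k v"
    by (simp add: S_L L_7)
  finally show ?thesis by simp
qed

end

section \<open>Skew-symmetric matrices and their twisted representations\<close>

definition so3 :: "3 \<Rightarrow> 'a::comm_ring_1^3^3" where
  "so3 k = (\<chi> m i. eps k i m)"

text \<open>The identity for a double cross product, in matrix form.\<close>

lemma so3_mult: "so3 a ** so3 b = (\<chi> m i. kron m b * kron i a - kron a b * kron m i)"
proof -
  have "(\<Sum>p\<in>UNIV. eps a p m * eps b i p) = (kron m b * kron i a - kron a b * kron m i :: 'a)"
    for a b m i :: 3
  proof -
    have "\<forall>a b m i. (\<Sum>p\<in>UNIV. eps a p m * eps b i p) = (kron m b * kron i a - kron a b * kron m i :: 'a)"
      by (simp add: forall_3 sum_3 eps_def kron_def)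
    then show ?thesis by blast
  qed
  then show ?thesis
    by (simp add: so3_def matrix_matrix_mult_def)
qed

lemma sum_eps_eps:
  "(\<Sum>e\<in>UNIV. eps b c e * eps e i m) = (kron m c * kron i b - kron m b * kron i c :: 'a::comm_ring_1)"
proof -
  have "\<forall>b c i m. (\<Sum>e\<in>UNIV. eps b c e * eps e i m) = (kron m c * kron i b - kron m b * kron i c :: 'a)"
    by (simp add: forall_3 sum_3 eps_def kron_def)
  then show ?thesis by blast
qed

lemma sum_kron:
  "(\<Sum>p\<in>UNIV. kron m p * f p) = (f m :: 'a::comm_ring_1)" "(\<Sum>p\<in>UNIV. kron p m * f p) = f m"
  by (simp_all add: kron_def if_distrib[of "\<lambda>x. x * _"] cong: if_cong)

lemma kron_commute: "kron a b = kron b a"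
  by (auto simp: kron_def)

lemma so3_mult4: "so3 a ** so3 b ** so3 c ** so3 d =
  ((\<chi> m i. kron a d * (kron m b * kron i c) - kron c d * (kron m b * kron i a)
    - kron a b * (kron m d * kron i c) + kron a b * (kron c d * kron m i)) :: 'a::comm_ring_1^3^3)"
proof -
  have sum: "(\<Sum>p\<in>UNIV. (kron m b * kron p a - kron a b * kron m p) *
      (kron p d * kron i c - kron c d * kron p i)) =
    kron m b * (kron a d * kron i c - kron c d * kron i a) -
    kron a b * (kron m d * kron i c - kron c d * kron m i :: 'a)" for m i
  proof -
    have "(\<Sum>p\<in>UNIV. (kron m b * kron p a - kron a b * kron m p) *
        (kron p d * kron i c - kron c d * kron p i :: 'a)) =
      (\<Sum>p\<in>UNIV. kron p a * (kron m b * (kron p d * kron i c - kron c d * kron p i))) -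
      (\<Sum>p\<in>UNIV. kron m p * (kron a b * (kron p d * kron i c - kron c d * kron p i)))"
      by (simp add: algebra_simps flip: sum_subtractf)
    then show ?thesis
      by (simp only: sum_kron kron_commute[of a i])
  qed
  have assoc: "so3 a ** so3 b ** so3 c ** so3 d = (so3 a ** so3 b) ** (so3 c ** so3 d :: 'a^3^3)"
    by (simp only: matrix_mul_assoc)
  show ?thesis
    unfolding assoc unfolding so3_mult
    by (simp only: matrix_matrix_mult_def vec_lambda_beta sum) (simp add: algebra_simps)
qed

text \<open>In \<open>so3_mult4\<close> the multiple of the identity is unchanged by reversing the
  word and drops out. The other terms pair up to antisymmetric differences of matrix units, which
  \<open>sum_eps_eps\<close> turns into cross products.\<close>

lemma anti_tetrad_so3:
  "anti_tetrad (so3 a) (so3 b) (so3 c) (so3 d) =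
    (\<Sum>e\<in>UNIV. mscale (- (kron a d * eps b c e + kron c d * eps a b e + kron a b * eps c d e))
      (so3 e :: 'a::comm_ring_1^3^3))"
proof -
  have sum: "(\<Sum>e\<in>UNIV. - (kron a d * eps b c e + kron c d * eps a b e + kron a b * eps c d e) * eps e i m) =
    - (kron a d * (kron m c * kron i b - kron m b * kron i c)
      + kron c d * (kron m b * kron i a - kron m a * kron i b)
      + kron a b * (kron m d * kron i c - kron m c * kron i d) :: 'a)" for i m
    unfolding sum_eps_eps[symmetric] sum_distrib_left sum.distrib[symmetric] sum_negf[symmetric]
    by (rule sum.cong) (simp_all add: algebra_simps)
  have comm: "kron d c = (kron c d :: 'a)" "kron b a = (kron a b :: 'a)" "kron d a = (kron a d :: 'a)"
    by (simp_all only: kron_commute)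
  show ?thesis
    unfolding vec_eq_iff anti_tetrad_def so3_mult4
    by (simp add: mscale_def map_matrix_def so3_def sum_component sum[simplified] comm)
      (simp add: algebra_simps)
qed

text \<open>Coordinates with respect to \<open>so3\<close>: for each \<open>k\<close> the entry is
  taken where \<open>so3 k\<close> is 1.\<close>

definition axial :: "3 \<Rightarrow> 'a^3^3 \<Rightarrow> 'a" where
  "axial k A = (if k = 1 then A $ 3 $ 2 else if k = 2 then A $ 1 $ 3 else A $ 2 $ 1)"

lemma so3_skew: "so3 k \<in> skew_matrices"
  by (simp add: skew_matrices_def so3_def transpose_def vec_eq_iff forall_3 eps_def)

lemma skew_eq_sum_so3:
  fixes A :: "'a::field_char_0^3^3"
  assumes "A \<in> skew_matrices"
  shows "A = (\<Sum>k\<in>UNIV. mscale (axial k A) (so3 k))"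
proof -
  have skew: "A $ j $ i = - A $ i $ j" for i j
  proof -
    have "transpose A = - A"
      using assms by (simp add: skew_matrices_def)
    from arg_cong[OF this, of "\<lambda>B. B $ i $ j"] show ?thesis
      by (simp add: transpose_def)
  qed
  have diag: "A $ i $ i = 0" for i
    using skew[of i i] by simp
  show ?thesis
    using skew[of 1 2] skew[of 3 1] skew[of 2 3]
    by (simp add: diag vec_eq_iff forall_3 sum_3 mscale_def so3_def eps_def axial_def)
qed

lemma of_rat_eps_kron [simp]: "of_rat (eps i j k) = eps i j k" "of_rat (kron i j) = kron i j"
  by (simp_all add: eps_def kron_def)

context
  fixes s :: "'k::field_char_0 \<Rightarrow> 'v::ab_group_add \<Rightarrow> 'v" and \<rho>
  assumes rep: "quad_rep (skew_matrices :: (rat^3^3) set) s \<rho>"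
begin

interpretation V: vector_space s
  using rep by (simp add: quad_rep_def)

lemma quad_rep_sum_so3:
  "\<rho> (\<Sum>k\<in>UNIV. mscale (q k) (so3 k)) v = (\<Sum>k\<in>UNIV. s (of_rat (q k)) (\<rho> (so3 k) v))"
proof -
  note skew = mat_vs.subspace_scale[OF subspace_skew_matrices so3_skew]
    mat_vs.subspace_add[OF subspace_skew_matrices]
  show ?thesis
    using rep by (simp add: quad_rep_def sum_3 skew so3_skew)
qed

lemma quad_rep_skew:
  assumes "A \<in> skew_matrices"
  shows "\<rho> A v = (\<Sum>k\<in>UNIV. s (of_rat (axial k A)) (\<rho> (so3 k) v))"
  using quad_rep_sum_so3[of "\<lambda>k. axial k A"] skew_eq_sum_so3[OF assms] by simp

lemma tetrad_operators_quad_rep: "tetrad_operators s (\<lambda>k. \<rho> (so3 k))"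
proof (intro tetrad_operators.intro tetrad_operators_axioms.intro V.vector_space_axioms)
  show "Vector_Spaces.linear s s (\<rho> (so3 a))" for a
    using rep so3_skew unfolding quad_rep_def by blast
  show "\<rho> (so3 a) (\<rho> (so3 b) (\<rho> (so3 c) (\<rho> (so3 d) v))) - \<rho> (so3 d) (\<rho> (so3 c) (\<rho> (so3 b) (\<rho> (so3 a) v))) =
      - (\<Sum>e\<in>UNIV. s (kron a d * eps b c e + kron c d * eps a b e + kron a b * eps c d e) (\<rho> (so3 e) v))"
    for a b c d v
  proof -
    have "\<rho> (so3 a) (\<rho> (so3 b) (\<rho> (so3 c) (\<rho> (so3 d) v))) - \<rho> (so3 d) (\<rho> (so3 c) (\<rho> (so3 b) (\<rho> (so3 a) v))) =
        \<rho> (anti_tetrad (so3 a) (so3 b) (so3 c) (so3 d)) v"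
      using rep by (simp add: quad_rep_def so3_skew)
    also have "\<dots> = - (\<Sum>e\<in>UNIV. s (kron a d * eps b c e + kron c d * eps a b e + kron a b * eps c d e) (\<rho> (so3 e) v))"
      unfolding anti_tetrad_so3 quad_rep_sum_so3
      by (simp add: of_rat_add of_rat_mult of_rat_diff of_rat_minus
          flip: sum_negf V.scale_minus_left)
    finally show ?thesis .
  qed
qed

end

definition twisted_rep :: "'k::field_char_0 \<Rightarrow> rat^3^3 \<Rightarrow> 'k^3 \<Rightarrow> 'k^3" where
  "twisted_rep l A v = l *s natural_rep A v"

lemma twisted_rep_1: "twisted_rep 1 = natural_rep"
  by (simp add: twisted_rep_def fun_eq_iff)

abbreviation of_rat_matrix :: "rat^'n^'m \<Rightarrow> 'k::field_char_0^'n^'m" where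
  "of_rat_matrix \<equiv> map_matrix of_rat"

lemma of_rat_matrix_simps:
  "of_rat_matrix (A ** B) = of_rat_matrix A ** of_rat_matrix B"
  "of_rat_matrix (A + B) = of_rat_matrix A + of_rat_matrix B"
  "of_rat_matrix (A - B) = of_rat_matrix A - of_rat_matrix B"
  "of_rat_matrix (mscale q A) = mscale (of_rat q) (of_rat_matrix A)"
  "of_rat_matrix (so3 k) = so3 k"
  by (simp_all add: vec_eq_iff map_matrix_def matrix_matrix_mult_def of_rat_sum of_rat_mult
      of_rat_add of_rat_diff mscale_def so3_def)

lemma mscale_mult: "mscale q A *v v = q *s (A *v v)" for A :: "'a::field^'n^'m"
  by (simp add: vec_eq_iff mscale_def matrix_vector_mult_def sum_distrib_left mult.assoc)

lemma quad_rep_twisted: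
  fixes l :: "'k::field_char_0"
  assumes "l ^ 4 = l"
  shows "quad_rep skew_matrices (*s) (twisted_rep l)"
proof -
  have "Vector_Spaces.linear (*s) (*s) (twisted_rep l A)" for A
    unfolding twisted_rep_def natural_rep_def
    by unfold_locales (simp_all add: vec.scale_right_distrib matrix_vector_right_distrib
        vector_scalar_commute mult.commute)
  moreover have "twisted_rep l (anti_tetrad a b c d) v =
      twisted_rep l a (twisted_rep l b (twisted_rep l c (twisted_rep l d v))) -
      twisted_rep l d (twisted_rep l c (twisted_rep l b (twisted_rep l a v)))" for a b c d v
  proof -
    have l: "l * (l * (l * l)) = l"
      using assms by (simp only: power4_eq_xxxx mult.assoc)
    show ?thesis
      by (simp add: l twisted_rep_def natural_rep_def anti_tetrad_def of_rat_matrix_simps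
          vector_scalar_commute matrix_vector_mult_diff_rdistrib matrix_vector_mul_assoc
          matrix_mul_assoc vec.scale_right_diff_distrib)
  qed
  ultimately show ?thesis
    by (simp add: quad_rep_def vec.vector_space_axioms twisted_rep_def natural_rep_def
        of_rat_matrix_simps matrix_vector_mult_add_rdistrib vec.scale_right_distrib mscale_mult
        mult.commute)
qed

lemma twisted_rep_so3: "twisted_rep l (so3 k) v = (\<chi> m. l * (\<Sum>i\<in>UNIV. eps k i m * v $ i))"
  by (simp add: twisted_rep_def natural_rep_def of_rat_matrix_simps so3_def vec_eq_iff
      matrix_vector_mult_def)

lemma fin_dim_irrep_twisted:
  fixes l :: "'k::field_char_0"
  assumes "l ^ 3 = 1"
  shows "fin_dim_irrep skew_matrices (*s) (twisted_rep l)"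
  unfolding fin_dim_irrep_def
proof (intro conjI allI impI)
  have l: "l \<noteq> 0" using assms by auto
  show "quad_rep skew_matrices (*s) (twisted_rep l)"
    using assms by (intro quad_rep_twisted) (simp add: eval_nat_numeral)
  show "finite_dim ((*s) :: 'k \<Rightarrow> 'k^3 \<Rightarrow> _)"
    unfolding finite_dim_def
    by (rule exI[of _ cart_basis]) (simp add: finite_cart_basis span_cart_basis)
  have "axis 1 (1::'k) \<noteq> (0 :: 'k^3)" by (simp add: axis_eq_0_iff)
  then show "(UNIV :: ('k^3) set) \<noteq> {0}" by (metis UNIV_I singletonD)
  fix W :: "('k^3) set"
  assume W: "vec.subspace W \<and> (\<forall>a\<in>skew_matrices. twisted_rep l a ` W \<subseteq> W)"
  have so3: "so3 k *v w \<in> W" if "w \<in> W" for k w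
  proof -
    have "twisted_rep l (so3 k) w \<in> W" using W that so3_skew by blast
    then have "inverse l *s twisted_rep l (so3 k) w \<in> W"
      using W vec.subspace_scale by blast
    then show ?thesis
      using l by (simp add: twisted_rep_def natural_rep_def of_rat_matrix_simps)
  qed
  \<comment> \<open>\<open>so3 j ** so3 i\<close> plus \<open>kron i j\<close> times the identity is
    a matrix unit, so it isolates one coordinate of \<open>w\<close> and places it anywhere.\<close>
  have unit: "w $ j *s axis i 1 \<in> W" if "w \<in> W" for w :: "'k^3" and i j
  proof -
    have "so3 j *v (so3 i *v w) + kron i j *s w \<in> W"
      using W that so3 by (simp add: vec.subspace_add vec.subspace_scale)
    also have "so3 j *v (so3 i *v w) + kron i j *s w = w $ j *s axis i 1"
    proof -
      have "(\<Sum>p\<in>UNIV. (kron m i * kron p j - kron j i * kron m p) * w $ p) =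
          (\<Sum>p\<in>UNIV. kron p j * (kron m i * w $ p)) - (\<Sum>p\<in>UNIV. kron m p * (kron j i * w $ p))" for m
        by (simp add: algebra_simps flip: sum_subtractf)
      then show ?thesis
        unfolding matrix_vector_mul_assoc so3_mult
        by (simp add: matrix_vector_mult_def vec_eq_iff sum_kron) (simp add: axis_def kron_def)
    qed
    finally show ?thesis .
  qed
  show "W = {0} \<or> W = UNIV"
  proof (cases "\<exists>w\<in>W. w \<noteq> 0")
    case True
    then obtain w :: "'k^3" and j where w: "w \<in> W" "w $ j \<noteq> 0" by (auto simp: vec_eq_iff)
    have "axis i 1 \<in> W" for i
    proof -
      have "inverse (w $ j) *s (w $ j *s axis i 1) \<in> W"
        using vec.subspace_scale unit[OF w(1)] W by blast
      then show ?thesis using w(2) by simp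
    qed
    then have "cart_basis \<subseteq> W" by (auto simp: cart_basis_def)
    then have "vec.span cart_basis \<subseteq> W" using W vec.span_minimal by blast
    then show ?thesis by (simp add: span_cart_basis top.extremum_unique)
  next
    case False
    moreover have "0 \<in> W" using W by (simp add: vec.subspace_def)
    ultimately show ?thesis by blast
  qed
qed

section \<open>Classification of the irreducible representations\<close>

lemma quad_rep_subspace_iff:
  assumes "quad_rep (skew_matrices :: (rat^3^3) set) s \<rho>" "module.subspace s W"
  shows "(\<forall>a\<in>skew_matrices. \<rho> a ` W \<subseteq> W) \<longleftrightarrow> (\<forall>k. \<forall>w\<in>W. \<rho> (so3 k) w \<in> W)"
proof -
  interpret V: vector_space s
    using assms by (simp add: quad_rep_def)
  have "\<rho> a w \<in> W" if "\<forall>k. \<forall>w\<in>W. \<rho> (so3 k) w \<in> W" "w \<in> W" "a \<in> skew_matrices" for a w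
    unfolding quad_rep_skew[OF assms(1) that(3)]
    using that(1,2) assms(2) by (intro V.subspace_sum V.subspace_scale) auto
  then show ?thesis
    using so3_skew by blast
qed

lemma intertwining_skew:
  fixes \<rho> \<sigma> :: "rat^3^3 \<Rightarrow> _"
  assumes "quad_rep skew_matrices s \<rho>" "quad_rep skew_matrices t \<sigma>"
    and "Vector_Spaces.linear s t f"
    and "\<And>k v. f (\<rho> (so3 k) v) = \<sigma> (so3 k) (f v)" "a \<in> skew_matrices"
  shows "f (\<rho> a v) = \<sigma> a (f v)"
proof -
  interpret f: Vector_Spaces.linear s t f by (rule assms)
  show ?thesis
    by (simp add: quad_rep_skew[OF assms(1,5)] quad_rep_skew[OF assms(2,5)] f.sum f.scale assms(4))
qed

text \<open>Schur's lemma: kernel and range of the intertwiner are invariant, so a nonzero one is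
  bijective. Intertwining is checked on the \<open>so3 k\<close> only and extended by
  \<open>intertwining_skew\<close>.\<close>

lemma irrep_intertwining_equiv:
  fixes \<rho> :: "rat^3^3 \<Rightarrow> 'v::ab_group_add \<Rightarrow> 'v" and \<sigma> :: "rat^3^3 \<Rightarrow> 'w::ab_group_add \<Rightarrow> 'w"
  assumes \<rho>: "fin_dim_irrep skew_matrices s \<rho>" and \<sigma>: "fin_dim_irrep skew_matrices t \<sigma>"
    and f: "Vector_Spaces.linear s t f"
    and intertwines: "\<And>k v. f (\<rho> (so3 k) v) = \<sigma> (so3 k) (f v)"
    and nonzero: "f u \<noteq> 0"
  shows "rep_equiv skew_matrices s \<rho> t \<sigma>"
proof -
  interpret V: vector_space s using \<rho> by (simp add: fin_dim_irrep_def quad_rep_def)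
  interpret W: vector_space t using \<sigma> by (simp add: fin_dim_irrep_def quad_rep_def)
  interpret f: Vector_Spaces.linear s t f by (rule f)
  have irr: "W = {0} \<or> W = UNIV" if "module.subspace s W" "\<And>k w. w \<in> W \<Longrightarrow> \<rho> (so3 k) w \<in> W" for W
    using that \<rho> quad_rep_subspace_iff[of s \<rho> W] unfolding fin_dim_irrep_def by blast
  have irr': "W = {0} \<or> W = UNIV" if "module.subspace t W" "\<And>k w. w \<in> W \<Longrightarrow> \<sigma> (so3 k) w \<in> W" for W
    using that \<sigma> quad_rep_subspace_iff[of t \<sigma> W] unfolding fin_dim_irrep_def by blast
  have "\<sigma> (so3 k) 0 = 0" for k
    using intertwines[of k 0] tetrad_operators.L_simps(4)[OF tetrad_operators_quad_rep, of s \<rho> k] \<rho>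
    by (simp add: fin_dim_irrep_def f.zero)
  then have "{v. f v = 0} = {0} \<or> {v. f v = 0} = UNIV"
    by (intro irr) (simp_all add: V.subspace_def f.zero f.add f.scale intertwines)
  then have "inj f"
    using nonzero f.inj_iff_eq_0 by blast
  moreover have "range f = {0} \<or> range f = UNIV"
  proof (rule irr')
    show "W.subspace (range f)"
      using f.subspace_image[of UNIV] V.subspace_UNIV by simp
  qed (auto simp flip: intertwines)
  ultimately have "bij f"
    using nonzero by (auto simp: bij_def)
  moreover have "f (\<rho> a v) = \<sigma> a (f v)" if "a \<in> skew_matrices" for a v
  proof (rule intertwining_skew[of s \<rho> t \<sigma> f])
    show "quad_rep skew_matrices s \<rho>" "quad_rep skew_matrices t \<sigma>"
      using \<rho> \<sigma> by (simp_all only: fin_dim_irrep_def)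
  qed (fact f intertwines that)+
  ultimately show ?thesis
    using f unfolding rep_equiv_def by blast
qed

lemma fin_dim_irrep_trivial:
  "fin_dim_irrep (skew_matrices :: (rat^3^3) set) (*) (trivial_rep :: _ \<Rightarrow> 'k::field_char_0 \<Rightarrow> 'k)"
  unfolding fin_dim_irrep_def
proof (intro conjI allI impI)
  have "Vector_Spaces.linear (*) (*) (\<lambda>v :: 'k. 0 :: 'k)"
    by unfold_locales simp_all
  then show "quad_rep (skew_matrices :: (rat^3^3) set) (*) (trivial_rep :: _ \<Rightarrow> 'k \<Rightarrow> 'k)"
    by (simp add: quad_rep_def vector_space_over_itself.vector_space_axioms trivial_rep_def[abs_def])
  have full: "W = UNIV" if "vector_space_over_itself.subspace W" "w \<in> W" "w \<noteq> 0" for W and w :: 'k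
  proof -
    have "x \<in> W" for x
      using vector_space_over_itself.subspace_scale[OF that(1,2), of "x / w"] that(3) by simp
    then show ?thesis by blast
  qed
  have "vector_space_over_itself.span {1 :: 'k} = UNIV"
    by (rule full[where w = 1])
      (simp_all add: vector_space_over_itself.subspace_span vector_space_over_itself.span_base)
  then show "finite_dim ((*) :: 'k \<Rightarrow> 'k \<Rightarrow> 'k)"
    unfolding finite_dim_def by (intro exI[of _ "{1}"]) simp
  show "(UNIV :: 'k set) \<noteq> {0}"
    by (metis UNIV_I singletonD zero_neq_one)
  fix W :: "'k set"
  assume "vector_space_over_itself.subspace W \<and> (\<forall>a\<in>(skew_matrices :: (rat^3^3) set). trivial_rep a ` W \<subseteq> W)"
  then show "W = {0} \<or> W = UNIV"
    using full vector_space_over_itself.subspace_0 by blast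
qed

lemma trivial_not_equiv_twisted:
  fixes l :: "'k::field_char_0"
  assumes "l \<noteq> 0"
  shows "\<not> rep_equiv (skew_matrices :: (rat^3^3) set) (*) (trivial_rep :: _ \<Rightarrow> 'k \<Rightarrow> 'k) (*s) (twisted_rep l)"
proof
  assume "rep_equiv (skew_matrices :: (rat^3^3) set) (*) (trivial_rep :: _ \<Rightarrow> 'k \<Rightarrow> 'k) (*s) (twisted_rep l)"
  then obtain f :: "'k \<Rightarrow> 'k^3" where f: "Vector_Spaces.linear (*) (*s) f" "bij f"
    "\<And>a v. a \<in> (skew_matrices :: (rat^3^3) set) \<Longrightarrow> f (trivial_rep a v) = twisted_rep l a (f v)"
    unfolding rep_equiv_def by blast
  interpret f: Vector_Spaces.linear "(*)" "(*s)" f by (rule f)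
  \<comment> \<open>\<open>so3 1\<close> sends the second unit vector to the third, whereas an
    equivalence with the trivial representation would annihilate it.\<close>
  obtain v where "f v = axis 2 1"
    using f(2) by (metis bij_pointE)
  then have "twisted_rep l (so3 1) (axis 2 1) = 0"
    using f(3)[OF so3_skew, of 1 v] by (simp add: trivial_rep_def f.zero)
  then have "twisted_rep l (so3 1) (axis 2 1) $ 3 = 0"
    by simp
  then show False
    using assms by (simp add: twisted_rep_so3 sum_3 eps_def axis_def)
qed

text \<open>The sum of squares of the generators acts by the scalar \<open>- 2 * l^2\<close>, an
  invariant of the equivalence class, and \<open>l = l^4\<close> recovers \<open>l\<close> from its
  square.\<close>

lemma twisted_not_equiv:
  fixes l l' :: "'k::field_char_0"
  assumes "l ^ 3 = 1" "l' ^ 3 = 1" "l \<noteq> l'"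
  shows "\<not> rep_equiv (skew_matrices :: (rat^3^3) set) (*s) (twisted_rep l) (*s) (twisted_rep l')"
proof
  assume "rep_equiv (skew_matrices :: (rat^3^3) set) (*s) (twisted_rep l) (*s) (twisted_rep l')"
  then obtain f :: "'k^3 \<Rightarrow> 'k^3" where f: "Vector_Spaces.linear (*s) (*s) f" "bij f"
    "\<And>a v. a \<in> (skew_matrices :: (rat^3^3) set) \<Longrightarrow> f (twisted_rep l a v) = twisted_rep l' a (f v)"
    unfolding rep_equiv_def by blast
  interpret f: Vector_Spaces.linear "(*s)" "(*s)" f by (rule f)
  have casimir: "(\<Sum>k\<in>UNIV. twisted_rep l (so3 k) (twisted_rep l (so3 k) v)) = (- 2 * l^2) *s v"
    for l :: 'k and v
    by (simp add: twisted_rep_so3 sum_3 eps_def vec_eq_iff forall_3 power2_eq_square algebra_simps)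
  have "f ((- 2 * l^2) *s v) = (- 2 * l'^2) *s f v" for v
    by (simp only: casimir[symmetric] f.sum f(3)[OF so3_skew])
  then have eq: "(- 2 * l^2) *s f v = (- 2 * l'^2) *s f v" for v
    by (simp only: f.scale)
  obtain v where "f v = axis 1 1"
    using f(2) by (metis bij_pointE)
  then have "((- 2 * l^2) *s axis 1 1) $ (1::3) = ((- 2 * l'^2) *s axis 1 1) $ (1::3)"
    using eq[of v] by simp
  then have "l^2 = l'^2" by simp
  then have "l * l^3 = l' * l'^3"
    by (metis power_commutes power_mult_distrib power2_eq_square power3_eq_cube mult.assoc)
  then show False using assms by simp
qed

context tetrad_operators
begin

context
  fixes \<omega> :: 'k
  assumes \<omega>: "\<omega>\<^sup>2 + \<omega> + 1 = 0"
    and irreducible: "\<And>W. V.subspace W \<Longrightarrow> (\<And>k w. w \<in> W \<Longrightarrow> L k w \<in> W) \<Longrightarrow> W = {0} \<or> W = UNIV"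
    and nonzero: "(UNIV :: 'v set) \<noteq> {0}"
begin

text \<open>The common kernel of the \<open>L k\<close> is invariant. If it is zero, then
  \<open>S\<close> cubed is the identity, since the difference is killed by every
  \<open>L k\<close>. Applying the factors of \<open>S\<close> cubed minus 1 to a nonzero vector one
  after another, the last nonzero result is an eigenvector; its eigenspace is invariant because
  \<open>S\<close> is central.\<close>

lemma irreducible_zero_or_scalar:
  "(\<forall>k v. L k v = 0) \<or> (\<exists>\<mu>\<in>{1, \<omega>, \<omega>\<^sup>2}. \<forall>v. S v = s \<mu> v)"
proof -
  have "{v. \<forall>k. L k v = 0} = {0} \<or> {v. \<forall>k. L k v = 0} = UNIV"
    by (rule irreducible) (simp_all add: V.subspace_def)
  moreover have "\<exists>\<mu>\<in>{1, \<omega>, \<omega>\<^sup>2}. \<forall>v. S v = s \<mu> v" if "{v. \<forall>k. L k v = 0} = {0}"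
  proof -
    have S3: "S (S (S v)) = v" for v
    proof -
      have "S (S (S v)) - v \<in> {v. \<forall>k. L k v = 0}"
        by (simp add: L_S_commute S_pow3_L)
      then show ?thesis unfolding that by simp
    qed
    have cubic: "S (S (S v - v) - s \<omega> (S v - v)) = s (\<omega>\<^sup>2) (S (S v - v) - s \<omega> (S v - v))" for v
    proof -
      have w2: "\<omega>\<^sup>2 = - \<omega> - 1" and w3: "\<omega> * \<omega> = - \<omega> - 1"
        using \<omega> by (simp_all add: power2_eq_square eq_neg_iff_add_eq_0 algebra_simps)
      show ?thesis
        by (simp add: S3 w2 w3 V.scale_left_diff_distrib V.scale_right_diff_distrib
            V.scale_left_distrib algebra_simps)
    qed
    obtain v :: 'v where v: "v \<noteq> 0" using nonzero by auto
    have "\<exists>\<mu>\<in>{1, \<omega>, \<omega>\<^sup>2}. \<exists>u. u \<noteq> 0 \<and> S u = s \<mu> u"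
    proof (cases "S v - v = 0")
      case True
      then show ?thesis using v by (intro bexI[of _ 1] exI[of _ v]) simp_all
    next
      case 1: False
      show ?thesis
      proof (cases "S (S v - v) - s \<omega> (S v - v) = 0")
        case True
        then show ?thesis using 1 by (intro bexI[of _ \<omega>] exI[of _ "S v - v"]) (simp_all del: S_simps)
      next
        case False
        then show ?thesis using cubic
          by (intro bexI[of _ "\<omega>\<^sup>2"] exI[of _ "S (S v - v) - s \<omega> (S v - v)"]) (simp_all del: S_simps)
      qed
    qed
    then obtain \<mu> u where \<mu>: "\<mu> \<in> {1, \<omega>, \<omega>\<^sup>2}" and u: "u \<noteq> 0" "S u = s \<mu> u" by blast
    have "{v. S v = s \<mu> v} = {0} \<or> {v. S v = s \<mu> v} = UNIV"
      by (rule irreducible)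
        (simp_all add: V.subspace_def V.scale_right_distrib mult.commute L_S_commute[symmetric])
    then have "\<forall>v. S v = s \<mu> v" using u by blast
    then show ?thesis using \<mu> by blast
  qed
  ultimately show ?thesis by blast
qed

end

text \<open>In \<open>L_F\<close> the operator \<open>S\<close> is the scalar \<open>l^2\<close>,
  whose inverse is \<open>l\<close>; this turns it into the transformation law of the unit vectors
  under \<open>twisted_rep l\<close>. The argument of \<open>f\<close> on the left of the second
  conclusion is \<open>twisted_rep l (so3 k) c\<close> written out.\<close>

lemma intertwiner_from_scalar:
  assumes S: "\<And>v. S v = s (l\<^sup>2) v" and l: "l ^ 3 = 1" and nonzero: "L k v \<noteq> 0"
  obtains f where "Vector_Spaces.linear (*s) s f"
    "\<And>k c. f (\<chi> m. l * (\<Sum>i\<in>UNIV. eps k i m * c $ i)) = L k (f c)" "\<exists>u. f u \<noteq> 0"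
proof -
  have l4: "l * l\<^sup>2 = 1" using l by (simp add: power3_eq_cube power2_eq_square mult.assoc)
  have "\<exists>i j. F i j v \<noteq> 0"
  proof (rule ccontr)
    assume "\<not> ?thesis"
    then have "L k v = 0" by (simp add: L_eq_S_F)
    then show False using nonzero by simp
  qed
  then obtain i0 j where ij: "F i0 j v \<noteq> 0" by blast
  have LF: "L k (F i j v) = s l (\<Sum>m\<in>UNIV. s (eps k i m) (F m j v))" for k i
  proof -
    have "s (l * l\<^sup>2) (L k (F i j v)) = s l (\<Sum>m\<in>UNIV. s (eps k i m) (F m j v))"
      unfolding L_F[symmetric] S by simp
    then show ?thesis by (simp add: l4)
  qed
  define f where "f c = (\<Sum>i\<in>UNIV. s (c $ i) (F i j v))" for c :: "'k^3"
  show thesis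
  proof
    show "Vector_Spaces.linear (*s) s f"
      unfolding f_def
      by unfold_locales (simp_all add: V.scale_left_distrib V.scale_right_distrib sum.distrib V.scale_sum_right)
    show "f (\<chi> m. l * (\<Sum>i\<in>UNIV. eps k i m * c $ i)) = L k (f c)" for k c
    proof -
      have "f (\<chi> m. l * (\<Sum>i\<in>UNIV. eps k i m * c $ i)) =
          (\<Sum>m\<in>UNIV. \<Sum>i\<in>UNIV. s (l * eps k i m * c $ i) (F m j v))"
        by (simp add: f_def sum_distrib_left V.scale_sum_left mult.assoc)
      also have "\<dots> = (\<Sum>i\<in>UNIV. \<Sum>m\<in>UNIV. s (l * eps k i m * c $ i) (F m j v))"
        by (rule sum.swap)
      also have "\<dots> = (\<Sum>i\<in>UNIV. s (c $ i) (L k (F i j v)))"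
        by (simp add: LF V.scale_sum_right mult_ac)
      also have "\<dots> = L k (f c)"
        by (simp add: f_def sum_3)
      finally show ?thesis .
    qed
    have "f (axis i0 1) = F i0 j v"
      by (simp add: f_def axis_def if_distrib[of "\<lambda>x. s x _"] cong: if_cong)
    then show "\<exists>u. f u \<noteq> 0" using ij by metis
  qed
qed

end

lemma irrep_classification:
  fixes s :: "'k::field_char_0 \<Rightarrow> 'v::ab_group_add \<Rightarrow> 'v"
  assumes \<sigma>: "fin_dim_irrep (skew_matrices :: (rat^3^3) set) s \<sigma>" and \<omega>: "\<omega>\<^sup>2 + \<omega> + 1 = 0"
  shows "rep_equiv skew_matrices (*) trivial_rep s \<sigma> \<or>
    (\<exists>l\<in>{1, \<omega>, \<omega>\<^sup>2}. rep_equiv skew_matrices (*s) (twisted_rep l) s \<sigma>)"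
proof -
  have rep: "quad_rep skew_matrices s \<sigma>" and nonzero: "(UNIV :: 'v set) \<noteq> {0}"
    using \<sigma> by (simp_all add: fin_dim_irrep_def)
  interpret tetrad_operators s "\<lambda>k. \<sigma> (so3 k)"
    using rep by (rule tetrad_operators_quad_rep)
  have irr: "W = {0} \<or> W = UNIV" if "V.subspace W" "\<And>k w. w \<in> W \<Longrightarrow> \<sigma> (so3 k) w \<in> W" for W
    using that \<sigma> quad_rep_subspace_iff[of s \<sigma> W] unfolding fin_dim_irrep_def by blast
  show ?thesis
  proof (cases "\<forall>k v. \<sigma> (so3 k) v = 0")
    case True
    obtain v :: 'v where v: "v \<noteq> 0" using nonzero by auto
    have "Vector_Spaces.linear (*) s (\<lambda>q. s q v)"
      by unfold_locales (simp_all add: algebra_simps V.scale_left_distrib)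
    then have "rep_equiv skew_matrices (*) trivial_rep s \<sigma>"
      by (rule irrep_intertwining_equiv[OF fin_dim_irrep_trivial \<sigma>, of _ 1])
        (simp_all add: v True trivial_rep_def)
    then show ?thesis ..
  next
    case False
    then obtain \<mu> where \<mu>: "\<mu> \<in> {1, \<omega>, \<omega>\<^sup>2}" "\<And>v. S v = s \<mu> v"
      using irreducible_zero_or_scalar[OF \<omega> irr nonzero] by blast
    have w2: "\<omega>\<^sup>2 = - \<omega> - 1"
      using \<omega> by (simp add: eq_neg_iff_add_eq_0 algebra_simps)
    have w3: "\<omega> ^ 3 = 1"
    proof -
      have "\<omega> ^ 3 - 1 = (\<omega> - 1) * (\<omega>\<^sup>2 + \<omega> + 1)"
        by (simp add: power3_eq_cube power2_eq_square algebra_simps)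
      then show ?thesis using \<omega> by simp
    qed
    have w6: "(\<omega>\<^sup>2) ^ 3 = 1" using w3 by (metis power_mult mult.commute power_one)
    have w4: "(\<omega>\<^sup>2)\<^sup>2 = \<omega>"
      using w3 by (simp add: power2_eq_square power3_eq_cube mult.assoc)
    \<comment> \<open>Among the cube roots of unity, the square of \<open>\<mu>\<close> is a square
      root of \<open>\<mu>\<close>, because the fourth power of \<open>\<mu>\<close> is
      \<open>\<mu>\<close>.\<close>
    have "\<exists>l\<in>{1, \<omega>, \<omega>\<^sup>2}. l ^ 3 = 1 \<and> l\<^sup>2 = \<mu>"
      using \<mu>(1)
    proof (elim insertE emptyE)
      assume "\<mu> = 1"
      then show ?thesis by (intro bexI[of _ 1]) simp_all
    next
      assume "\<mu> = \<omega>"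
      then show ?thesis using w6 w4 by (intro bexI[of _ "\<omega>\<^sup>2"] conjI) (simp_all only: insert_iff simp_thms)
    next
      assume "\<mu> = \<omega>\<^sup>2"
      then show ?thesis using w3 by (intro bexI[of _ \<omega>]) simp_all
    qed
    then obtain l where l: "l \<in> {1, \<omega>, \<omega>\<^sup>2}" "l ^ 3 = 1" "l\<^sup>2 = \<mu>" by blast
    have scalar: "S v = s (l\<^sup>2) v" for v
      by (simp add: \<mu>(2) l(3))
    obtain k v where kv: "\<sigma> (so3 k) v \<noteq> 0" using False by blast
    obtain f where f: "Vector_Spaces.linear (*s) s f"
      "\<And>k c. f (\<chi> m. l * (\<Sum>i\<in>UNIV. eps k i m * c $ i)) = \<sigma> (so3 k) (f c)" "\<exists>u. f u \<noteq> 0"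
      by (rule intertwiner_from_scalar[OF scalar l(2) kv]) (rule that)
    then obtain u where u: "f u \<noteq> 0" by blast
    have "rep_equiv skew_matrices (*s) (twisted_rep l) s \<sigma>"
      by (rule irrep_intertwining_equiv[OF fin_dim_irrep_twisted[OF l(2)] \<sigma> f(1) _ u])
        (simp add: twisted_rep_so3 f(2))
    then show ?thesis using l(1) by blast
  qed
qed

lemma rep_equiv_sym:
  assumes "rep_equiv J s \<rho> t \<sigma>"
  shows "rep_equiv J t \<sigma> s \<rho>"
proof -
  obtain f where f: "Vector_Spaces.linear s t f" "bij f" "\<And>a v. a \<in> J \<Longrightarrow> f (\<rho> a v) = \<sigma> a (f v)"
    using assms unfolding rep_equiv_def by blast
  interpret f: Vector_Spaces.linear s t f by (rule f)
  have "Vector_Spaces.linear t s (inv_into UNIV f)"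
  proof unfold_locales
    show "inv_into UNIV f (b1 + b2) = inv_into UNIV f b1 + inv_into UNIV f b2" for b1 b2
      using f(2) by (metis f.add bij_inv_eq_iff)
    show "inv_into UNIV f (t r b) = s r (inv_into UNIV f b)" for r b
      using f(2) by (metis f.scale bij_inv_eq_iff)
  qed
  moreover have "inv_into UNIV f (\<sigma> a v) = \<rho> a (inv_into UNIV f v)" if "a \<in> J" for a v
    using f(2) f(3)[OF that] by (metis bij_inv_eq_iff)
  ultimately show ?thesis
    using bij_imp_bij_inv[OF f(2)] unfolding rep_equiv_def by blast
qed

lemma rep_equiv_trans:
  assumes "rep_equiv J s \<rho> t \<sigma>" "rep_equiv J t \<sigma> u \<tau>"
  shows "rep_equiv J s \<rho> u \<tau>"
proof -
  obtain f where f: "Vector_Spaces.linear s t f" "bij f" "\<And>a v. a \<in> J \<Longrightarrow> f (\<rho> a v) = \<sigma> a (f v)"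
    using assms unfolding rep_equiv_def by blast
  obtain g where g: "Vector_Spaces.linear t u g" "bij g" "\<And>a v. a \<in> J \<Longrightarrow> g (\<sigma> a v) = \<tau> a (g v)"
    using assms unfolding rep_equiv_def by blast
  have "Vector_Spaces.linear s u (g \<circ> f)"
    using f(1) g(1) by (rule Vector_Spaces.linear_compose)
  moreover have "bij (g \<circ> f)" using f(2) g(2) by (rule bij_comp)
  ultimately show ?thesis
    using f(3) g(3) unfolding rep_equiv_def by (intro exI[of _ "g \<circ> f"]) simp
qed

section \<open>Monoid algebras and algebras carried by a whole type\<close>

lemma ring_extend_simps [simp]:
  "carrier (ring.extend R m) = carrier R" "mult (ring.extend R m) = mult R"
  "one (ring.extend R m) = one R" "zero (ring.extend R m) = zero R" "add (ring.extend R m) = add R"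
  "smult (ring.extend R (module.fields f)) = f"
  by (simp_all add: ring.defs module.defs)

lemma ring_truncate_simps [simp]:
  "carrier (ring.truncate R) = carrier R" "mult (ring.truncate R) = mult R"
  "one (ring.truncate R) = one R" "zero (ring.truncate R) = zero R" "add (ring.truncate R) = add R"
  by (simp_all add: ring.defs)

text \<open>Records that differ only in further fields, such as \<open>smult\<close>, have different
  types, so the ring property has to be transported between them.\<close>

lemma ring_cong:
  assumes "ring R" and [simp]: "carrier S = carrier R" "mult S = mult R" "one S = one R"
    "zero S = zero R" "add S = add R"
  shows "ring S"
proof -
  interpret R: ring R by (rule assms)
  show ?thesis
  proof (intro ringI abelian_groupI monoidI)
    fix x
    assume "x \<in> carrier S"
    then show "\<exists>y\<in>carrier S. y \<oplus>\<^bsub>S\<^esub> x = \<zero>\<^bsub>S\<^esub>"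
      by (intro bexI[of _ "\<ominus>\<^bsub>R\<^esub> x"]) (simp_all add: R.l_neg)
  qed (simp_all add: R.a_ac R.m_assoc R.l_distr R.r_distr)
qed

lemma ring_extend: "ring R \<Longrightarrow> ring (ring.extend R m)"
  by (rule ring_cong) simp_all

text \<open>The scalar action \<open>sc\<close> is a parameter so that rational coefficients can act
  through \<open>of_rat\<close> on a space over a larger field.\<close>

definition lin_ext :: "('k::zero \<Rightarrow> 'c::comm_monoid_add \<Rightarrow> 'c) \<Rightarrow> ('m \<Rightarrow> 'c) \<Rightarrow> ('m \<Rightarrow>\<^sub>0 'k) \<Rightarrow> 'c" where
  "lin_ext sc g p = (\<Sum>x\<in>Poly_Mapping.keys p. sc (Poly_Mapping.lookup p x) (g x))"

lemma poly_mapping_sum_single: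
  fixes p :: "'m \<Rightarrow>\<^sub>0 'k::comm_monoid_add"
  shows "p = (\<Sum>x\<in>Poly_Mapping.keys p. Poly_Mapping.single x (Poly_Mapping.lookup p x))"
proof (rule poly_mapping_eqI)
  fix k
  have "(\<Sum>x\<in>Poly_Mapping.keys p. Poly_Mapping.lookup (Poly_Mapping.single x (Poly_Mapping.lookup p x)) k) =
      (\<Sum>x\<in>Poly_Mapping.keys p. if x = k then Poly_Mapping.lookup p x else 0)"
    by (rule sum.cong) (auto simp: lookup_single when_def)
  then show "Poly_Mapping.lookup p k =
      Poly_Mapping.lookup (\<Sum>x\<in>Poly_Mapping.keys p. Poly_Mapping.single x (Poly_Mapping.lookup p x)) k"
    by (simp add: lookup_sum in_keys_iff)
qed

text \<open>The cases retain that supports lie in \<open>C\<close>, as is needed for a monoid whose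
  carrier is not the whole type.\<close>

lemma poly_mapping_carrier_induct [consumes 1, case_names zero single add]:
  fixes p :: "'m \<Rightarrow>\<^sub>0 'k::comm_monoid_add"
  assumes "Poly_Mapping.keys p \<subseteq> C"
    and zero: "P 0" and single: "\<And>x k. x \<in> C \<Longrightarrow> P (Poly_Mapping.single x k)"
    and add: "\<And>p q. Poly_Mapping.keys p \<subseteq> C \<Longrightarrow> Poly_Mapping.keys q \<subseteq> C \<Longrightarrow> P p \<Longrightarrow> P q \<Longrightarrow> P (p + q)"
  shows "P p"
proof -
  have "Poly_Mapping.keys (\<Sum>x\<in>I. Poly_Mapping.single x (f x)) \<subseteq> C \<and>
      P (\<Sum>x\<in>I. Poly_Mapping.single x (f x))" if "finite I" "I \<subseteq> C" for I and f :: "'m \<Rightarrow> 'k"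
    using that
  proof (induction I)
    case (insert x I)
    have "Poly_Mapping.keys (Poly_Mapping.single x (f x)) \<subseteq> C"
      using insert.prems by simp
    with insert show ?case
      using keys_add[of "Poly_Mapping.single x (f x)" "\<Sum>x\<in>I. Poly_Mapping.single x (f x)"]
      by (auto intro!: add single)
  qed (simp add: zero)
  then show ?thesis
    using poly_mapping_sum_single[of p] assms(1) by (metis finite_keys)
qed

lemma lin_ext_simps:
  assumes "\<And>x. sc 0 x = 0" and add: "\<And>a b x. sc (a + b) x = sc a x + sc b x"
  shows "lin_ext sc g 0 = 0" "lin_ext sc g (Poly_Mapping.single x k) = sc k (g x)"
    "lin_ext sc g (p + q) = lin_ext sc g p + lin_ext sc g q"
proof -
  show "lin_ext sc g 0 = 0" "lin_ext sc g (Poly_Mapping.single x k) = sc k (g x)"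
    using assms(1) by (simp_all add: lin_ext_def)
  show "lin_ext sc g (p + q) = lin_ext sc g p + lin_ext sc g q"
    unfolding lin_ext_def
    by (rule setsum_keys_plus_distrib[where f = "\<lambda>x k. sc k (g x)"]) (simp_all add: assms)
qed

abbreviation conv :: "('m, 'z) monoid_scheme \<Rightarrow> ('m \<Rightarrow>\<^sub>0 'k) \<Rightarrow> ('m \<Rightarrow>\<^sub>0 'k) \<Rightarrow> ('m \<Rightarrow>\<^sub>0 'k::comm_ring_1)" where
  "conv M p q \<equiv> p \<otimes>\<^bsub>monoid_algebra M\<^esub> q"

lemma monoid_algebra_simps [simp]:
  "carrier (monoid_algebra M) = {p. Poly_Mapping.keys p \<subseteq> carrier M}"
  "one (monoid_algebra M) = Poly_Mapping.single \<one>\<^bsub>M\<^esub> 1"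
  "zero (monoid_algebra M) = 0" "add (monoid_algebra M) = (+)"
  "smult (monoid_algebra M) = (\<lambda>k. Poly_Mapping.map ((*) k))"
  by (simp_all add: monoid_algebra_def)

lemma conv_eq: "conv M p q = (\<Sum>x\<in>Poly_Mapping.keys p. \<Sum>y\<in>Poly_Mapping.keys q.
    Poly_Mapping.single (x \<otimes>\<^bsub>M\<^esub> y) (Poly_Mapping.lookup p x * Poly_Mapping.lookup q y))"
  by (simp add: monoid_algebra_def)

lemma conv_simps:
  "conv M 0 q = 0" "conv M p 0 = 0"
  "conv M (p + p') q = conv M p q + conv M p' q" "conv M p (q + q') = conv M p q + conv M p q'"
  "conv M (Poly_Mapping.single x a) (Poly_Mapping.single y b) = Poly_Mapping.single (x \<otimes>\<^bsub>M\<^esub> y) (a * b)"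
proof -
  show "conv M 0 q = 0" "conv M p 0 = 0"
    "conv M (Poly_Mapping.single x a) (Poly_Mapping.single y b) = Poly_Mapping.single (x \<otimes>\<^bsub>M\<^esub> y) (a * b)"
    by (simp_all add: conv_eq)
  show "conv M (p + p') q = conv M p q + conv M p' q"
    unfolding conv_eq
    by (rule setsum_keys_plus_distrib[where f = "\<lambda>x k. \<Sum>y\<in>Poly_Mapping.keys q.
      Poly_Mapping.single (x \<otimes>\<^bsub>M\<^esub> y) (k * Poly_Mapping.lookup q y)"])
      (simp_all add: distrib_right single_add sum.distrib)
  show "conv M p (q + q') = conv M p q + conv M p q'"
    unfolding conv_eq sum.distrib[symmetric]
    by (intro sum.cong refl setsum_keys_plus_distrib[where f = "\<lambda>y k.
      Poly_Mapping.single (_ \<otimes>\<^bsub>M\<^esub> y) (Poly_Mapping.lookup p _ * k)"])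
      (simp_all add: distrib_left single_add)
qed

lemma ring_monoid_algebra:
  assumes "monoid M"
  shows "ring (monoid_algebra M :: ('k::comm_ring_1, _) module)"
proof -
  interpret M: monoid M by (rule assms)
  have closed: "Poly_Mapping.keys (conv M p q) \<subseteq> carrier M"
    if "Poly_Mapping.keys p \<subseteq> carrier M" "Poly_Mapping.keys q \<subseteq> carrier M" for p q :: "_ \<Rightarrow>\<^sub>0 'k"
    using that(1)
  proof (induction p rule: poly_mapping_carrier_induct)
    case (single x k)
    show ?case using that(2)
    proof (induction q rule: poly_mapping_carrier_induct)
      case (single y l)
      then show ?case using \<open>x \<in> carrier M\<close> by (simp add: conv_simps)
    next
      case (add q q')
      then show ?case
        unfolding conv_simps by (blast dest: keys_add[THEN subsetD])
    qed (simp add: conv_simps)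
  next
    case (add p p')
    then show ?case
      unfolding conv_simps by (blast dest: keys_add[THEN subsetD])
  qed (simp add: conv_simps)
  have assoc: "conv M (conv M p q) r = conv M p (conv M q r)"
    if "Poly_Mapping.keys p \<subseteq> carrier M" "Poly_Mapping.keys q \<subseteq> carrier M" "Poly_Mapping.keys r \<subseteq> carrier M"
    for p q r :: "_ \<Rightarrow>\<^sub>0 'k"
    using that(1)
  proof (induction p rule: poly_mapping_carrier_induct)
    case x: (single x k)
    show ?case using that(2)
    proof (induction q rule: poly_mapping_carrier_induct)
      case y: (single y l)
      show ?case using that(3)
      proof (induction r rule: poly_mapping_carrier_induct)
        case (single z m)
        then show ?case using x y by (simp add: conv_simps M.m_assoc mult.assoc)
      qed (simp_all add: conv_simps)
    qed (simp_all add: conv_simps)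
  qed (simp_all add: conv_simps)
  have one: "conv M (Poly_Mapping.single \<one>\<^bsub>M\<^esub> 1) p = p" "conv M p (Poly_Mapping.single \<one>\<^bsub>M\<^esub> 1) = p"
    if "Poly_Mapping.keys p \<subseteq> carrier M" for p :: "_ \<Rightarrow>\<^sub>0 'k"
    using that by (induction p rule: poly_mapping_carrier_induct) (simp_all add: conv_simps)
  show ?thesis
  proof (intro ringI abelian_groupI monoidI)
    fix p :: "_ \<Rightarrow>\<^sub>0 'k"
    assume p: "p \<in> carrier (monoid_algebra M)"
    show "\<exists>y\<in>carrier (monoid_algebra M). y \<oplus>\<^bsub>monoid_algebra M\<^esub> p = \<zero>\<^bsub>monoid_algebra M\<^esub>"
      using p by (intro bexI[of _ "- p"]) simp_all
    show "p \<oplus>\<^bsub>monoid_algebra M\<^esub> q \<in> carrier (monoid_algebra M)" if "q \<in> carrier (monoid_algebra M)" for q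
      using p that keys_add[of p q] by auto
  qed (use closed in \<open>simp_all add: conv_simps assoc one add_ac\<close>)
qed

text \<open>Addition and zero agree with the type class operations, so finite sums in the algebra
  are ordinary sums.\<close>

locale type_algebra = ring C for C :: "('l, 'c::ab_group_add) module" +
  assumes carrier_UNIV [simp]: "carrier C = UNIV"
    and add_eq [simp]: "add C = (+)" and zero_eq [simp]: "zero C = 0"
begin

text \<open>The universal property of the monoid algebra. Multiplicativity is checked on pairs of
  monoid elements, where it is \<open>sc_mult\<close> together with multiplicativity of
  \<open>g\<close>; additivity does the rest.\<close>

lemma lin_ext_hom:
  fixes sc :: "'k::comm_ring_1 \<Rightarrow> 'c \<Rightarrow> 'c" and M :: "'m monoid"
  assumes M: "monoid M"
    and sc: "\<And>a b x. sc (a + b) x = sc a x + sc b x"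
    and sc_mult: "\<And>a b x y. sc (a * b) (x \<otimes>\<^bsub>C\<^esub> y) = sc a x \<otimes>\<^bsub>C\<^esub> sc b y"
    and sc_1: "sc 1 \<one>\<^bsub>C\<^esub> = \<one>\<^bsub>C\<^esub>"
    and g: "\<And>x y. x \<in> carrier M \<Longrightarrow> y \<in> carrier M \<Longrightarrow> g (x \<otimes>\<^bsub>M\<^esub> y) = g x \<otimes>\<^bsub>C\<^esub> g y" "g \<one>\<^bsub>M\<^esub> = \<one>\<^bsub>C\<^esub>"
  shows "ring_hom_ring (monoid_algebra M) C (lin_ext sc g)"
proof -
  have "sc 0 x = 0" for x using sc[of 0 0 x] by simp
  note [simp] = lin_ext_simps[of sc, OF this sc]
  have mult_simps: "0 \<otimes>\<^bsub>C\<^esub> c = 0" "c \<otimes>\<^bsub>C\<^esub> 0 = 0" "(c + c') \<otimes>\<^bsub>C\<^esub> d = c \<otimes>\<^bsub>C\<^esub> d + c' \<otimes>\<^bsub>C\<^esub> d"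
    "d \<otimes>\<^bsub>C\<^esub> (c + c') = d \<otimes>\<^bsub>C\<^esub> c + d \<otimes>\<^bsub>C\<^esub> c'" for c c' d
    using l_null[of c] r_null[of c] l_distr[of c c' d] r_distr[of c c' d] by simp_all
  have mult: "lin_ext sc g (conv M p q) = lin_ext sc g p \<otimes>\<^bsub>C\<^esub> lin_ext sc g q"
    if "Poly_Mapping.keys p \<subseteq> carrier M" "Poly_Mapping.keys q \<subseteq> carrier M" for p q
    using that(1)
  proof (induction p rule: poly_mapping_carrier_induct)
    case x: (single x k)
    show ?case using that(2)
    proof (induction q rule: poly_mapping_carrier_induct)
      case (single y l)
      then show ?case using x by (simp add: conv_simps sc_mult g)
    qed (simp_all add: conv_simps mult_simps)
  qed (simp_all add: conv_simps mult_simps)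
  show ?thesis
    by (intro ring_hom_ringI ring_monoid_algebra M ring_axioms) (simp_all add: mult g sc_1)
qed

end

lemma direct_sum_algebra_simps [simp]:
  "carrier (A \<oplus>\<^sub>a C) = carrier A \<times> carrier C"
  "(a, c) \<otimes>\<^bsub>A \<oplus>\<^sub>a C\<^esub> (a', c') = (a \<otimes>\<^bsub>A\<^esub> a', c \<otimes>\<^bsub>C\<^esub> c')"
  "(a, c) \<oplus>\<^bsub>A \<oplus>\<^sub>a C\<^esub> (a', c') = (a \<oplus>\<^bsub>A\<^esub> a', c \<oplus>\<^bsub>C\<^esub> c')"
  "\<one>\<^bsub>A \<oplus>\<^sub>a C\<^esub> = (\<one>\<^bsub>A\<^esub>, \<one>\<^bsub>C\<^esub>)" "\<zero>\<^bsub>A \<oplus>\<^sub>a C\<^esub> = (\<zero>\<^bsub>A\<^esub>, \<zero>\<^bsub>C\<^esub>)"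
  "k \<odot>\<^bsub>A \<oplus>\<^sub>a C\<^esub> (a, c) = (k \<odot>\<^bsub>A\<^esub> a, k \<odot>\<^bsub>C\<^esub> c)"
  by (simp_all add: direct_sum_algebra_def RDirProd_def DirProd_def monoid.defs)

lemma type_algebra_direct_sum:
  fixes A :: "('l, 'a::ab_group_add) module" and C :: "('l, 'c::ab_group_add) module"
  assumes "type_algebra A" "type_algebra C"
  shows "type_algebra (A \<oplus>\<^sub>a C)"
proof -
  interpret A: type_algebra A by (rule assms)
  interpret C: type_algebra C by (rule assms)
  have "ring (A \<oplus>\<^sub>a C)"
    unfolding direct_sum_algebra_def by (intro ring_extend RDirProd_ring A.ring_axioms C.ring_axioms)
  then show ?thesis
    unfolding type_algebra_def type_algebra_axioms_def
    by (auto simp: fun_eq_iff zero_prod_def)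
qed

lemma field_algebra_simps [simp]:
  "a \<otimes>\<^bsub>field_algebra\<^esub> b = a * b" "\<one>\<^bsub>field_algebra\<^esub> = 1" "a \<odot>\<^bsub>field_algebra\<^esub> b = a * b"
  by (simp_all add: field_algebra_def ring_of_type_algebra_def)

lemma type_algebra_field: "type_algebra field_algebra"
  unfolding type_algebra_def type_algebra_axioms_def field_algebra_def
  by (simp add: ring_extend ring_from_type_algebra) (simp add: ring_of_type_algebra_def)

lemma matrix_algebra_simps [simp]:
  "a \<otimes>\<^bsub>matrix_algebra\<^esub> b = a ** b" "\<one>\<^bsub>matrix_algebra\<^esub> = mat 1" "k \<odot>\<^bsub>matrix_algebra\<^esub> b = mscale k b"
  by (simp_all add: matrix_algebra_def)

lemma type_algebra_matrix: "type_algebra (matrix_algebra :: ('k::field, 'k^'n^'n) module)"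
proof -
  have rdistrib: "(A + B) ** D = A ** D + B ** D" for A B D :: "'k^'n^'n"
    by (simp add: matrix_matrix_mult_def vec_eq_iff distrib_right sum.distrib)
  have "ring (matrix_algebra :: ('k, 'k^'n^'n) module)"
  proof (intro ringI abelian_groupI monoidI)
    fix A :: "'k^'n^'n"
    show "\<exists>y\<in>carrier matrix_algebra. y \<oplus>\<^bsub>matrix_algebra\<^esub> A = \<zero>\<^bsub>matrix_algebra\<^esub>"
      by (intro bexI[of _ "- A"]) (simp_all add: matrix_algebra_def)
  qed (simp_all add: matrix_algebra_def add_ac matrix_mul_assoc matrix_add_ldistrib rdistrib)
  then show ?thesis
    unfolding type_algebra_def type_algebra_axioms_def by (simp add: matrix_algebra_def)
qed

section \<open>The span of the regular representation\<close>

text \<open>Coefficients are indexed by \<open>A\<close> rather than by vectors, because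
  \<open>g\<close> is not assumed injective: the spanning family of the envelope is not yet known to
  be independent.\<close>

lemma (in vector_space) span_image_finite:
  assumes "finite A" "x \<in> span (g ` A)"
  shows "\<exists>c. x = (\<Sum>a\<in>A. scale (c a) (g a))"
proof -
  let ?R = "range (\<lambda>c. \<Sum>a\<in>A. scale (c a) (g a))"
  have "subspace ?R"
    unfolding subspace_def
  proof (intro conjI ballI allI)
    show "0 \<in> ?R" by (intro range_eqI[of _ _ "\<lambda>_. 0"]) simp
    show "v + w \<in> ?R" if "v \<in> ?R" "w \<in> ?R" for v w
    proof -
      obtain c d where "v = (\<Sum>a\<in>A. scale (c a) (g a))" "w = (\<Sum>a\<in>A. scale (d a) (g a))"
        using \<open>v \<in> ?R\<close> \<open>w \<in> ?R\<close> by blast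
      then show ?thesis
        by (intro range_eqI[of _ _ "\<lambda>a. c a + d a"]) (simp add: scale_left_distrib sum.distrib)
    qed
    show "scale q v \<in> ?R" if "v \<in> ?R" for q v
    proof -
      obtain c where "v = (\<Sum>a\<in>A. scale (c a) (g a))"
        using \<open>v \<in> ?R\<close> by blast
      then show ?thesis
        by (intro range_eqI[of _ _ "\<lambda>a. q * c a"]) (simp add: scale_sum_right)
    qed
  qed
  moreover have "g ` A \<subseteq> ?R"
  proof
    fix y
    assume "y \<in> g ` A"
    then obtain a where "a \<in> A" "y = g a" by blast
    then show "y \<in> ?R"
      using assms(1) by (intro range_eqI[of _ _ "\<lambda>b. if b = a then 1 else 0"])
        (simp add: if_distrib[of "\<lambda>x. scale x _"] cong: if_cong)
  qed
  ultimately have "span (g ` A) \<subseteq> ?R"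
    using span_minimal by blast
  then show ?thesis using assms(2) by blast
qed

text \<open>\<open>None\<close> stands for the identity and \<open>Some (m, i, j)\<close> for the
  \<open>m\<close>-th power of \<open>S\<close> times \<open>F i j\<close>, which makes 1 + 3 * 9 =
  28 indices.\<close>

definition basis_index :: "(nat \<times> 3 \<times> 3) option set" where
  "basis_index = insert None (Some ` ({..<3} \<times> UNIV))"

lemma finite_basis_index: "finite basis_index"
  by (simp add: basis_index_def)


context tetrad_operators
begin

text \<open>The vector \<open>u\<close> takes the place of the identity element of the
  envelope.\<close>

definition envelope_basis :: "'v \<Rightarrow> (nat \<times> 3 \<times> 3) option \<Rightarrow> 'v" where
  "envelope_basis u a = (case a of None \<Rightarrow> u | Some (m, i, j) \<Rightarrow> (S ^^ m) (F i j u))"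

text \<open>The cube of \<open>S\<close> fixes the range of every \<open>L k\<close>, and both
  summands of \<open>F i j v\<close>, including \<open>S v\<close>, are combinations of vectors in
  such ranges.\<close>

lemma S_pow3_F: "S (S (S (F i j v))) = F i j v"
proof -
  have LL: "S (S (S (L j (L i v)))) = L j (L i v)" for i j
    by (rule S_pow3_L)
  have "S (S (S (S v))) = S (S (S (s (- 1 / 2) (\<Sum>k\<in>UNIV. L k (L k v)))))"
    by (simp only: S_def[of v])
  also have "\<dots> = s (- 1 / 2) (\<Sum>k\<in>UNIV. S (S (S (L k (L k v)))))"
    by (simp add: sum_3)
  also have "\<dots> = S v"
    by (simp only: LL S_def[of v])
  finally have "S (S (S (S v))) = S v" .
  then show ?thesis
    by (simp add: F_def LL)
qed

lemma L_F': "L k (F i j v) = S (S (\<Sum>m\<in>UNIV. s (eps k i m) (F m j v)))"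
  unfolding L_F[symmetric] by (simp add: S_pow3_L)

lemma S_pow_simps:
  "(S ^^ m) (v + w) = (S ^^ m) v + (S ^^ m) w" "(S ^^ m) (s q v) = s q ((S ^^ m) v)" "(S ^^ m) 0 = 0"
  "L k ((S ^^ m) v) = (S ^^ m) (L k v)"
  by (induction m) (simp_all add: L_S_commute)

lemma S_pow_sum: "(S ^^ m) (\<Sum>a\<in>A. f a) = (\<Sum>a\<in>A. (S ^^ m) (f a))"
  by (induction A rule: infinite_finite_induct) (simp_all add: S_pow_simps)

lemma S_pow_F_in_span: "(S ^^ m) (F i j u) \<in> V.span (envelope_basis u ` basis_index)"
proof (induction m rule: less_induct)
  case (less m)
  show ?case
  proof (cases "m < 3")
    case True
    then have "Some (m, i, j) \<in> basis_index"
      by (simp add: basis_index_def)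
    then have "envelope_basis u (Some (m, i, j)) \<in> V.span (envelope_basis u ` basis_index)"
      by (intro V.span_base imageI)
    moreover have "envelope_basis u (Some (m, i, j)) = (S ^^ m) (F i j u)"
      by (simp add: envelope_basis_def)
    ultimately show ?thesis by metis
  next
    case False
    define n where "n = m - 3"
    with False have n: "m = n + 3" by simp
    have "(S ^^ m) (F i j u) = (S ^^ n) (F i j u)"
      by (simp add: n funpow_add numeral_3_eq_3 S_pow3_F del: add_Suc_right)
    then show ?thesis using less[of n] n by simp
  qed
qed

text \<open>On \<open>u\<close> itself a letter is expanded by \<open>L_eq_S_F\<close>. On the other
  elements it raises the exponent of \<open>S\<close> by two, by \<open>L_F'\<close>, and
  \<open>S_pow_F_in_span\<close> brings the exponent back below three.\<close>

lemma span_envelope_basis_invariant: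
  assumes "v \<in> V.span (envelope_basis u ` basis_index)"
  shows "L k v \<in> V.span (envelope_basis u ` basis_index)"
proof -
  let ?M = "V.span (envelope_basis u ` basis_index)"
  have "L k (envelope_basis u a) \<in> ?M" for a
  proof (cases a)
    case None
    have "S (F m i u) \<in> ?M" for m i
      using S_pow_F_in_span[of 1 m i u] by simp
    then have "(\<Sum>i\<in>UNIV. \<Sum>m\<in>UNIV. s (eps k i m) (S (F m i u))) \<in> ?M"
      by (intro V.span_sum V.span_scale)
    then show ?thesis
      by (simp add: None envelope_basis_def flip: L_eq_S_F)
  next
    case (Some mij)
    obtain m i j where mij: "mij = (m, i, j)" by (cases mij)
    have "L k ((S ^^ m) (F i j u)) = (S ^^ m) (S (S (\<Sum>n\<in>UNIV. s (eps k i n) (F n j u))))"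
      by (simp only: S_pow_simps L_F')
    also have "\<dots> = (S ^^ Suc (Suc m)) (\<Sum>n\<in>UNIV. s (eps k i n) (F n j u))"
      by (simp only: funpow_Suc_right comp_apply)
    also have "\<dots> = (\<Sum>n\<in>UNIV. s (eps k i n) ((S ^^ Suc (Suc m)) (F n j u)))"
      by (simp only: S_pow_sum S_pow_simps)
    also have "\<dots> \<in> ?M"
      by (intro V.span_sum V.span_scale S_pow_F_in_span)
    finally show ?thesis by (simp add: Some mij envelope_basis_def)
  qed
  moreover have "V.subspace {v. L k v \<in> ?M}"
    by (simp add: V.subspace_def V.span_zero V.span_add V.span_scale)
  ultimately have "?M \<subseteq> {v. L k v \<in> ?M}"
    by (intro V.span_minimal) auto
  then show ?thesis using assms by auto
qed

end

text \<open>The envelope is built from an arbitrary basis \<open>B\<close>, while the operator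
  calculations use \<open>so3\<close>. Representations of the whole space of skew matrices mediate
  between the two.\<close>

locale skew_basis =
  fixes B :: "(rat^3^3) set"
  assumes independent: "mat_vs.independent B" and span_eq: "mat_vs.span B = skew_matrices"
begin

lemma finite_B: "finite B"
proof -
  have "A \<in> mat_vs.span (range so3)" if "A \<in> skew_matrices" for A :: "rat^3^3"
    by (subst skew_eq_sum_so3[OF that]) (intro mat_vs.span_sum mat_vs.span_scale mat_vs.span_base rangeI)
  then have "B \<subseteq> mat_vs.span (range so3)"
    using mat_vs.span_superset[of B] span_eq by blast
  then show ?thesis
    using mat_vs.independent_span_bound[OF _ independent, of "range so3"] by simp
qed

lemma B_skew: "b \<in> B \<Longrightarrow> b \<in> skew_matrices"
  using mat_vs.span_base span_eq by blast

abbreviation coord :: "rat^3^3 \<Rightarrow> rat^3^3 \<Rightarrow> rat" where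
  "coord \<equiv> mat_vs.representation B"

lemma coord_simps:
  "a \<in> skew_matrices \<Longrightarrow> a' \<in> skew_matrices \<Longrightarrow> coord (a + a') e = coord a e + coord a' e"
  "a \<in> skew_matrices \<Longrightarrow> coord (mscale q a) e = q * coord a e"
  "b \<in> B \<Longrightarrow> coord b e = (if e = b then 1 else 0)"
  using mat_vs.representation_add[OF independent] mat_vs.representation_scale[OF independent]
    mat_vs.representation_basis[OF independent] span_eq by simp_all

lemma skew_induct [consumes 1, case_names basis zero add scale]:
  assumes "a \<in> skew_matrices" and basis: "\<And>b. b \<in> B \<Longrightarrow> P b" and zero: "P 0"
    and add: "\<And>a a'. a \<in> skew_matrices \<Longrightarrow> a' \<in> skew_matrices \<Longrightarrow> P a \<Longrightarrow> P a' \<Longrightarrow> P (a + a')"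
    and scale: "\<And>q a. a \<in> skew_matrices \<Longrightarrow> P a \<Longrightarrow> P (mscale q a)"
  shows "P a"
proof -
  have "mat_vs.subspace {a \<in> skew_matrices. P a}"
    using subspace_skew_matrices by (auto simp: mat_vs.subspace_def zero add scale)
  then have "mat_vs.span B \<subseteq> {a \<in> skew_matrices. P a}"
    using basis B_skew by (intro mat_vs.span_minimal) auto
  then show ?thesis using assms(1) span_eq by blast
qed

text \<open>Both sides of the tetrad relation are linear in each argument, so it extends from
  \<open>B\<close> to its span one argument at a time, the later arguments staying in
  \<open>B\<close> until their turn.\<close>

lemma quad_rep_from_basis:
  fixes s :: "'k::field_char_0 \<Rightarrow> 'v::ab_group_add \<Rightarrow> 'v"
  assumes "vector_space s" and linear: "\<And>b. b \<in> B \<Longrightarrow> Vector_Spaces.linear s s (Y b)"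
    and tetrad: "\<And>a b c d v. a \<in> B \<Longrightarrow> b \<in> B \<Longrightarrow> c \<in> B \<Longrightarrow> d \<in> B \<Longrightarrow>
      Y a (Y b (Y c (Y d v))) - Y d (Y c (Y b (Y a v))) =
      (\<Sum>e\<in>B. s (of_rat (coord (anti_tetrad a b c d) e)) (Y e v))"
  shows "quad_rep skew_matrices s (\<lambda>a v. \<Sum>e\<in>B. s (of_rat (coord a e)) (Y e v))"
proof -
  interpret V: vector_space s by (rule assms)
  define \<rho> where "\<rho> a v = (\<Sum>e\<in>B. s (of_rat (coord a e)) (Y e v))" for a v
  have Y: "Y b (v + w) = Y b v + Y b w" "Y b (s q v) = s q (Y b v)" if "b \<in> B" for b v w q
  proof -
    interpret Y: Vector_Spaces.linear s s "Y b" by (rule linear[OF that])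
    show "Y b (v + w) = Y b v + Y b w" "Y b (s q v) = s q (Y b v)"
      by (simp_all add: Y.add Y.scale)
  qed
  have on_basis: "\<rho> b v = Y b v" if "b \<in> B" for b v
    using that finite_B
    by (simp add: \<rho>_def coord_simps if_distrib[of of_rat] if_distrib[of "\<lambda>x. s x _"] cong: if_cong)
  have add: "\<rho> (a + a') v = \<rho> a v + \<rho> a' v" if "a \<in> skew_matrices" "a' \<in> skew_matrices" for a a' v
    using that by (simp add: \<rho>_def coord_simps of_rat_add V.scale_left_distrib sum.distrib)
  have scale: "\<rho> (mscale q a) v = s (of_rat q) (\<rho> a v)" if "a \<in> skew_matrices" for q a v
    using that by (simp add: \<rho>_def coord_simps of_rat_mult V.scale_sum_right)
  have zero: "\<rho> 0 v = 0" for v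
    using scale[of 0 0 v] subspace_skew_matrices mat_vs.subspace_0 by fastforce
  have add': "\<rho> a (v + w) = \<rho> a v + \<rho> a w" and scale': "\<rho> a (s q v) = s q (\<rho> a v)" for a v w q
    by (simp_all add: \<rho>_def Y V.scale_right_distrib sum.distrib V.scale_sum_right mult.commute)
  have zero': "\<rho> a 0 = 0" for a
    using scale'[of a 0 0] by simp
  have lin: "Vector_Spaces.linear s s (\<rho> a)" for a
    by unfold_locales (simp_all add: add' scale')
  have mult: "(A + A') ** C = A ** C + A' ** C" "C ** (A + A') = C ** A + C ** A'"
    "mscale q A ** C = mscale q (A ** C)" "C ** mscale q A = mscale q (C ** A)"
    for A A' C :: "rat^3^3" and q
    by (simp_all add: vec_eq_iff matrix_matrix_mult_def mscale_def distrib_left distrib_right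
        sum.distrib sum_distrib_left mult_ac)
  have mult_0: "0 ** A = 0" "A ** 0 = 0" for A :: "rat^3^3"
    by (simp_all add: vec_eq_iff matrix_matrix_mult_def)
  have mscale_diff: "mscale q (A - C) = mscale q A - mscale q C" for A C :: "rat^3^3" and q
    by (rule mat_vs.scale_right_diff_distrib)
  have mat: "anti_tetrad (a + a') b c d = anti_tetrad a b c d + anti_tetrad a' b c d"
    "anti_tetrad a (b + b') c d = anti_tetrad a b c d + anti_tetrad a b' c d"
    "anti_tetrad a b (c + c') d = anti_tetrad a b c d + anti_tetrad a b c' d"
    "anti_tetrad a b c (d + d') = anti_tetrad a b c d + anti_tetrad a b c d'"
    "anti_tetrad (mscale q a) b c d = mscale q (anti_tetrad a b c d)"
    "anti_tetrad a (mscale q b) c d = mscale q (anti_tetrad a b c d)"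
    "anti_tetrad a b (mscale q c) d = mscale q (anti_tetrad a b c d)"
    "anti_tetrad a b c (mscale q d) = mscale q (anti_tetrad a b c d)"
    "anti_tetrad 0 b c d = 0" "anti_tetrad a 0 c d = 0" "anti_tetrad a b 0 d = 0" "anti_tetrad a b c 0 = 0"
    for a b c d a' b' c' d' :: "rat^3^3" and q
    by (simp_all add: anti_tetrad_def mult mult_0 mscale_diff algebra_simps)
  have "\<rho> (anti_tetrad a b c d) v = \<rho> a (\<rho> b (\<rho> c (\<rho> d v))) - \<rho> d (\<rho> c (\<rho> b (\<rho> a v)))"
    if abcd: "a \<in> skew_matrices" "b \<in> skew_matrices" "c \<in> skew_matrices" "d \<in> skew_matrices" for a b c d v
  proof -
    note simps = mat add add' scale scale' zero zero' anti_tetrad_skew_matrices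
      V.scale_right_diff_distrib add_diff_add
    have 1: "\<forall>v. \<rho> (anti_tetrad a b c d) v = \<rho> a (\<rho> b (\<rho> c (\<rho> d v))) - \<rho> d (\<rho> c (\<rho> b (\<rho> a v)))"
      if "a \<in> skew_matrices" "b \<in> B" "c \<in> B" "d \<in> B" for a b c d
      using that(1)
    proof (induction a rule: skew_induct)
      case (basis a)
      show ?case
        using tetrad[OF basis that(2-4), folded \<rho>_def] basis that(2-4) by (simp add: on_basis)
    qed (use that B_skew in \<open>simp_all add: simps\<close>)
    have 2: "\<forall>v. \<rho> (anti_tetrad a b c d) v = \<rho> a (\<rho> b (\<rho> c (\<rho> d v))) - \<rho> d (\<rho> c (\<rho> b (\<rho> a v)))"
      if "a \<in> skew_matrices" "b \<in> skew_matrices" "c \<in> B" "d \<in> B" for a b c d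
      using that(2)
      by (induction b rule: skew_induct) (use that B_skew 1 in \<open>simp_all add: simps\<close>)
    have 3: "\<forall>v. \<rho> (anti_tetrad a b c d) v = \<rho> a (\<rho> b (\<rho> c (\<rho> d v))) - \<rho> d (\<rho> c (\<rho> b (\<rho> a v)))"
      if "a \<in> skew_matrices" "b \<in> skew_matrices" "c \<in> skew_matrices" "d \<in> B" for a b c d
      using that(3)
      by (induction c rule: skew_induct) (use that B_skew 2 in \<open>simp_all add: simps\<close>)
    have "\<forall>v. \<rho> (anti_tetrad a b c d) v = \<rho> a (\<rho> b (\<rho> c (\<rho> d v))) - \<rho> d (\<rho> c (\<rho> b (\<rho> a v)))"
      using abcd(4)
      by (induction d rule: skew_induct) (use abcd B_skew 3 in \<open>simp_all add: simps\<close>)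
    then show ?thesis by blast
  qed
  then have "quad_rep skew_matrices s \<rho>"
    using assms(1) lin add scale by (simp add: quad_rep_def)
  then show ?thesis
    by (simp add: \<rho>_def[abs_def])
qed

end

text \<open>If \<open>g\<close> is a linear projection onto \<open>W\<close>, then
  \<open>v - g v\<close> has kernel exactly \<open>W\<close>, and its image models the quotient by
  \<open>W\<close> inside the same type.\<close>

lemma (in vector_space) ex_projection_along:
  assumes "subspace W"
  obtains p where "Vector_Spaces.linear scale scale p" "\<And>w. w \<in> W \<Longrightarrow> p w = 0" "\<And>v. v - p v \<in> W"
proof -
  interpret pair: vector_space_pair scale scale ..
  obtain g where g: "g \<in> UNIV \<rightarrow> W" "Vector_Spaces.linear scale scale g" "\<forall>v\<in>W. g v = v"
    using pair.linear_exists_left_inverse_on[OF linear_id[unfolded id_def] assms] by (auto simp: inj_on_def)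
  interpret g: Vector_Spaces.linear scale scale g by (rule g)
  show thesis
  proof
    show "Vector_Spaces.linear scale scale (\<lambda>v. v - g v)"
      by unfold_locales (simp_all add: g.add g.scale scale_right_diff_distrib)
  qed (use g in auto)
qed

section \<open>Monoid algebras and their ideals as vector spaces\<close>

abbreviation pm_scale :: "'k::comm_ring_1 \<Rightarrow> ('m \<Rightarrow>\<^sub>0 'k) \<Rightarrow> 'm \<Rightarrow>\<^sub>0 'k" where
  "pm_scale q \<equiv> Poly_Mapping.map ((*) q)"

lemma lookup_pm_scale [simp]: "Poly_Mapping.lookup (pm_scale q p) x = q * Poly_Mapping.lookup p x"
  by (simp add: map.rep_eq when_def)

lemma pm_scale_single [simp]: "pm_scale q (Poly_Mapping.single x k) = Poly_Mapping.single x (q * k)"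
  by (rule poly_mapping_eqI) (simp add: lookup_single when_def)

lemma pm_scale_add: "pm_scale q (p + p') = pm_scale q p + pm_scale q p'"
  by (rule poly_mapping_eqI) (simp add: lookup_add distrib_left)

global_interpretation pm_vs: vector_space "pm_scale :: 'k::field \<Rightarrow> ('m \<Rightarrow>\<^sub>0 'k) \<Rightarrow> _"
  by unfold_locales (auto intro!: poly_mapping_eqI simp: lookup_add algebra_simps)

lemma keys_subset_iff: "Poly_Mapping.keys p \<subseteq> C \<longleftrightarrow> (\<forall>x. x \<notin> C \<longrightarrow> Poly_Mapping.lookup p x = 0)"
  by (auto simp: in_keys_iff)

lemma subspace_keys: "pm_vs.subspace {p. Poly_Mapping.keys p \<subseteq> C}"
  by (simp add: pm_vs.subspace_def keys_subset_iff lookup_add)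

lemma conv_pm_scale:
  "conv M (pm_scale q p) r = pm_scale q (conv M p r)" "conv M p (pm_scale q r) = pm_scale q (conv M p r)"
proof -
  have 0: "pm_scale q 0 = 0"
    by (rule poly_mapping_eqI) simp
  have single: "conv M (pm_scale q (Poly_Mapping.single x k)) r = pm_scale q (conv M (Poly_Mapping.single x k) r)"
    "conv M (Poly_Mapping.single x k) (pm_scale q r) = pm_scale q (conv M (Poly_Mapping.single x k) r)" for x k
    using subset_UNIV
    by (induction r rule: poly_mapping_carrier_induct) (simp_all add: 0 conv_simps pm_scale_add mult_ac)
  show "conv M (pm_scale q p) r = pm_scale q (conv M p r)" "conv M p (pm_scale q r) = pm_scale q (conv M p r)"
    using subset_UNIV
    by (induction p rule: poly_mapping_carrier_induct) (simp_all only: 0 conv_simps pm_scale_add single)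
qed

lemma single_one_conv:
  assumes "monoid M" "Poly_Mapping.keys p \<subseteq> carrier M"
  shows "conv M (Poly_Mapping.single \<one>\<^bsub>M\<^esub> q) p = pm_scale q p"
proof -
  interpret monoid M by (rule assms)
  show ?thesis
    using assms(2)
  proof (induction p rule: poly_mapping_carrier_induct)
    case zero
    show ?case by (rule poly_mapping_eqI) (simp add: conv_simps)
  qed (simp_all add: conv_simps pm_scale_add)
qed

text \<open>Scaling is multiplication by a multiple of the identity, which an ideal absorbs.\<close>

lemma monoid_ideal_subspace:
  assumes "monoid M" "ideal I (monoid_algebra M :: ('k::field, _) module)"
  shows "pm_vs.subspace I"
proof -
  interpret I: ideal I "monoid_algebra M :: ('k, _) module" by (rule assms)
  show ?thesis
    unfolding pm_vs.subspace_def
  proof (intro conjI ballI allI)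
    show "0 \<in> I" using additive_subgroup.zero_closed[OF I.additive_subgroup_axioms] by simp
    show "p + q \<in> I" if "p \<in> I" "q \<in> I" for p q
      using additive_subgroup.a_closed[OF I.additive_subgroup_axioms that] by simp
    fix p q
    assume p: "p \<in> I"
    have keys: "Poly_Mapping.keys p \<subseteq> carrier M" using I.a_subset p by auto
    have "conv M (Poly_Mapping.single \<one>\<^bsub>M\<^esub> q) p \<in> I"
      using p assms(1) by (intro I.I_l_closed) (simp_all add: monoid.one_closed)
    then show "pm_scale q p \<in> I"
      by (simp add: single_one_conv[OF assms(1) keys])
  qed
qed

definition word_monoid :: "'a set \<Rightarrow> 'a list monoid" where
  "word_monoid A = \<lparr>carrier = lists A, monoid.mult = (@), one = []\<rparr>"

lemma word_monoid_simps [simp]: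
  "carrier (word_monoid A) = lists A" "v \<otimes>\<^bsub>word_monoid A\<^esub> w = v @ w" "\<one>\<^bsub>word_monoid A\<^esub> = []"
  by (simp_all add: word_monoid_def)

lemma monoid_word_monoid: "monoid (word_monoid A)"
  by (intro monoidI) auto

lemma free_algebra_eq: "free_algebra A = monoid_algebra (word_monoid A)"
  by (simp add: free_algebra_def word_monoid_def)

section \<open>The regular representation of the envelope\<close>

context skew_basis
begin

abbreviation "words \<equiv> word_monoid B"
abbreviation "FA \<equiv> (monoid_algebra words :: (rat, (rat^3^3) list \<Rightarrow>\<^sub>0 rat) module)"

definition "rel_ideal = Idl\<^bsub>FA\<^esub> (envelope_relations B)"

sublocale FA: ring FA
  by (rule ring_monoid_algebra[OF monoid_word_monoid])

abbreviation letter :: "rat^3^3 \<Rightarrow> (rat^3^3) list \<Rightarrow>\<^sub>0 rat" where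
  "letter b \<equiv> Poly_Mapping.single [b] 1"

lemma letter_closed: "b \<in> B \<Longrightarrow> letter b \<in> carrier FA"
  by simp

lemma carrier_subspace: "pm_vs.subspace (carrier FA)"
  using subspace_keys by simp

lemma envelope_relations_closed: "envelope_relations B \<subseteq> carrier FA"
proof -
  have "Poly_Mapping.single w k \<in> carrier FA" if "w \<in> lists B" for w k
    using that by simp
  then show ?thesis
    unfolding envelope_relations_def
    by (auto simp del: monoid_algebra_simps intro!: pm_vs.subspace_diff[OF carrier_subspace]
        pm_vs.subspace_sum[OF carrier_subspace])
qed

sublocale rel: ideal rel_ideal FA
  unfolding rel_ideal_def by (rule FA.genideal_ideal[OF envelope_relations_closed])

lemma rel_ideal_subspace: "pm_vs.subspace rel_ideal"
  using monoid_word_monoid rel.ideal_axioms by (rule monoid_ideal_subspace)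

text \<open>One fixed choice of projection; the image of the free algebra under it is a model of the
  envelope inside the type.\<close>

definition proj :: "((rat^3^3) list \<Rightarrow>\<^sub>0 rat) \<Rightarrow> (rat^3^3) list \<Rightarrow>\<^sub>0 rat" where
  "proj = (SOME p. Vector_Spaces.linear pm_scale pm_scale p \<and> (\<forall>w\<in>rel_ideal. p w = 0) \<and>
    (\<forall>v. v - p v \<in> rel_ideal))"

lemma proj: "Vector_Spaces.linear pm_scale pm_scale proj" "w \<in> rel_ideal \<Longrightarrow> proj w = 0"
  "v - proj v \<in> rel_ideal"
proof -
  have "\<exists>p. Vector_Spaces.linear pm_scale pm_scale p \<and> (\<forall>w\<in>rel_ideal. p w = 0) \<and>
      (\<forall>v. v - p v \<in> rel_ideal)"
    using pm_vs.ex_projection_along[OF rel_ideal_subspace] by metis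
  from someI_ex[OF this] show "Vector_Spaces.linear pm_scale pm_scale proj" "w \<in> rel_ideal \<Longrightarrow> proj w = 0"
    "v - proj v \<in> rel_ideal"
    unfolding proj_def by blast+
qed

interpretation proj: Vector_Spaces.linear pm_scale pm_scale proj
  by (rule proj)

lemma proj_cong: "v - w \<in> rel_ideal \<Longrightarrow> proj v = proj w"
  using proj(2)[of "v - w"] proj.diff[of v w] by simp

text \<open>\<open>v\<close> and \<open>proj v\<close> differ by an element of the ideal, and the
  ideal lies in the free algebra.\<close>

lemma proj_closed: "v \<in> carrier FA \<Longrightarrow> proj v \<in> carrier FA"
  using pm_vs.subspace_diff[OF carrier_subspace, of v "v - proj v"] proj(3)[of v] rel.a_subset by auto

text \<open>The free algebra is a proper subset of its type; \<open>restrict_words\<close> projects the type onto it.\<close>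

definition restrict_words :: "((rat^3^3) list \<Rightarrow>\<^sub>0 rat) \<Rightarrow> (rat^3^3) list \<Rightarrow>\<^sub>0 rat" where
  "restrict_words = lin_ext pm_scale (\<lambda>w. if w \<in> lists B then Poly_Mapping.single w 1 else 0)"

lemma restrict_words_simps:
  "restrict_words 0 = 0" "restrict_words (v + w) = restrict_words v + restrict_words w"
  "restrict_words (Poly_Mapping.single x k) = (if x \<in> lists B then Poly_Mapping.single x k else 0)"
  unfolding restrict_words_def
  by (simp_all add: lin_ext_simps pm_vs.scale_left_distrib)

lemma restrict_words_scale: "restrict_words (pm_scale q v) = pm_scale q (restrict_words v)"
  using subset_UNIV[of "Poly_Mapping.keys v"]
  by (induction v rule: poly_mapping_carrier_induct) (simp_all add: restrict_words_simps pm_vs.scale_right_distrib)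

lemma restrict_words_closed: "restrict_words v \<in> carrier FA"
  using subset_UNIV[of "Poly_Mapping.keys v"]
proof (induction v rule: poly_mapping_carrier_induct)
  case (add v w)
  then show ?case
    using pm_vs.subspace_add[OF carrier_subspace] by (simp only: restrict_words_simps)
qed (simp_all add: restrict_words_simps)

lemma restrict_words_id: "v \<in> carrier FA \<Longrightarrow> restrict_words v = v"
proof -
  assume "v \<in> carrier FA"
  then have "Poly_Mapping.keys v \<subseteq> lists B" by simp
  then show "restrict_words v = v"
    by (induction v rule: poly_mapping_carrier_induct) (simp_all add: restrict_words_simps)
qed

text \<open>Left multiplication in the envelope, carried over to the image of \<open>proj\<close>
  and made total by \<open>restrict_words\<close>.\<close>

definition left_mult :: "rat^3^3 \<Rightarrow> ((rat^3^3) list \<Rightarrow>\<^sub>0 rat) \<Rightarrow> (rat^3^3) list \<Rightarrow>\<^sub>0 rat" where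
  "left_mult b v = proj (conv words (letter b) (restrict_words v))"

lemma left_mult_closed: "b \<in> B \<Longrightarrow> left_mult b v \<in> carrier FA"
  unfolding left_mult_def
  by (intro proj_closed FA.m_closed letter_closed restrict_words_closed)

text \<open>Changing the representative changes the product only within the ideal, which absorbs
  left factors. A product of several letters can therefore be projected once, at the end.\<close>

lemma left_mult_proj:
  assumes "b \<in> B" "v \<in> carrier FA"
  shows "left_mult b (proj v) = proj (conv words (letter b) v)"
proof -
  have "conv words (letter b) v - conv words (letter b) (proj v) = conv words (letter b) (v - proj v)"
    using conv_simps(4)[of words "letter b" "v - proj v" "proj v"] by simp
  also have "\<dots> \<in> rel_ideal"
    using assms(1) proj(3) by (intro rel.I_l_closed letter_closed)
  finally show ?thesis
    using proj_cong restrict_words_id[OF proj_closed[OF assms(2)]] by (simp add: left_mult_def)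
qed

lemma left_mult_linear: "Vector_Spaces.linear pm_scale pm_scale (left_mult b)"
  by unfold_locales
    (simp_all add: left_mult_def restrict_words_simps restrict_words_scale conv_simps conv_pm_scale
      proj.add proj.scale)

text \<open>After collecting the projections, the difference of the two sides is \<open>proj\<close>
  of a defining relation times \<open>w\<close>. That product is in the ideal because the ideal also
  absorbs right factors.\<close>

lemma left_mult_tetrad:
  assumes "a \<in> B" "b \<in> B" "c \<in> B" "d \<in> B"
  shows "left_mult a (left_mult b (left_mult c (left_mult d v))) -
      left_mult d (left_mult c (left_mult b (left_mult a v))) =
    (\<Sum>e\<in>B. pm_scale (coord (anti_tetrad a b c d) e) (left_mult e v))"
proof -
  define w where "w = restrict_words v"
  have w: "w \<in> carrier FA" by (simp only: w_def restrict_words_closed)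
  have four: "left_mult a (left_mult b (left_mult c (left_mult d v))) =
      proj (conv words (Poly_Mapping.single [a, b, c, d] 1) w)"
    if "a \<in> B" "b \<in> B" "c \<in> B" "d \<in> B" for a b c d
  proof -
    have "conv words (letter a) (conv words (letter b) (conv words (letter c) (conv words (letter d) w))) =
        conv words (conv words (letter a) (conv words (letter b) (conv words (letter c) (letter d)))) w"
      using that w by (simp only: FA.m_assoc FA.m_closed letter_closed)
    moreover have "left_mult d v = proj (conv words (letter d) w)"
      by (simp add: left_mult_def w_def)
    ultimately show ?thesis
      using that w
      by (simp only: left_mult_proj FA.m_closed letter_closed) (simp add: conv_simps)
  qed
  let ?r = "Poly_Mapping.single [a, b, c, d] 1 - Poly_Mapping.single [d, c, b, a] 1
    - (\<Sum>e\<in>B. Poly_Mapping.single [e] (coord (anti_tetrad a b c d) e))"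
  have "?r \<in> envelope_relations B"
    using assms unfolding envelope_relations_def by blast
  then have "?r \<in> rel_ideal"
    unfolding rel_ideal_def using FA.genideal_self[OF envelope_relations_closed] by blast
  then have "conv words ?r w \<in> rel_ideal"
    using w by (intro rel.I_r_closed)
  then have "proj (conv words ?r w) = 0"
    by (rule proj(2))
  moreover have "conv words (p - q) w = conv words p w - conv words q w" for p q
    using conv_simps(3)[of words "p - q" q w] by simp
  moreover have "conv words (\<Sum>e\<in>A. Poly_Mapping.single [e] (q e)) w =
      (\<Sum>e\<in>A. pm_scale (q e) (conv words (letter e) w))" for q and A :: "(rat^3^3) set"
  proof -
    have "conv words (\<Sum>e\<in>A. Poly_Mapping.single [e] (q e)) w =
        (\<Sum>e\<in>A. conv words (Poly_Mapping.single [e] (q e)) w)"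
      by (induction A rule: infinite_finite_induct) (simp_all add: conv_simps)
    also have "\<dots> = (\<Sum>e\<in>A. pm_scale (q e) (conv words (letter e) w))"
      by (simp flip: conv_pm_scale)
    finally show ?thesis .
  qed
  ultimately have "proj (conv words (Poly_Mapping.single [a, b, c, d] 1) w) -
      proj (conv words (Poly_Mapping.single [d, c, b, a] 1) w) =
      (\<Sum>e\<in>B. pm_scale (coord (anti_tetrad a b c d) e) (proj (conv words (letter e) w)))"
    by (simp add: proj.diff proj.sum proj.scale)
  then show ?thesis
    using assms by (simp add: four) (simp add: left_mult_def w_def)
qed

definition regular_rep :: "rat^3^3 \<Rightarrow> ((rat^3^3) list \<Rightarrow>\<^sub>0 rat) \<Rightarrow> (rat^3^3) list \<Rightarrow>\<^sub>0 rat" where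
  "regular_rep a v = (\<Sum>e\<in>B. pm_scale (of_rat (coord a e)) (left_mult e v))"

lemma quad_rep_regular: "quad_rep skew_matrices pm_scale regular_rep"
  unfolding regular_rep_def[abs_def]
  by (rule quad_rep_from_basis)
    (simp_all add: pm_vs.vector_space_axioms left_mult_linear left_mult_tetrad)

sublocale reg: tetrad_operators "pm_scale :: rat \<Rightarrow> _" "\<lambda>k. regular_rep (so3 k)"
  by (rule tetrad_operators_quad_rep[OF quad_rep_regular])

lemma regular_rep_basis: "b \<in> B \<Longrightarrow> regular_rep b v = left_mult b v"
  using finite_B
  by (simp add: regular_rep_def coord_simps if_distrib[of of_rat] if_distrib[of "\<lambda>x. pm_scale x _"] cong: if_cong)

definition env_basis :: "(nat \<times> 3 \<times> 3) option \<Rightarrow> (rat^3^3) list \<Rightarrow>\<^sub>0 rat" where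
  "env_basis = reg.envelope_basis (proj (Poly_Mapping.single [] 1))"

text \<open>This is the upper bound on the dimension. A word is built letter by letter, each letter
  acts through its coordinates in \<open>so3\<close>, and the span is invariant under these.\<close>

lemma proj_in_span:
  assumes "v \<in> carrier FA"
  shows "proj v \<in> pm_vs.span (env_basis ` basis_index)"
proof -
  let ?M = "pm_vs.span (env_basis ` basis_index)"
  have word: "proj (Poly_Mapping.single w 1) \<in> ?M" if "w \<in> lists B" for w
    using that
  proof (induction w)
    case Nil
    have "env_basis None \<in> ?M"
      by (intro pm_vs.span_base imageI) (simp add: basis_index_def)
    then show ?case by (simp add: env_basis_def reg.envelope_basis_def)
  next
    case (Cons b w)
    have "proj (Poly_Mapping.single (b # w) 1) = left_mult b (proj (Poly_Mapping.single w 1))"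
      using Cons.hyps by (subst left_mult_proj) (simp_all add: conv_simps)
    also have "\<dots> = regular_rep b (proj (Poly_Mapping.single w 1))"
      using Cons.hyps by (simp add: regular_rep_basis)
    also have "\<dots> = (\<Sum>k\<in>UNIV. pm_scale (of_rat (axial k b)) (regular_rep (so3 k) (proj (Poly_Mapping.single w 1))))"
      using Cons.hyps by (intro quad_rep_skew[OF quad_rep_regular] B_skew)
    also have "\<dots> \<in> ?M"
      using Cons.IH unfolding env_basis_def
      by (intro pm_vs.span_sum pm_vs.span_scale reg.span_envelope_basis_invariant)
    finally show ?case .
  qed
  have "Poly_Mapping.keys v \<subseteq> lists B" using assms by simp
  then show ?thesis
  proof (induction v rule: poly_mapping_carrier_induct)
    case (single w k)
    have "proj (Poly_Mapping.single w k) = pm_scale k (proj (Poly_Mapping.single w 1))"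
      by (simp flip: proj.scale)
    then show ?case using word[OF single] by (simp only: pm_vs.span_scale)
  qed (simp_all add: proj.zero proj.add pm_vs.span_zero pm_vs.span_add)
qed

end

section \<open>The target algebra\<close>

type_synonym 'k target = "'k \<times> ('k^3^3) \<times> ('k^3^3) \<times> ('k^3^3)"

abbreviation target_algebra :: "('k::field_char_0, 'k target) module" where
  "target_algebra \<equiv> field_algebra \<oplus>\<^sub>a matrix_algebra \<oplus>\<^sub>a matrix_algebra \<oplus>\<^sub>a matrix_algebra"

lemma type_algebra_target: "type_algebra target_algebra"
  by (intro type_algebra_direct_sum type_algebra_field type_algebra_matrix)

lemma target_mult:
  "(a, A, A', A'') \<otimes>\<^bsub>target_algebra\<^esub> (c, C, C', C'') = (a * c, A ** C, A' ** C', A'' ** C'')"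
  "\<one>\<^bsub>target_algebra\<^esub> = (1, mat 1, mat 1, mat 1)"
  "k \<odot>\<^bsub>target_algebra\<^esub> (a, A, A', A'') = (k * a, mscale k A, mscale k A', mscale k A'')"
  by simp_all

lemma mscale_simps:
  "mscale a A ** C = mscale a (A ** C)" "C ** mscale a A = mscale a (C ** A)"
  "mscale a (mscale b A) = mscale (a * b) A" "mscale 1 A = A"
  "mscale a (A + C) = mscale a A + mscale a C" "mscale (a + b) A = mscale a A + mscale b A"
  "mscale a (A - C) = mscale a A - mscale a C" "mscale a 0 = 0" "mscale 0 A = 0"
  for A C :: "'a::field^3^3"
  by (simp_all add: vec_eq_iff matrix_matrix_mult_def mscale_def algebra_simps sum_distrib_left)

lemma target_scale:
  fixes t u :: "'k::field_char_0 target"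
  shows "(k + l) \<odot>\<^bsub>target_algebra\<^esub> t = k \<odot>\<^bsub>target_algebra\<^esub> t + l \<odot>\<^bsub>target_algebra\<^esub> t"
    "k \<odot>\<^bsub>target_algebra\<^esub> (t + u) = k \<odot>\<^bsub>target_algebra\<^esub> t + k \<odot>\<^bsub>target_algebra\<^esub> u"
    "(k * l) \<odot>\<^bsub>target_algebra\<^esub> t = k \<odot>\<^bsub>target_algebra\<^esub> (l \<odot>\<^bsub>target_algebra\<^esub> t)"
    "1 \<odot>\<^bsub>target_algebra\<^esub> t = t"
    "(k * l) \<odot>\<^bsub>target_algebra\<^esub> (t \<otimes>\<^bsub>target_algebra\<^esub> u) =
      (k \<odot>\<^bsub>target_algebra\<^esub> t) \<otimes>\<^bsub>target_algebra\<^esub> (l \<odot>\<^bsub>target_algebra\<^esub> u)"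
  by (cases t; cases u; simp add: mscale_simps algebra_simps)+

lemma target_scale_0: "k \<odot>\<^bsub>target_algebra\<^esub> 0 = 0" "0 \<odot>\<^bsub>target_algebra\<^esub> t = 0"
  using target_scale(2)[of k 0 0] target_scale(1)[of 0 0 t] by simp_all

lemma sum_target_scale: "k \<odot>\<^bsub>target_algebra\<^esub> (\<Sum>a\<in>A. f a) = (\<Sum>a\<in>A. k \<odot>\<^bsub>target_algebra\<^esub> f a)"
  by (induction A rule: infinite_finite_induct) (simp_all add: target_scale target_scale_0)

lemma so3_casimir: "(\<Sum>k\<in>UNIV. so3 k ** (so3 k ** A)) = - A - (A :: 'a::comm_ring_1^3^3)"
proof -
  have "(\<Sum>k\<in>UNIV. so3 k ** (so3 k ** A)) = (\<Sum>k\<in>UNIV. so3 k ** so3 k) ** A"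
    by (simp add: sum_3 matrix_mul_assoc matrix_matrix_mult_def vec_eq_iff algebra_simps sum.distrib)
  moreover have "(\<Sum>k\<in>UNIV. so3 k ** so3 k) = (mat (- 2) :: 'a^3^3)"
    by (simp add: so3_mult vec_eq_iff sum_3 forall_3 kron_def mat_def)
  moreover have "mat (- 2) ** A = - A - A"
    by (simp add: matrix_matrix_mult_def mat_def vec_eq_iff sum_3 forall_3)
  ultimately show ?thesis by simp
qed

definition matrix_unit :: "3 \<Rightarrow> 3 \<Rightarrow> 'a::comm_ring_1^3^3" where
  "matrix_unit i j = (\<chi> p q. kron p i * kron q j)"

lemma so3_matrix_unit: "so3 j ** (so3 i ** A) + mscale (kron i j) A = matrix_unit i j ** (A :: 'a::field^3^3)"
proof -
  have "matrix_unit i j = so3 j ** so3 i + mscale (kron i j) (mat 1 :: 'a^3^3)"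
    by (simp add: so3_mult matrix_unit_def vec_eq_iff mscale_def mat_def kron_def)
  moreover have "(A + C) ** D = A ** D + C ** D" for A C D :: "'a^3^3"
    by (simp add: matrix_matrix_mult_def vec_eq_iff distrib_right sum.distrib)
  ultimately show ?thesis
    by (simp add: mscale_simps matrix_mul_assoc)
qed

text \<open>The components are the trivial representation and the twists by 1,
  \<open>\<omega>\<close> and the square of \<open>\<omega>\<close>.\<close>

definition target_letter :: "'k::field_char_0 \<Rightarrow> rat^3^3 \<Rightarrow> 'k target" where
  "target_letter \<omega> A = (0, of_rat_matrix A, mscale \<omega> (of_rat_matrix A), mscale (\<omega>\<^sup>2) (of_rat_matrix A))"

text \<open>On the twist by \<open>l\<close> the operator \<open>S\<close> is \<open>l^2\<close> and
  \<open>F i j\<close> is \<open>l^2\<close> times a matrix unit. The factor from \<open>F\<close>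
  makes the exponent \<open>Suc m\<close>; in the last component \<open>l^2\<close> is the fourth
  power of \<open>\<omega>\<close>, that is \<open>\<omega>\<close>.\<close>

definition target_basis :: "'k::field_char_0 \<Rightarrow> (nat \<times> 3 \<times> 3) option \<Rightarrow> 'k target" where
  "target_basis \<omega> a = (case a of None \<Rightarrow> \<one>\<^bsub>target_algebra\<^esub> | Some (m, i, j) \<Rightarrow>
    (0, matrix_unit i j, mscale ((\<omega>\<^sup>2) ^ Suc m) (matrix_unit i j), mscale (\<omega> ^ Suc m) (matrix_unit i j)))"

context
  fixes \<omega> :: "'k::field_char_0"
  assumes \<omega>: "\<omega>\<^sup>2 + \<omega> + 1 = 0"
begin

lemma omega_sq: "\<omega> * \<omega> = - \<omega> - 1"
  using \<omega> by (simp add: power2_eq_square eq_neg_iff_add_eq_0 algebra_simps)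

lemma omega_powers: "\<omega> ^ 3 = 1" "(\<omega>\<^sup>2) ^ 2 = \<omega>" "(\<omega>\<^sup>2) ^ 3 = 1"
proof -
  have "\<omega> ^ 3 - 1 = (\<omega> - 1) * (\<omega>\<^sup>2 + \<omega> + 1)"
    by (simp add: power3_eq_cube power2_eq_square algebra_simps)
  then show 3: "\<omega> ^ 3 = 1" using \<omega> by simp
  have "(\<omega>\<^sup>2) ^ 2 = \<omega> * \<omega> ^ 3" "(\<omega>\<^sup>2) ^ 3 = (\<omega> ^ 3)\<^sup>2"
    by (simp_all add: eval_nat_numeral mult.assoc)
  then show "(\<omega>\<^sup>2) ^ 2 = \<omega>" "(\<omega>\<^sup>2) ^ 3 = 1" using 3 by simp_all
qed

text \<open>Inversion of the Fourier transform on the cyclic group of order three, with exponents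
  starting at 1, so that \<open>x2\<close> carries the coefficient 1. The forward implication yields
  independence of the 28 images, the converse that they span.\<close>

lemma discrete_fourier_3:
  "y0 = x0 + x1 + x2 \<and> y1 = \<omega>\<^sup>2 * x0 + \<omega> * x1 + x2 \<and> y2 = \<omega> * x0 + \<omega>\<^sup>2 * x1 + x2 \<longleftrightarrow>
   x0 = (y0 + \<omega> * y1 + \<omega>\<^sup>2 * y2) / 3 \<and> x1 = (y0 + \<omega>\<^sup>2 * y1 + \<omega> * y2) / 3 \<and> x2 = (y0 + y1 + y2) / 3"
proof -
  have w: "\<omega>\<^sup>2 = - \<omega> - 1" using omega_sq by (simp add: power2_eq_square)
  have ww: "\<omega> * (\<omega> * z) = - \<omega> * z - z" for z
    using arg_cong[OF omega_sq, of "\<lambda>u. u * z"] by (simp add: algebra_simps)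
  show ?thesis
  proof (intro iffI)
    assume y: "y0 = x0 + x1 + x2 \<and> y1 = \<omega>\<^sup>2 * x0 + \<omega> * x1 + x2 \<and> y2 = \<omega> * x0 + \<omega>\<^sup>2 * x1 + x2"
    show "x0 = (y0 + \<omega> * y1 + \<omega>\<^sup>2 * y2) / 3 \<and> x1 = (y0 + \<omega>\<^sup>2 * y1 + \<omega> * y2) / 3 \<and> x2 = (y0 + y1 + y2) / 3"
      unfolding y[THEN conjunct1] y[THEN conjunct2, THEN conjunct1] y[THEN conjunct2, THEN conjunct2]
      by (simp add: w field_simps ww)
  next
    assume x: "x0 = (y0 + \<omega> * y1 + \<omega>\<^sup>2 * y2) / 3 \<and> x1 = (y0 + \<omega>\<^sup>2 * y1 + \<omega> * y2) / 3 \<and> x2 = (y0 + y1 + y2) / 3"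
    show "y0 = x0 + x1 + x2 \<and> y1 = \<omega>\<^sup>2 * x0 + \<omega> * x1 + x2 \<and> y2 = \<omega> * x0 + \<omega>\<^sup>2 * x1 + x2"
      unfolding x[THEN conjunct1] x[THEN conjunct2, THEN conjunct1] x[THEN conjunct2, THEN conjunct2]
      by (simp add: w field_simps ww)
  qed
qed

lemma sum_target_basis:
  "(\<Sum>a\<in>basis_index. c a \<odot>\<^bsub>target_algebra\<^esub> target_basis \<omega> a) =
    (c None,
     \<chi> p q. c None * kron p q + (c (Some (0, p, q)) + c (Some (1, p, q)) + c (Some (2, p, q))),
     \<chi> p q. c None * kron p q +
      (\<omega>\<^sup>2 * c (Some (0, p, q)) + \<omega> * c (Some (1, p, q)) + c (Some (2, p, q))),
     \<chi> p q. c None * kron p q +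
      (\<omega> * c (Some (0, p, q)) + \<omega>\<^sup>2 * c (Some (1, p, q)) + c (Some (2, p, q))))"
proof -
  have split: "(\<Sum>a\<in>basis_index. f a) = f None + (\<Sum>m<3. \<Sum>i\<in>UNIV. \<Sum>j\<in>UNIV. f (Some (m, i, j)))"
    for f :: "_ \<Rightarrow> 'k target"
    by (simp add: basis_index_def sum.reindex sum.cartesian_product split_def comp_def flip: UNIV_Times_UNIV)
  have unit: "(\<Sum>m<3. \<Sum>i\<in>UNIV. \<Sum>j\<in>UNIV. d (Some (m, i, j)) * (h m * (kron p i * kron q j))) =
      h 0 * d (Some (0, p, q)) + h 1 * d (Some (1, p, q)) + h 2 * d (Some (2, p, q))"
    for h :: "nat \<Rightarrow> 'k" and d p q
  proof -
    have "(\<Sum>i\<in>UNIV. \<Sum>j\<in>UNIV. d (Some (m, i, j)) * (h m * (kron p i * kron q j))) =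
        (\<Sum>i\<in>UNIV. kron p i * (\<Sum>j\<in>UNIV. kron q j * (h m * d (Some (m, i, j)))))" for m
      by (simp add: sum_distrib_left mult_ac)
    then show ?thesis
      by (simp add: sum_kron eval_nat_numeral)
  qed
  have h: "(\<omega>\<^sup>2) ^ Suc 0 = \<omega>\<^sup>2" "(\<omega>\<^sup>2) ^ Suc 1 = \<omega>" "(\<omega>\<^sup>2) ^ Suc 2 = 1"
    "\<omega> ^ Suc 0 = \<omega>" "\<omega> ^ Suc 1 = \<omega>\<^sup>2" "\<omega> ^ Suc 2 = 1"
  proof -
    have suc: "Suc 0 = 1" "Suc 1 = 2" "Suc 2 = 3" by simp_all
    show "(\<omega>\<^sup>2) ^ Suc 0 = \<omega>\<^sup>2" "(\<omega>\<^sup>2) ^ Suc 1 = \<omega>" "(\<omega>\<^sup>2) ^ Suc 2 = 1"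
      "\<omega> ^ Suc 0 = \<omega>" "\<omega> ^ Suc 1 = \<omega>\<^sup>2" "\<omega> ^ Suc 2 = 1"
      unfolding suc omega_powers by simp_all
  qed
  have id: "mat 1 $ p $ q = (kron p q :: 'k)" for p q :: 3
    by (simp add: mat_def kron_def)
  show ?thesis
    unfolding split
    using unit[of c "\<lambda>_. 1"] unit[of c "\<lambda>m. (\<omega>\<^sup>2) ^ Suc m", unfolded h] unit[of c "\<lambda>m. \<omega> ^ Suc m", unfolded h]
    by (simp add: target_basis_def target_mult prod_eq_iff fst_sum snd_sum vec_eq_iff sum_component
        mscale_def matrix_unit_def id mult.assoc)
qed

lemma target_basis_independent:
  assumes "(\<Sum>a\<in>basis_index. c a \<odot>\<^bsub>target_algebra\<^esub> target_basis \<omega> a) = 0" "a \<in> basis_index"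
  shows "c a = 0"
proof -
  have None: "c None = 0"
    using assms(1) by (simp add: sum_target_basis zero_prod_def)
  have "c (Some (m, i, j)) = 0" if "m < 3" for m i j
  proof -
    have "0 = c (Some (0, i, j)) + c (Some (1, i, j)) + c (Some (2, i, j)) \<and>
        0 = \<omega>\<^sup>2 * c (Some (0, i, j)) + \<omega> * c (Some (1, i, j)) + c (Some (2, i, j)) \<and>
        0 = \<omega> * c (Some (0, i, j)) + \<omega>\<^sup>2 * c (Some (1, i, j)) + c (Some (2, i, j))"
      using assms(1) by (simp add: sum_target_basis zero_prod_def None vec_eq_iff)
    then show ?thesis
      unfolding discrete_fourier_3 using that by (auto simp: less_Suc_eq numeral_3_eq_3 numeral_2_eq_2)
  qed
  then show ?thesis
    using assms(2) None by (auto simp: basis_index_def)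
qed

lemma target_basis_spans: "\<exists>c. t = (\<Sum>a\<in>basis_index. c a \<odot>\<^bsub>target_algebra\<^esub> target_basis \<omega> a)"
proof -
  obtain b Y0 Y1 Y2 where t: "t = (b, Y0, Y1, Y2)" by (cases t)
  define y where "y Z p q = Z $ p $ q - b * kron p q" for Z :: "'k^3^3" and p q
  \<comment> \<open>Inverse Fourier transform of the three matrices, after removing the multiple of
    the identity that the first component forces.\<close>
  define c where "c a = (case a of None \<Rightarrow> b | Some (m, p, q) \<Rightarrow>
    (if m = 0 then (y Y0 p q + \<omega> * y Y1 p q + \<omega>\<^sup>2 * y Y2 p q) / 3
     else if m = 1 then (y Y0 p q + \<omega>\<^sup>2 * y Y1 p q + \<omega> * y Y2 p q) / 3
     else (y Y0 p q + y Y1 p q + y Y2 p q) / 3))" for a :: "(nat \<times> 3 \<times> 3) option"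
  have "y Y0 p q = c (Some (0, p, q)) + c (Some (1, p, q)) + c (Some (2, p, q)) \<and>
      y Y1 p q = \<omega>\<^sup>2 * c (Some (0, p, q)) + \<omega> * c (Some (1, p, q)) + c (Some (2, p, q)) \<and>
      y Y2 p q = \<omega> * c (Some (0, p, q)) + \<omega>\<^sup>2 * c (Some (1, p, q)) + c (Some (2, p, q))" for p q
    unfolding discrete_fourier_3 by (simp add: c_def)
  then have "Y0 $ p $ q = b * kron p q + (c (Some (0, p, q)) + c (Some (1, p, q)) + c (Some (2, p, q)))"
    "Y1 $ p $ q = b * kron p q + (\<omega>\<^sup>2 * c (Some (0, p, q)) + \<omega> * c (Some (1, p, q)) + c (Some (2, p, q)))"
    "Y2 $ p $ q = b * kron p q + (\<omega> * c (Some (0, p, q)) + \<omega>\<^sup>2 * c (Some (1, p, q)) + c (Some (2, p, q)))"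
    for p q
    by (simp_all add: y_def algebra_simps)
  moreover have "c None = b" by (simp add: c_def)
  ultimately have "t = (\<Sum>a\<in>basis_index. c a \<odot>\<^bsub>target_algebra\<^esub> target_basis \<omega> a)"
    by (simp add: t sum_target_basis vec_eq_iff)
  then show ?thesis by blast
qed

end

section \<open>The homomorphism from the free algebra to the target\<close>

locale envelope_target = skew_basis +
  fixes \<omega> :: "'k::field_char_0"
  assumes omega: "\<omega>\<^sup>2 + \<omega> + 1 = 0"
begin

sublocale T: type_algebra "target_algebra :: ('k, 'k target) module"
  by (rule type_algebra_target)

abbreviation tmult (infixl \<open>\<star>\<close> 70) where "x \<star> y \<equiv> x \<otimes>\<^bsub>target_algebra :: ('k, 'k target) module\<^esub> y"
abbreviation tscale (infixr \<open>\<bullet>\<^sub>t\<close> 75) where "k \<bullet>\<^sub>t t \<equiv> k \<odot>\<^bsub>target_algebra :: ('k, 'k target) module\<^esub> t"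
abbreviation "image_letter \<equiv> target_letter \<omega>"

definition word_image :: "(rat^3^3) list \<Rightarrow> 'k target" where
  "word_image w = foldr (\<lambda>a t. image_letter a \<star> t) w \<one>\<^bsub>target_algebra\<^esub>"

definition env_hom :: "((rat^3^3) list \<Rightarrow>\<^sub>0 rat) \<Rightarrow> 'k target" where
  "env_hom = lin_ext (\<lambda>q t. of_rat q \<bullet>\<^sub>t t) word_image"

lemma T_simps:
  "x \<star> (y \<star> z) = (x \<star> y) \<star> z" "(x + y) \<star> z = x \<star> z + y \<star> z" "x \<star> (y + z) = x \<star> y + x \<star> z"
  "\<one>\<^bsub>target_algebra\<^esub> \<star> x = x" "x \<star> \<one>\<^bsub>target_algebra\<^esub> = x" "0 \<star> x = 0" "x \<star> 0 = 0"
  for x y z :: "'k target"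
  using T.m_assoc[of x y z] T.l_distr[of x y z] T.r_distr[of y z x] T.l_one[of x] T.r_one[of x]
    T.l_null[of x] T.r_null[of x]
  by (simp_all del: direct_sum_algebra_simps)

lemma env_hom_ring_hom: "ring_hom_ring FA target_algebra env_hom"
  unfolding env_hom_def
proof (rule T.lin_ext_hom[OF monoid_word_monoid])
  show "of_rat (a + b) \<bullet>\<^sub>t x = of_rat a \<bullet>\<^sub>t x + of_rat b \<bullet>\<^sub>t x" for a b x
    by (simp only: of_rat_add target_scale)
  show "of_rat (a * b) \<bullet>\<^sub>t (x \<star> y) = (of_rat a \<bullet>\<^sub>t x) \<star> (of_rat b \<bullet>\<^sub>t y)" for a b x y
    by (simp only: of_rat_mult target_scale(5))
  show "of_rat 1 \<bullet>\<^sub>t \<one>\<^bsub>target_algebra\<^esub> = \<one>\<^bsub>target_algebra\<^esub>"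
    by (simp only: of_rat_1 target_scale(4))
  have "word_image (v @ w) = word_image v \<star> word_image w" for v w
    by (induction v) (simp_all add: word_image_def T_simps del: direct_sum_algebra_simps)
  then show "word_image (v \<otimes>\<^bsub>words\<^esub> w) = word_image v \<star> word_image w" for v w
    by (simp del: direct_sum_algebra_simps)
  show "word_image \<one>\<^bsub>words\<^esub> = \<one>\<^bsub>target_algebra\<^esub>"
    by (simp add: word_image_def)
qed

sublocale env_hom: ring_hom_ring FA target_algebra env_hom
  by (rule env_hom_ring_hom)

lemma rat_lin_ext_simps:
  defines "h \<equiv> \<lambda>g. lin_ext (\<lambda>q t. of_rat q \<bullet>\<^sub>t t) g"
  shows "h g 0 = 0" "h g (p + r) = h g p + h g r" "h g (p - r) = h g p - h g r"
    "h g (\<Sum>a\<in>A. f a) = (\<Sum>a\<in>A. h g (f a))"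
    "h g (Poly_Mapping.single x q) = of_rat q \<bullet>\<^sub>t g x"
proof -
  have "of_rat 0 \<bullet>\<^sub>t t = 0" "of_rat (a + b) \<bullet>\<^sub>t t = of_rat a \<bullet>\<^sub>t t + of_rat b \<bullet>\<^sub>t t"
    for a b and t :: "'k target"
    by (simp_all only: of_rat_0 of_rat_add target_scale target_scale_0)
  note lin = lin_ext_simps[of "\<lambda>q t. of_rat q \<bullet>\<^sub>t t", OF this]
  show 0: "h g 0 = 0" unfolding h_def by (rule lin)
  show add: "h g (p + r) = h g p + h g r" for p r unfolding h_def by (rule lin)
  show "h g (Poly_Mapping.single x q) = of_rat q \<bullet>\<^sub>t g x" unfolding h_def by (rule lin)
  show "h g (p - r) = h g p - h g r"
    using add[of "p - r" r] by simp
  show "h g (\<Sum>a\<in>A. f a) = (\<Sum>a\<in>A. h g (f a))"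
    by (induction A rule: infinite_finite_induct) (simp_all add: 0 add)
qed

lemmas env_hom_simps = rat_lin_ext_simps[where g = word_image, folded env_hom_def]

lemma env_hom_scale: "env_hom (pm_scale q v) = of_rat q \<bullet>\<^sub>t env_hom v"
  using subset_UNIV[of "Poly_Mapping.keys v"]
  by (induction v rule: poly_mapping_carrier_induct)
    (simp_all add: env_hom_simps pm_scale_add of_rat_mult target_scale target_scale_0
      del: direct_sum_algebra_simps)

lemma image_letter_simps:
  "image_letter (A + C) = image_letter A + image_letter C"
  "image_letter (mscale q A) = of_rat q \<bullet>\<^sub>t image_letter A"
  "image_letter 0 = 0"
proof -
  show "image_letter (A + C) = image_letter A + image_letter C"
    "image_letter (mscale q A) = of_rat q \<bullet>\<^sub>t image_letter A"
    by (simp_all add: target_letter_def of_rat_matrix_simps mscale_simps mult.commute)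
  show "image_letter 0 = 0"
    by (simp add: target_letter_def mscale_simps zero_prod_def vec_eq_iff map_matrix_def mscale_def)
qed

lemma image_letter_coord:
  assumes "A \<in> skew_matrices"
  shows "(\<Sum>e\<in>B. of_rat (coord A e) \<bullet>\<^sub>t image_letter e) = image_letter A"
  using assms
proof (induction A rule: skew_induct)
  case (basis b)
  then have "(\<Sum>e\<in>B. of_rat (coord b e) \<bullet>\<^sub>t image_letter e) = (\<Sum>e\<in>B. if e = b then image_letter e else 0)"
    by (intro sum.cong refl) (simp add: coord_simps target_scale target_scale_0 del: direct_sum_algebra_simps)
  then show ?case using basis finite_B by simp
next
  case zero
  then show ?case
    using coord_simps(2)[of 0 0] subspace_skew_matrices
    by (simp add: mat_vs.representation_zero target_scale_0 image_letter_simps del: direct_sum_algebra_simps)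
next
  case (add A C)
  then show ?case
    by (simp add: coord_simps of_rat_add target_scale sum.distrib image_letter_simps del: direct_sum_algebra_simps)
next
  case (scale q A)
  then show ?case
    by (simp add: coord_simps of_rat_mult target_scale image_letter_simps flip: sum_target_scale
        del: direct_sum_algebra_simps)
qed

lemma image_letter_tetrad:
  "image_letter (anti_tetrad a b c d) =
    image_letter a \<star> (image_letter b \<star> (image_letter c \<star> image_letter d)) -
    image_letter d \<star> (image_letter c \<star> (image_letter b \<star> image_letter a))"
proof -
  have 3: "\<omega> * (\<omega> * \<omega>) = 1"
    using omega_powers(1)[OF omega] by (simp add: power3_eq_cube mult.assoc)
  have 4: "\<omega> * (\<omega> * (\<omega> * z)) = z" for z
  proof -
    have "\<omega> * (\<omega> * (\<omega> * z)) = \<omega> * (\<omega> * \<omega>) * z" by (simp only: mult.assoc)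
    then show ?thesis by (simp only: 3 mult_1)
  qed
  show ?thesis
    by (simp add: target_letter_def anti_tetrad_def of_rat_matrix_simps mscale_simps matrix_mul_assoc
        power2_eq_square mult.assoc 3 4)
qed

lemma env_hom_rel_ideal: "v \<in> rel_ideal \<Longrightarrow> env_hom v = 0"
proof -
  have "envelope_relations B \<subseteq> a_kernel FA target_algebra env_hom"
  proof
    fix r
    assume r: "r \<in> envelope_relations B"
    obtain a b c d where abcd: "a \<in> B" "b \<in> B" "c \<in> B" "d \<in> B"
      and r_eq: "r = Poly_Mapping.single [a, b, c, d] 1 - Poly_Mapping.single [d, c, b, a] 1
        - (\<Sum>e\<in>B. Poly_Mapping.single [e] (coord (anti_tetrad a b c d) e))"
      using r unfolding envelope_relations_def mem_Collect_eq by (elim exE conjE) (rule that)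
    have "anti_tetrad a b c d \<in> skew_matrices"
      using abcd B_skew by (intro anti_tetrad_skew_matrices)
    then have "env_hom r = 0"
      unfolding r_eq
      by (simp add: env_hom_simps word_image_def target_scale image_letter_coord
          image_letter_tetrad T_simps(5) del: direct_sum_algebra_simps)
    then show "r \<in> a_kernel FA target_algebra env_hom"
      using r envelope_relations_closed by (auto simp only: a_kernel_def' T.zero_eq)
  qed
  then have "rel_ideal \<subseteq> a_kernel FA target_algebra env_hom"
    unfolding rel_ideal_def by (intro FA.genideal_minimal env_hom.kernel_is_ideal)
  then show "v \<in> rel_ideal \<Longrightarrow> env_hom v = 0"
    by (auto simp only: a_kernel_def' T.zero_eq)
qed

lemma env_hom_proj: "env_hom (proj v) = env_hom v"
  using env_hom_rel_ideal[OF proj(3)[of v]] by (simp add: env_hom_simps)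

lemma env_hom_left_mult:
  assumes "b \<in> B" "v \<in> carrier FA"
  shows "env_hom (left_mult b v) = image_letter b \<star> env_hom v"
proof -
  have "env_hom (left_mult b v) = env_hom (conv words (letter b) v)"
    unfolding left_mult_def restrict_words_id[OF assms(2)] by (rule env_hom_proj)
  also have "\<dots> = env_hom (letter b) \<star> env_hom v"
    using assms by (intro env_hom.hom_mult letter_closed)
  also have "env_hom (letter b) = image_letter b"
    by (simp add: env_hom_simps word_image_def target_scale T_simps del: direct_sum_algebra_simps)
  finally show ?thesis .
qed

lemma sum_T_mult: "(\<Sum>a\<in>A. f a) \<star> t = (\<Sum>a\<in>A. f a \<star> t)"
  by (induction A rule: infinite_finite_induct) (simp_all add: T_simps del: direct_sum_algebra_simps)

lemma tscale_mult: "(k \<bullet>\<^sub>t t) \<star> u = k \<bullet>\<^sub>t (t \<star> u)"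
  using target_scale(5)[of k 1 t u] by (simp add: target_scale del: direct_sum_algebra_simps)

text \<open>The bridge to the target: the regular representation becomes left multiplication by
  images of letters, so \<open>S\<close> and \<open>F\<close> can be evaluated with
  matrices.\<close>

lemma env_hom_regular_rep:
  assumes "A \<in> skew_matrices" "v \<in> carrier FA"
  shows "env_hom (regular_rep A v) = image_letter A \<star> env_hom v"
proof -
  have "env_hom (regular_rep A v) = (\<Sum>e\<in>B. of_rat (coord A e) \<bullet>\<^sub>t (image_letter e \<star> env_hom v))"
    using assms(2)
    by (simp add: regular_rep_def env_hom_simps env_hom_scale env_hom_left_mult
        del: direct_sum_algebra_simps monoid_algebra_simps)
  also have "\<dots> = image_letter A \<star> env_hom v"
    by (simp add: sum_T_mult tscale_mult flip: image_letter_coord[OF assms(1)] del: direct_sum_algebra_simps)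
  finally show ?thesis .
qed

lemma regular_rep_closed: "regular_rep A v \<in> carrier FA"
  unfolding regular_rep_def
  by (intro pm_vs.subspace_sum[OF carrier_subspace] pm_vs.subspace_scale[OF carrier_subspace] left_mult_closed)

lemma reg_S_closed: "reg.S v \<in> carrier FA"
  unfolding reg.S_def
  by (intro pm_vs.subspace_sum[OF carrier_subspace] pm_vs.subspace_scale[OF carrier_subspace] regular_rep_closed)

lemma reg_F_closed: "reg.F i j v \<in> carrier FA"
  unfolding reg.F_def
  by (intro pm_vs.subspace_add[OF carrier_subspace] pm_vs.subspace_scale[OF carrier_subspace]
      regular_rep_closed reg_S_closed)

text \<open>By \<open>so3_casimir\<close>, \<open>S\<close> acts on the twist by \<open>l\<close> as
  \<open>l^2\<close>; the last component uses that the fourth power of \<open>\<omega>\<close> is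
  \<open>\<omega>\<close>.\<close>

lemma env_hom_S:
  assumes "v \<in> carrier FA" "env_hom v = (a, A, A', A'')"
  shows "env_hom (reg.S v) = (0, A, mscale (\<omega>\<^sup>2) A', mscale \<omega> A'')"
proof -
  have w4: "\<omega> ^ 4 = \<omega>"
    using omega_powers(2)[OF omega] by simp
  have half: "mscale (1 / 2) (2 * C) = C" "mscale (k / 2) (2 * C) = mscale k C" for C :: "'k^3^3" and k
    by (simp_all add: vec_eq_iff mscale_def)
  have "env_hom (reg.S v) = of_rat (- 1 / 2) \<bullet>\<^sub>t (\<Sum>k\<in>UNIV. image_letter (so3 k) \<star> (image_letter (so3 k) \<star> env_hom v))"
    using assms(1)
    by (simp only: reg.S_def env_hom_scale env_hom_simps env_hom_regular_rep[OF so3_skew] regular_rep_closed)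
  also have "\<dots> = (- 1 / 2) \<bullet>\<^sub>t (0, \<Sum>k\<in>UNIV. so3 k ** (so3 k ** A),
      mscale (\<omega>\<^sup>2) (\<Sum>k\<in>UNIV. so3 k ** (so3 k ** A')), mscale \<omega> (\<Sum>k\<in>UNIV. so3 k ** (so3 k ** A'')))"
    unfolding assms(2)
    by (simp add: target_letter_def sum_3 of_rat_matrix_simps mscale_simps w4 of_rat_divide of_rat_minus
        power2_eq_square[symmetric])
  also have "\<dots> = (0, A, mscale (\<omega>\<^sup>2) A', mscale \<omega> A'')"
    unfolding so3_casimir by (simp add: mscale_simps) (simp add: half)
  finally show ?thesis .
qed

lemma env_hom_F:
  assumes "v \<in> carrier FA" "env_hom v = (a, A, A', A'')"
  shows "env_hom (reg.F i j v) =
    (0, matrix_unit i j ** A, mscale (\<omega>\<^sup>2) (matrix_unit i j ** A'), mscale \<omega> (matrix_unit i j ** A''))"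
proof -
  have w4: "\<omega> ^ 4 = \<omega>"
    using omega_powers(2)[OF omega] by simp
  have "env_hom (reg.F i j v) =
      image_letter (so3 j) \<star> (image_letter (so3 i) \<star> env_hom v) + kron i j \<bullet>\<^sub>t env_hom (reg.S v)"
    using assms(1)
    by (simp only: reg.F_def env_hom_simps env_hom_scale env_hom_regular_rep[OF so3_skew] regular_rep_closed
        of_rat_eps_kron)
  then show ?thesis
    unfolding env_hom_S[OF assms] assms(2) so3_matrix_unit[symmetric]
    by (simp add: target_letter_def of_rat_matrix_simps mscale_simps w4 mult.commute
        power2_eq_square[symmetric])
qed

lemma env_basis_closed: "env_basis a \<in> carrier FA"
proof -
  have "(reg.S ^^ m) (reg.F i j v) \<in> carrier FA" for m i j v
    by (cases m) (simp_all only: funpow.simps comp_apply id_apply reg_S_closed reg_F_closed)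
  moreover have "proj (Poly_Mapping.single [] 1) \<in> carrier FA"
    by (rule proj_closed) simp
  ultimately show ?thesis
    unfolding env_basis_def reg.envelope_basis_def by (simp split: option.split del: monoid_algebra_simps)
qed

lemma env_hom_env_basis: "env_hom (env_basis a) = target_basis \<omega> a"
proof -
  define u where "u = proj (Poly_Mapping.single [] 1)"
  have u: "u \<in> carrier FA"
    unfolding u_def by (rule proj_closed) simp
  have hu: "env_hom u = (1, mat 1, mat 1, mat 1)"
    unfolding u_def env_hom_proj by (simp add: env_hom_simps word_image_def mscale_simps)
  have pow: "(reg.S ^^ m) (reg.F i j u) \<in> carrier FA \<and> env_hom ((reg.S ^^ m) (reg.F i j u)) =
      (0, matrix_unit i j, mscale ((\<omega>\<^sup>2) ^ Suc m) (matrix_unit i j), mscale (\<omega> ^ Suc m) (matrix_unit i j))"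
    for m i j
  proof (induction m)
    case 0
    show ?case
      using env_hom_F[OF u hu] reg_F_closed by (simp del: monoid_algebra_simps)
  next
    case (Suc m)
    then show ?case
      using env_hom_S[of "(reg.S ^^ m) (reg.F i j u)"] reg_S_closed
      by (simp add: mscale_simps mult_ac del: monoid_algebra_simps)
  qed
  show ?thesis
  proof (cases a)
    case None
    then show ?thesis
      by (simp add: env_basis_def reg.envelope_basis_def target_basis_def hu flip: u_def)
  next
    case (Some mij)
    then show ?thesis
      using pow by (cases mij) (simp add: env_basis_def reg.envelope_basis_def target_basis_def flip: u_def)
  qed
qed

lemma env_normal_form:
  assumes "v \<in> carrier FA"
  shows "\<exists>c. v - (\<Sum>a\<in>basis_index. pm_scale (c a) (env_basis a)) \<in> rel_ideal"
proof -
  obtain c where "proj v = (\<Sum>a\<in>basis_index. pm_scale (c a) (env_basis a))"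
    using pm_vs.span_image_finite[OF finite_basis_index proj_in_span[OF assms]] by blast
  then show ?thesis
    using proj(3)[of v] by (intro exI[of _ c]) simp
qed

text \<open>The normal form has rational coefficients, and the images of the 28 elements are
  independent even over \<open>'k\<close>, so a zero image forces every coefficient to
  vanish.\<close>

lemma env_hom_kernel:
  assumes "v \<in> carrier FA" "env_hom v = 0"
  shows "v \<in> rel_ideal"
proof -
  obtain c where c: "v - (\<Sum>a\<in>basis_index. pm_scale (c a) (env_basis a)) \<in> rel_ideal"
    using env_normal_form[OF assms(1)] by blast
  have "(\<Sum>a\<in>basis_index. of_rat (c a) \<bullet>\<^sub>t target_basis \<omega> a) = 0"
    using env_hom_rel_ideal[OF c] assms(2)
    by (simp add: env_hom_simps env_hom_scale env_hom_env_basis del: direct_sum_algebra_simps)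
  then have "c a = 0" if "a \<in> basis_index" for a
    using target_basis_independent[OF omega, of "\<lambda>a. of_rat (c a)" a] that by simp
  then have "(\<Sum>a\<in>basis_index. pm_scale (c a) (env_basis a)) = 0"
    by (intro sum.neutral ballI) (simp only: pm_vs.scale_zero_left)
  then show ?thesis using c by simp
qed

end

section \<open>Extension of scalars\<close>

lemma quotient_algebra_simps [simp]:
  "carrier (quotient_algebra A I) = carrier (A Quot I)" "mult (quotient_algebra A I) = mult (A Quot I)"
  "one (quotient_algebra A I) = one (A Quot I)" "zero (quotient_algebra A I) = zero (A Quot I)"
  "add (quotient_algebra A I) = add (A Quot I)"
  "smult (quotient_algebra A I) = (\<lambda>k S. \<Union>x\<in>S. I +>\<^bsub>A\<^esub> (k \<odot>\<^bsub>A\<^esub> x))"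
  by (simp_all add: quotient_algebra_def)

lemma rat_algebra_simps [simp]:
  "carrier rat_algebra = UNIV" "x \<otimes>\<^bsub>rat_algebra\<^esub> y = x * y" "x \<oplus>\<^bsub>rat_algebra\<^esub> y = x + y"
  "\<one>\<^bsub>rat_algebra\<^esub> = 1" "q \<odot>\<^bsub>rat_algebra\<^esub> x = of_rat q * x"
  by (simp_all add: rat_algebra_def ring_of_type_algebra_def)

context envelope_target
begin

section \<open>The envelope as a quotient ring and its map into the target\<close>

abbreviation "Env \<equiv> envelope B"
abbreviation "ratK \<equiv> (rat_algebra :: (rat, 'k) module)"
abbreviation "coset v \<equiv> rel_ideal +>\<^bsub>FA\<^esub> v"

lemma envelope_eq: "Env = quotient_algebra FA rel_ideal"
  by (simp add: envelope_def free_algebra_eq rel_ideal_def)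

lemma coset_eq: "v - w \<in> rel_ideal \<Longrightarrow> coset v = coset w"
proof -
  have sub: "coset v \<subseteq> coset w" if "v - w \<in> rel_ideal" for v w
  proof
    fix x
    assume "x \<in> coset v"
    then obtain i where i: "i \<in> rel_ideal" "x = i + v"
      by (auto simp: a_r_coset_def')
    then have "i + (v - w) \<in> rel_ideal" "x = (i + (v - w)) + w"
      using that pm_vs.subspace_add[OF rel_ideal_subspace] by auto
    then show "x \<in> coset w"
      unfolding a_r_coset_def' by (intro UN_I[of "i + (v - w)"]) simp_all
  qed
  assume "v - w \<in> rel_ideal"
  moreover from this have "w - v \<in> rel_ideal"
    using pm_vs.subspace_neg[OF rel_ideal_subspace] by fastforce
  ultimately show "coset v = coset w"
    using sub by blast
qed

sublocale coset: ring_hom_ring FA "FA Quot rel_ideal" "(+>\<^bsub>FA\<^esub>) rel_ideal"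
  by (rule rel.rcos_ring_hom_ring)

lemma carrier_envelope: "carrier Env = (\<lambda>v. coset v) ` carrier FA"
  by (auto simp: envelope_eq FactRing_def A_RCOSETS_def')

lemma coset_closed: "v \<in> carrier FA \<Longrightarrow> coset v \<in> carrier Env"
  unfolding carrier_envelope by (rule imageI)

lemma coset_mult: "v \<in> carrier FA \<Longrightarrow> w \<in> carrier FA \<Longrightarrow> coset v \<otimes>\<^bsub>Env\<^esub> coset w = coset (v \<otimes>\<^bsub>FA\<^esub> w)"
  unfolding envelope_eq quotient_algebra_simps by (rule coset.hom_mult[symmetric])

lemma coset_add: "v \<in> carrier FA \<Longrightarrow> w \<in> carrier FA \<Longrightarrow> coset v \<oplus>\<^bsub>Env\<^esub> coset w = coset (v + w)"
  unfolding envelope_eq quotient_algebra_simps using coset.hom_add[of v w] by simp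

lemma coset_one: "\<one>\<^bsub>Env\<^esub> = coset \<one>\<^bsub>FA\<^esub>"
  unfolding envelope_eq quotient_algebra_simps by (rule coset.hom_one[symmetric])

text \<open>The union in \<open>quotient_algebra\<close> runs over all representatives; each gives
  the same coset, so the union collapses.\<close>

lemma coset_smult: "q \<odot>\<^bsub>Env\<^esub> coset v = coset (pm_scale q v)"
proof -
  have "coset (pm_scale q x) = coset (pm_scale q v)" if x: "x \<in> coset v" for x
  proof (rule coset_eq)
    obtain i where "i \<in> rel_ideal" "x = i + v"
      using x by (auto simp: a_r_coset_def')
    then show "pm_scale q x - pm_scale q v \<in> rel_ideal"
      using pm_vs.subspace_scale[OF rel_ideal_subspace] by (simp add: pm_scale_add)
  qed
  moreover have "v \<in> coset v"
    using pm_vs.subspace_0[OF rel_ideal_subspace] by (force simp: a_r_coset_def')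
  ultimately show ?thesis
    unfolding envelope_eq quotient_algebra_simps monoid_algebra_simps by blast
qed

lemma ring_envelope: "ring Env"
  by (rule ring_cong[OF rel.quotient_is_ring]) (simp_all add: envelope_eq)

lemma rel_ideal_eq_kernel: "rel_ideal = a_kernel FA target_algebra env_hom"
  using env_hom_rel_ideal env_hom_kernel rel.a_subset unfolding a_kernel_def' T.zero_eq by blast

text \<open>\<open>env_hom\<close> is constant on the cosets of its kernel, which is the ideal of
  relations, so the image of a coset has one element.\<close>

definition env_map :: "((rat^3^3) list \<Rightarrow>\<^sub>0 rat) set \<Rightarrow> 'k target" where
  "env_map S = the_elem (env_hom ` S)"

lemma env_map_coset: "v \<in> carrier FA \<Longrightarrow> env_map (coset v) = env_hom v"
  unfolding env_map_def using env_hom.the_elem_simp by (simp only: rel_ideal_eq_kernel)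

lemma env_map_hom:
  assumes "x \<in> carrier Env" "y \<in> carrier Env"
  shows "env_map (x \<otimes>\<^bsub>Env\<^esub> y) = env_map x \<star> env_map y" "env_map (x \<oplus>\<^bsub>Env\<^esub> y) = env_map x + env_map y"
    "env_map (q \<odot>\<^bsub>Env\<^esub> x) = of_rat q \<bullet>\<^sub>t env_map x"
proof -
  obtain v w where v: "v \<in> carrier FA" "x = coset v" and w: "w \<in> carrier FA" "y = coset w"
    using assms unfolding carrier_envelope by blast
  show "env_map (x \<otimes>\<^bsub>Env\<^esub> y) = env_map x \<star> env_map y"
    unfolding v w coset_mult[OF v(1) w(1)] env_map_coset[OF v(1)] env_map_coset[OF w(1)]
      env_map_coset[OF FA.m_closed[OF v(1) w(1)]]
    by (rule env_hom.hom_mult[OF v(1) w(1)])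
  show "env_map (x \<oplus>\<^bsub>Env\<^esub> y) = env_map x + env_map y"
    unfolding v w coset_add[OF v(1) w(1)] env_map_coset[OF v(1)] env_map_coset[OF w(1)]
      env_map_coset[OF pm_vs.subspace_add[OF carrier_subspace v(1) w(1)]]
    by (rule env_hom_simps)
  show "env_map (q \<odot>\<^bsub>Env\<^esub> x) = of_rat q \<bullet>\<^sub>t env_map x"
    unfolding v coset_smult env_map_coset[OF v(1)] env_map_coset[OF pm_vs.subspace_scale[OF carrier_subspace v(1)]]
    by (rule env_hom_scale)
qed

lemma env_map_one: "env_map \<one>\<^bsub>Env\<^esub> = \<one>\<^bsub>target_algebra\<^esub>"
  unfolding coset_one env_map_coset[OF FA.one_closed] by (rule env_hom.hom_one)

section \<open>The tensor product of the envelope with the larger field\<close>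

abbreviation "pairs \<equiv> Env \<times>\<times> ratK"
abbreviation "PA \<equiv> (monoid_algebra pairs :: (rat, (_ \<times> 'k) \<Rightarrow>\<^sub>0 rat) module)"
abbreviation "TI \<equiv> tensor_ideal Env ratK"
abbreviation tensor_single (infix \<open>\<otimes>\<^sub>s\<close> 70) where "x \<otimes>\<^sub>s k \<equiv> Poly_Mapping.single (x, k :: 'k) (1 :: rat)"

lemma monoid_pairs: "monoid pairs"
proof (rule DirProd_monoid)
  show "monoid Env" using ring_envelope by (rule ring.axioms)
  show "monoid ratK" by (intro monoidI) simp_all
qed

sublocale PA: ring PA
  by (rule ring_monoid_algebra[OF monoid_pairs])

lemma PA_subspace: "pm_vs.subspace (carrier PA)"
  using subspace_keys by simp

lemma single_closed: "x \<in> carrier Env \<Longrightarrow> Poly_Mapping.single (x, k) q \<in> carrier PA"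
  by simp

lemma tensor_relations_closed: "tensor_relations Env ratK \<subseteq> carrier PA"
proof -
  interpret E: ring Env by (rule ring_envelope)
  have "q \<odot>\<^bsub>Env\<^esub> x \<in> carrier Env" if "x \<in> carrier Env" for q x
    using that pm_vs.subspace_scale[OF carrier_subspace] unfolding carrier_envelope
    by (auto simp only: coset_smult)
  then show ?thesis
    unfolding tensor_relations_def
    by (auto simp del: monoid_algebra_simps intro!: pm_vs.subspace_diff[OF PA_subspace] single_closed)
qed

sublocale TI: ideal TI PA
  unfolding tensor_ideal_def by (rule PA.genideal_ideal[OF tensor_relations_closed])

lemma TI_subspace: "pm_vs.subspace TI"
  using monoid_pairs TI.ideal_axioms by (rule monoid_ideal_subspace)

lemma tensor_relations:
  assumes "x \<in> carrier Env" "y \<in> carrier Env"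
  shows "(x \<oplus>\<^bsub>Env\<^esub> y) \<otimes>\<^sub>s k - x \<otimes>\<^sub>s k - y \<otimes>\<^sub>s k \<in> TI"
    "x \<otimes>\<^sub>s (k + l) - x \<otimes>\<^sub>s k - x \<otimes>\<^sub>s l \<in> TI"
    "(q \<odot>\<^bsub>Env\<^esub> x) \<otimes>\<^sub>s k - Poly_Mapping.single (x, k) q \<in> TI"
    "x \<otimes>\<^sub>s (of_rat q * k) - Poly_Mapping.single (x, k) q \<in> TI"
proof -
  note mem = subsetD[OF PA.genideal_self[OF tensor_relations_closed], folded tensor_ideal_def]
  show "(x \<oplus>\<^bsub>Env\<^esub> y) \<otimes>\<^sub>s k - x \<otimes>\<^sub>s k - y \<otimes>\<^sub>s k \<in> TI"
    using assms by (intro mem) (auto simp: tensor_relations_def)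
  show "x \<otimes>\<^sub>s (k + l) - x \<otimes>\<^sub>s k - x \<otimes>\<^sub>s l \<in> TI"
    using assms by (intro mem) (auto simp: tensor_relations_def)
  show "(q \<odot>\<^bsub>Env\<^esub> x) \<otimes>\<^sub>s k - Poly_Mapping.single (x, k) q \<in> TI"
    using assms by (intro mem) (auto simp: tensor_relations_def)
  show "x \<otimes>\<^sub>s (of_rat q * k) - Poly_Mapping.single (x, k) q \<in> TI"
    using assms by (intro mem) (auto simp: tensor_relations_def)
qed

text \<open>Lets tensor identities be chained and summed on representatives, without forming
  cosets.\<close>

definition cong_TI (infix \<open>\<equiv>\<^sub>T\<close> 50) where "p \<equiv>\<^sub>T r \<longleftrightarrow> p - r \<in> TI"

lemma cong_TI_sym: "p \<equiv>\<^sub>T r \<Longrightarrow> r \<equiv>\<^sub>T p"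
  unfolding cong_TI_def using pm_vs.subspace_neg[OF TI_subspace, of "p - r"] by simp

lemma cong_TI_trans [trans]: "p \<equiv>\<^sub>T r \<Longrightarrow> r \<equiv>\<^sub>T u \<Longrightarrow> p \<equiv>\<^sub>T u"
  unfolding cong_TI_def using pm_vs.subspace_add[OF TI_subspace, of "p - r" "r - u"] by simp

lemma cong_TI_add: "p \<equiv>\<^sub>T r \<Longrightarrow> p' \<equiv>\<^sub>T r' \<Longrightarrow> p + p' \<equiv>\<^sub>T r + r'"
  unfolding cong_TI_def using pm_vs.subspace_add[OF TI_subspace, of "p - r" "p' - r'"]
  by (simp add: algebra_simps)

lemma cong_TI_sum: "(\<And>a. a \<in> A \<Longrightarrow> f a \<equiv>\<^sub>T g a) \<Longrightarrow> (\<Sum>a\<in>A. f a) \<equiv>\<^sub>T (\<Sum>a\<in>A. g a)"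
  unfolding cong_TI_def sum_subtractf[symmetric] by (rule pm_vs.subspace_sum[OF TI_subspace])

lemma cong_tensor:
  assumes "x \<in> carrier Env" "y \<in> carrier Env"
  shows "(x \<oplus>\<^bsub>Env\<^esub> y) \<otimes>\<^sub>s k \<equiv>\<^sub>T x \<otimes>\<^sub>s k + y \<otimes>\<^sub>s k"
    "x \<otimes>\<^sub>s (k + l) \<equiv>\<^sub>T x \<otimes>\<^sub>s k + x \<otimes>\<^sub>s l"
    "(q \<odot>\<^bsub>Env\<^esub> x) \<otimes>\<^sub>s k \<equiv>\<^sub>T x \<otimes>\<^sub>s (of_rat q * k)"
    "Poly_Mapping.single (x, k) q \<equiv>\<^sub>T x \<otimes>\<^sub>s (of_rat q * k)"
    "x \<otimes>\<^sub>s 0 \<equiv>\<^sub>T 0"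
proof -
  show "(x \<oplus>\<^bsub>Env\<^esub> y) \<otimes>\<^sub>s k \<equiv>\<^sub>T x \<otimes>\<^sub>s k + y \<otimes>\<^sub>s k" "x \<otimes>\<^sub>s (k + l) \<equiv>\<^sub>T x \<otimes>\<^sub>s k + x \<otimes>\<^sub>s l"
    using tensor_relations(1)[OF assms, of k] tensor_relations(2)[OF assms, of k l]
    by (simp_all add: cong_TI_def diff_diff_eq)
  have 3: "(q \<odot>\<^bsub>Env\<^esub> x) \<otimes>\<^sub>s k \<equiv>\<^sub>T Poly_Mapping.single (x, k) q"
    and 4: "x \<otimes>\<^sub>s (of_rat q * k) \<equiv>\<^sub>T Poly_Mapping.single (x, k) q" for q
    unfolding cong_TI_def by (rule tensor_relations[OF assms])+
  show "Poly_Mapping.single (x, k) q \<equiv>\<^sub>T x \<otimes>\<^sub>s (of_rat q * k)"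
    by (rule cong_TI_sym[OF 4])
  with 3 show "(q \<odot>\<^bsub>Env\<^esub> x) \<otimes>\<^sub>s k \<equiv>\<^sub>T x \<otimes>\<^sub>s (of_rat q * k)"
    by (rule cong_TI_trans)
  show "x \<otimes>\<^sub>s 0 \<equiv>\<^sub>T 0" using 4[of 0] by simp
qed

abbreviation tensor_comb :: "((nat \<times> 3 \<times> 3) option \<Rightarrow> 'k) \<Rightarrow> _" where
  "tensor_comb c \<equiv> (\<Sum>a\<in>basis_index. coset (env_basis a) \<otimes>\<^sub>s c a)"

lemma coset_env_basis_closed: "coset (env_basis a) \<in> carrier Env"
  by (rule coset_closed[OF env_basis_closed])

text \<open>The rational coefficients of the normal form in the envelope move across the tensor sign
  and merge with \<open>k\<close> and \<open>q\<close>.\<close>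

lemma tensor_normal_form_single:
  assumes "x \<in> carrier Env"
  shows "\<exists>c. Poly_Mapping.single (x, k) q \<equiv>\<^sub>T tensor_comb c"
proof -
  obtain v where v: "v \<in> carrier FA" "x = coset v"
    using assms unfolding carrier_envelope by blast
  obtain c where c: "v - (\<Sum>a\<in>basis_index. pm_scale (c a) (env_basis a)) \<in> rel_ideal"
    using env_normal_form[OF v(1)] by blast
  have "coset (\<Sum>a\<in>A. pm_scale (c a) (env_basis a)) \<otimes>\<^sub>s l \<equiv>\<^sub>T
      (\<Sum>a\<in>A. coset (env_basis a) \<otimes>\<^sub>s (of_rat (c a) * l))" if "finite A" for A l
    using that
  proof (induction A)
    case empty
    have zero: "coset 0 \<in> carrier Env" by (intro coset_closed) simp
    \<comment> \<open>The zero coset is written as 0 times itself, so that the factor 0 can be moved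
      to the other side of the tensor sign.\<close>
    have "coset 0 \<otimes>\<^sub>s l = (0 \<odot>\<^bsub>Env\<^esub> coset 0) \<otimes>\<^sub>s l" by (simp add: coset_smult)
    also have "\<dots> \<equiv>\<^sub>T coset 0 \<otimes>\<^sub>s (of_rat 0 * l)" by (rule cong_tensor[OF zero zero])
    also have "\<dots> = coset 0 \<otimes>\<^sub>s 0" by simp
    also have "\<dots> \<equiv>\<^sub>T 0" by (rule cong_tensor[OF zero zero])
    finally show ?case by simp
  next
    case (insert b A)
    let ?s = "\<Sum>a\<in>A. pm_scale (c a) (env_basis a)"
    have s: "?s \<in> carrier FA" and b: "pm_scale (c b) (env_basis b) \<in> carrier FA"
      by (intro pm_vs.subspace_sum[OF carrier_subspace] pm_vs.subspace_scale[OF carrier_subspace] env_basis_closed)+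
    have "coset (pm_scale (c b) (env_basis b) + ?s) \<otimes>\<^sub>s l \<equiv>\<^sub>T coset (pm_scale (c b) (env_basis b)) \<otimes>\<^sub>s l + coset ?s \<otimes>\<^sub>s l"
      using cong_tensor(1)[OF coset_closed[OF b] coset_closed[OF s]] by (simp only: coset_add[OF b s])
    moreover have "coset (pm_scale (c b) (env_basis b)) \<otimes>\<^sub>s l \<equiv>\<^sub>T coset (env_basis b) \<otimes>\<^sub>s (of_rat (c b) * l)"
      using cong_tensor(3)[OF coset_env_basis_closed coset_env_basis_closed] by (simp only: coset_smult)
    ultimately have "coset (pm_scale (c b) (env_basis b) + ?s) \<otimes>\<^sub>s l \<equiv>\<^sub>T
        coset (env_basis b) \<otimes>\<^sub>s (of_rat (c b) * l) + (\<Sum>a\<in>A. coset (env_basis a) \<otimes>\<^sub>s (of_rat (c a) * l))"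
      by (rule cong_TI_trans[OF _ cong_TI_add[OF _ insert.IH]])
    then show ?case using insert.hyps by simp
  qed
  from this[OF finite_basis_index, of "of_rat q * k"]
  have "x \<otimes>\<^sub>s (of_rat q * k) \<equiv>\<^sub>T tensor_comb (\<lambda>a. of_rat (c a) * (of_rat q * k))"
    unfolding v(2) coset_eq[OF c] .
  then show ?thesis
    by (intro exI) (rule cong_TI_trans[OF cong_tensor(4)[OF assms assms]])
qed

lemma tensor_normal_form:
  assumes "p \<in> carrier PA"
  shows "\<exists>c. p \<equiv>\<^sub>T tensor_comb c"
proof -
  have tensor_comb_0: "tensor_comb (\<lambda>_. 0) \<equiv>\<^sub>T 0"
    using cong_TI_sum[of basis_index "\<lambda>a. coset (env_basis a) \<otimes>\<^sub>s 0" "\<lambda>_. 0"]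
      cong_tensor(5)[OF coset_env_basis_closed coset_env_basis_closed] by simp
  have "Poly_Mapping.keys p \<subseteq> carrier Env \<times> UNIV" using assms by simp
  then show ?thesis
  proof (induction p rule: poly_mapping_carrier_induct)
    case zero
    show ?case by (rule exI[of _ "\<lambda>_. 0"]) (rule cong_TI_sym[OF tensor_comb_0])
  next
    case (single x q)
    then show ?case using tensor_normal_form_single by (cases x) auto
  next
    case (add p r)
    then obtain c d where "p \<equiv>\<^sub>T tensor_comb c" "r \<equiv>\<^sub>T tensor_comb d" by blast
    then have "p + r \<equiv>\<^sub>T (\<Sum>a\<in>basis_index. coset (env_basis a) \<otimes>\<^sub>s c a + coset (env_basis a) \<otimes>\<^sub>s d a)"
      unfolding sum.distrib by (rule cong_TI_add)
    also have "\<dots> \<equiv>\<^sub>T tensor_comb (\<lambda>a. c a + d a)"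
      by (intro cong_TI_sum cong_TI_sym[OF cong_tensor(2)[OF coset_env_basis_closed coset_env_basis_closed]])
    finally show ?case by (rule exI[of _ "\<lambda>a. c a + d a"])
  qed
qed

definition tensor_hom :: "(((rat^3^3) list \<Rightarrow>\<^sub>0 rat) set \<times> 'k \<Rightarrow>\<^sub>0 rat) \<Rightarrow> 'k target" where
  "tensor_hom = lin_ext (\<lambda>q t. of_rat q \<bullet>\<^sub>t t) (\<lambda>(x, k). k \<bullet>\<^sub>t env_map x)"

lemmas tensor_hom_simps = rat_lin_ext_simps[where g = "\<lambda>(x, k). k \<bullet>\<^sub>t env_map x", folded tensor_hom_def]

text \<open>Multiplicative on pairs because scalars are central in the target, in the form
  \<open>target_scale(5)\<close>.\<close>

lemma tensor_hom_ring_hom: "ring_hom_ring PA target_algebra tensor_hom"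
  unfolding tensor_hom_def
proof (rule T.lin_ext_hom[OF monoid_pairs])
  show "of_rat (a + b) \<bullet>\<^sub>t x = of_rat a \<bullet>\<^sub>t x + of_rat b \<bullet>\<^sub>t x" for a b x
    by (simp only: of_rat_add target_scale)
  show "of_rat (a * b) \<bullet>\<^sub>t (x \<star> y) = (of_rat a \<bullet>\<^sub>t x) \<star> (of_rat b \<bullet>\<^sub>t y)" for a b x y
    by (simp only: of_rat_mult target_scale(5))
  show "of_rat 1 \<bullet>\<^sub>t \<one>\<^bsub>target_algebra\<^esub> = \<one>\<^bsub>target_algebra\<^esub>"
    by (simp only: of_rat_1 target_scale(4))
  show "(case x \<otimes>\<^bsub>pairs\<^esub> y of (x, k) \<Rightarrow> k \<bullet>\<^sub>t env_map x) =
      (case x of (x, k) \<Rightarrow> k \<bullet>\<^sub>t env_map x) \<star> (case y of (x, k) \<Rightarrow> k \<bullet>\<^sub>t env_map x)"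
    if "x \<in> carrier pairs" "y \<in> carrier pairs" for x y
    using that by (cases x; cases y) (simp add: env_map_hom target_scale(5) del: direct_sum_algebra_simps)
  show "(case \<one>\<^bsub>pairs\<^esub> of (x, k) \<Rightarrow> k \<bullet>\<^sub>t env_map x) = \<one>\<^bsub>target_algebra\<^esub>"
    by (simp add: env_map_one target_scale(4) del: direct_sum_algebra_simps)
qed

sublocale tensor_hom: ring_hom_ring PA target_algebra tensor_hom
  by (rule tensor_hom_ring_hom)

lemma tensor_hom_pure: "tensor_hom (x \<otimes>\<^sub>s k) = k \<bullet>\<^sub>t env_map x"
  by (simp add: tensor_hom_simps target_scale(4) del: direct_sum_algebra_simps)

lemma tensor_hom_TI: "p \<in> TI \<Longrightarrow> tensor_hom p = 0"
proof -
  have "tensor_relations Env ratK \<subseteq> a_kernel PA target_algebra tensor_hom"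
  proof
    fix r
    assume r: "r \<in> tensor_relations Env ratK"
    have comm: "k \<bullet>\<^sub>t (of_rat q \<bullet>\<^sub>t t) = of_rat q \<bullet>\<^sub>t (k \<bullet>\<^sub>t t)" for k q t
      by (simp only: mult.commute flip: target_scale(3))
    have "tensor_hom r = 0"
      using r unfolding tensor_relations_def
      by (auto simp: tensor_hom_simps env_map_hom target_scale comm simp del: direct_sum_algebra_simps)
    then show "r \<in> a_kernel PA target_algebra tensor_hom"
      using r tensor_relations_closed by (auto simp only: a_kernel_def' T.zero_eq)
  qed
  then have "TI \<subseteq> a_kernel PA target_algebra tensor_hom"
    unfolding tensor_ideal_def by (intro PA.genideal_minimal tensor_hom.kernel_is_ideal)
  then show "p \<in> TI \<Longrightarrow> tensor_hom p = 0"
    by (auto simp only: a_kernel_def' T.zero_eq)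
qed

lemma tensor_hom_comb: "tensor_hom (tensor_comb c) = (\<Sum>a\<in>basis_index. c a \<bullet>\<^sub>t target_basis \<omega> a)"
  by (simp only: tensor_hom_simps(4) tensor_hom_pure env_map_coset[OF env_basis_closed] env_hom_env_basis)

text \<open>The argument of \<open>env_hom_kernel\<close> with coefficients in \<open>'k\<close>,
  where independence of the images over \<open>'k\<close> is needed in full.\<close>

lemma tensor_hom_kernel: "TI = a_kernel PA target_algebra tensor_hom"
proof -
  have "p \<in> TI" if p: "p \<in> carrier PA" "tensor_hom p = 0" for p
  proof -
    obtain c where c: "p \<equiv>\<^sub>T tensor_comb c"
      using tensor_normal_form[OF p(1)] by blast
    then have "tensor_hom (p - tensor_comb c) = 0"
      unfolding cong_TI_def by (rule tensor_hom_TI)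
    then have sum: "(\<Sum>a\<in>basis_index. c a \<bullet>\<^sub>t target_basis \<omega> a) = 0"
      using p(2) by (simp only: tensor_hom_simps(3) tensor_hom_comb) simp
    have "c a = 0" if "a \<in> basis_index" for a
      by (rule target_basis_independent[OF omega sum that])
    then have "tensor_comb c \<equiv>\<^sub>T (\<Sum>a\<in>basis_index. 0)"
      using cong_tensor(5)[OF coset_env_basis_closed coset_env_basis_closed] by (intro cong_TI_sum) simp
    from cong_TI_trans[OF c this] have "p \<equiv>\<^sub>T 0" by simp
    then show ?thesis by (simp add: cong_TI_def)
  qed
  then show ?thesis
    using tensor_hom_TI TI.a_subset unfolding a_kernel_def' T.zero_eq by blast
qed

lemma tensor_hom_surj: "tensor_hom ` carrier PA = carrier target_algebra"
proof -
  have "t \<in> tensor_hom ` carrier PA" for t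
  proof -
    obtain c where "t = (\<Sum>a\<in>basis_index. c a \<bullet>\<^sub>t target_basis \<omega> a)"
      using target_basis_spans[OF omega] by blast
    then have "t = tensor_hom (tensor_comb c)"
      by (simp only: tensor_hom_comb)
    moreover have "tensor_comb c \<in> carrier PA"
      by (intro pm_vs.subspace_sum[OF PA_subspace] single_closed coset_env_basis_closed)
    ultimately show ?thesis
      by (rule image_eqI)
  qed
  then show ?thesis
    unfolding T.carrier_UNIV by (rule UNIV_eq_I[symmetric])
qed

theorem envelope_algebra_iso: "algebra_iso (extend_scalars Env) (target_algebra :: ('k, 'k target) module)"
proof -
  define f where "f S = the_elem (tensor_hom ` S)" for S
  have iso: "f \<in> ring_iso (PA Quot TI) target_algebra"
    unfolding f_def[abs_def] tensor_hom_kernel by (rule tensor_hom.FactRing_iso_set[OF tensor_hom_surj])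
  have ext: "carrier (extend_scalars Env :: ('k, _) module) = carrier (PA Quot TI)"
    "mult (extend_scalars Env :: ('k, _) module) = mult (PA Quot TI)"
    "add (extend_scalars Env :: ('k, _) module) = add (PA Quot TI)"
    "one (extend_scalars Env :: ('k, _) module) = one (PA Quot TI)"
    "smult (extend_scalars Env :: ('k, _) module) =
      (\<lambda>k S. pure_tensor Env ratK \<one>\<^bsub>Env\<^esub> k \<otimes>\<^bsub>PA Quot TI\<^esub> S)"
    by (simp_all add: extend_scalars_def Let_def tensor_algebra_def)
  have one: "\<one>\<^bsub>Env\<^esub> \<in> carrier Env"
    by (rule monoid.one_closed[OF ring.axioms(2)[OF ring_envelope]])
  \<comment> \<open>A scalar acts as multiplication by 1 tensor \<open>k\<close>, whose image is
    \<open>k\<close> times the identity of the target; hence the ring isomorphism is also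
    linear.\<close>
  have "f (pure_tensor Env ratK \<one>\<^bsub>Env\<^esub> k \<otimes>\<^bsub>PA Quot TI\<^esub> S) = k \<bullet>\<^sub>t f S" if S: "S \<in> carrier (PA Quot TI)" for k S
  proof -
    have closed: "\<one>\<^bsub>Env\<^esub> \<otimes>\<^sub>s k \<in> carrier PA"
      by (rule single_closed[OF one])
    have "pure_tensor Env ratK \<one>\<^bsub>Env\<^esub> k \<in> carrier (PA Quot TI)"
      using closed by (auto simp: pure_tensor_def FactRing_def A_RCOSETS_def' simp del: monoid_algebra_simps)
    then have "f (pure_tensor Env ratK \<one>\<^bsub>Env\<^esub> k \<otimes>\<^bsub>PA Quot TI\<^esub> S) =
        f (pure_tensor Env ratK \<one>\<^bsub>Env\<^esub> k) \<star> f S"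
      using iso S by (simp add: ring_iso_def ring_hom_mult del: direct_sum_algebra_simps)
    also have "f (pure_tensor Env ratK \<one>\<^bsub>Env\<^esub> k) = tensor_hom (\<one>\<^bsub>Env\<^esub> \<otimes>\<^sub>s k)"
      unfolding f_def pure_tensor_def using tensor_hom.the_elem_simp[OF closed] by (simp only: tensor_hom_kernel)
    also have "\<dots> = k \<bullet>\<^sub>t \<one>\<^bsub>target_algebra\<^esub>"
      by (simp only: tensor_hom_pure env_map_one)
    finally show ?thesis
      by (simp add: tscale_mult T_simps del: direct_sum_algebra_simps)
  qed
  moreover have "f \<in> ring_iso (extend_scalars Env :: ('k, _) module) target_algebra"
    using iso by (simp add: ring_iso_def ring_hom_def ext del: direct_sum_algebra_simps)
  ultimately show ?thesis
    unfolding algebra_iso_def ext by blast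
qed

end

section \<open>The main theorem\<close>

definition Qbeta_beta :: Qbeta where
  "Qbeta_beta = Abs_Qbeta beta"

lemma Rep_Qbeta_beta: "Rep_Qbeta Qbeta_beta = beta"
  unfolding Qbeta_beta_def by (rule Abs_Qbeta_inverse) (simp add: generate_field.incl)

text \<open>From \<open>(beta - 1)^2 = - 3\<close>. It is arranged so that 4 is the only numeral
  whose value under \<open>Rep_Qbeta\<close> has to be computed.\<close>

lemma Qbeta_beta_equation: "Qbeta_beta * Qbeta_beta + (- Qbeta_beta - Qbeta_beta) + 4 = 0"
proof -
  have beta: "beta * beta + (- beta - beta) + 4 = 0"
  proof -
    define r where "r = csqrt (- 3)"
    have "r * r = - 3"
      unfolding r_def using power2_csqrt[of "- 3"] by (simp only: power2_eq_square)
    moreover have "beta * beta + (- beta - beta) + 4 = r * r + 3"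
      unfolding beta_def r_def[symmetric] by (simp add: algebra_simps)
    ultimately show ?thesis by simp
  qed
  have four: "Rep_Qbeta 4 = 4"
  proof -
    have "(4 :: Qbeta) = 1 + 1 + 1 + 1" by simp
    then show ?thesis
      by (simp only: plus_Qbeta.rep_eq one_Qbeta.rep_eq) simp
  qed
  show ?thesis
    unfolding Rep_Qbeta_inject[symmetric] minus_Qbeta_def plus_Qbeta.rep_eq times_Qbeta.rep_eq
      uminus_Qbeta.rep_eq zero_Qbeta.rep_eq four Rep_Qbeta_beta
    using beta by simp
qed

text \<open>Since \<open>beta - 2\<close> is -1 plus a square root of -3, this is a primitive cube
  root of unity.\<close>

definition omega :: Qbeta where
  "omega = (Qbeta_beta - 2) / 2"

lemma omega: "omega\<^sup>2 + omega + 1 = 0"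
proof -
  have "4 * (omega\<^sup>2 + omega + 1) = Qbeta_beta * Qbeta_beta + (- Qbeta_beta - Qbeta_beta) + 4"
    by (simp add: omega_def power2_eq_square field_simps)
  then have "4 * (omega\<^sup>2 + omega + 1) = 0"
    unfolding Qbeta_beta_equation .
  then show ?thesis
    unfolding mult_eq_0_iff by simp
qed

lemma two_other_irreps_twisted:
  fixes w :: "'k::field_char_0"
  assumes w: "w\<^sup>2 + w + 1 = 0"
  shows "two_other_irreps (twisted_rep w) (twisted_rep (w\<^sup>2) :: rat^3^3 \<Rightarrow> _)"
proof -
  note cube = omega_powers(1)[OF w] omega_powers(3)[OF w]
  have "w \<noteq> 1"
    using w by auto
  have "w\<^sup>2 \<noteq> 1" "w \<noteq> w\<^sup>2"
  proof -
    have "w = 1" if "w\<^sup>2 = 1"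
      using cube(1) that by (simp add: power3_eq_cube power2_eq_square)
    then show 1: "w\<^sup>2 \<noteq> 1" using \<open>w \<noteq> 1\<close> by blast
    have "w \<noteq> 0" using w by auto
    then show "w \<noteq> w\<^sup>2" using \<open>w \<noteq> 1\<close> by (simp add: power2_eq_square)
  qed
  moreover have "w \<noteq> 0" "w\<^sup>2 \<noteq> 0"
    using w by auto
  ultimately show ?thesis
    using \<open>w \<noteq> 1\<close> cube twisted_not_equiv[of 1 w] twisted_not_equiv[of 1 "w\<^sup>2"] twisted_not_equiv[of w "w\<^sup>2"]
      trivial_not_equiv_twisted[of w] trivial_not_equiv_twisted[of "w\<^sup>2"]
      fin_dim_irrep_twisted[of w] fin_dim_irrep_twisted[of "w\<^sup>2"]
    unfolding two_other_irreps_def twisted_rep_1 by (metis power_one)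
qed

text \<open>Both given representations are twists by primitive cube roots of unity, and they are
  distinct, so together they exhaust the two nontrivial twists.\<close>

lemma irrep_classification_two_other:
  fixes w :: "'k::field_char_0" and \<rho>\<^sub>1 \<rho>\<^sub>2 :: "rat^3^3 \<Rightarrow> 'k^3 \<Rightarrow> 'k^3"
  assumes w: "w\<^sup>2 + w + 1 = 0" and two: "two_other_irreps \<rho>\<^sub>1 \<rho>\<^sub>2"
    and \<sigma>: "fin_dim_irrep skew_matrices s \<sigma>"
  shows "rep_equiv skew_matrices (*) trivial_rep s \<sigma> \<or> rep_equiv skew_matrices (*s) natural_rep s \<sigma> \<or>
    rep_equiv skew_matrices (*s) \<rho>\<^sub>1 s \<sigma> \<or> rep_equiv skew_matrices (*s) \<rho>\<^sub>2 s \<sigma>"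
proof -
  have twist: "rep_equiv skew_matrices (*s) (twisted_rep w) (*s) \<rho> \<or>
      rep_equiv skew_matrices (*s) (twisted_rep (w\<^sup>2)) (*s) \<rho>"
    if "fin_dim_irrep skew_matrices (*s) \<rho>"
      "\<not> rep_equiv skew_matrices (*) (trivial_rep :: _ \<Rightarrow> 'k \<Rightarrow> 'k) (*s) \<rho>"
      "\<not> rep_equiv skew_matrices (*s) natural_rep (*s) \<rho>" for \<rho> :: "rat^3^3 \<Rightarrow> 'k^3 \<Rightarrow> 'k^3"
    using irrep_classification[OF that(1) w] that(2,3) unfolding twisted_rep_1[symmetric] by blast
  have \<rho>: "rep_equiv skew_matrices (*s) (twisted_rep w) (*s) \<rho>\<^sub>1 \<or>
      rep_equiv skew_matrices (*s) (twisted_rep (w\<^sup>2)) (*s) \<rho>\<^sub>1"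
    "rep_equiv skew_matrices (*s) (twisted_rep w) (*s) \<rho>\<^sub>2 \<or>
      rep_equiv skew_matrices (*s) (twisted_rep (w\<^sup>2)) (*s) \<rho>\<^sub>2"
    "\<not> rep_equiv skew_matrices (*s) \<rho>\<^sub>1 (*s) \<rho>\<^sub>2"
    using two twist unfolding two_other_irreps_def by blast+
  have trans: "rep_equiv skew_matrices (*s) \<rho> s \<sigma>"
    if "rep_equiv skew_matrices (*s) (twisted_rep l) (*s) \<rho>"
      "rep_equiv skew_matrices (*s) (twisted_rep l) s \<sigma>" for l and \<rho> :: "rat^3^3 \<Rightarrow> 'k^3 \<Rightarrow> 'k^3"
    using rep_equiv_trans[OF rep_equiv_sym[OF that(1)] that(2)] .
  have distinct: "\<not> (rep_equiv skew_matrices (*s) (twisted_rep l) (*s) \<rho>\<^sub>1 \<and>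
      rep_equiv skew_matrices (*s) (twisted_rep l) (*s) \<rho>\<^sub>2)" for l
    using rep_equiv_trans[OF rep_equiv_sym] \<rho>(3) by blast
  from irrep_classification[OF \<sigma> w] consider
      "rep_equiv skew_matrices (*) trivial_rep s \<sigma>" | "rep_equiv skew_matrices (*s) natural_rep s \<sigma>"
    | "rep_equiv skew_matrices (*s) (twisted_rep w) s \<sigma>"
    | "rep_equiv skew_matrices (*s) (twisted_rep (w\<^sup>2)) s \<sigma>"
    unfolding twisted_rep_1[symmetric] by blast
  then show ?thesis
  proof cases
    case 3
    then show ?thesis using \<rho>(1,2) distinct[of "w\<^sup>2"] trans[of w] by blast
  next
    case 4
    then show ?thesis using \<rho>(1,2) distinct[of w] trans[of "w\<^sup>2"] by blast
  qed blast+
qed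

theorem proposition8p9:
  fixes B :: "(rat^3^3) set"
  assumes "mat_vs.independent B" and "mat_vs.span B = skew_matrices"
  shows "algebra_iso (extend_scalars (envelope B))
      ((field_algebra :: (Qbeta, Qbeta) module) \<oplus>\<^sub>a
       (matrix_algebra :: (Qbeta, Qbeta^3^3) module) \<oplus>\<^sub>a
       (matrix_algebra :: (Qbeta, Qbeta^3^3) module) \<oplus>\<^sub>a
       (matrix_algebra :: (Qbeta, Qbeta^3^3) module)) \<and>
    fin_dim_irrep (skew_matrices :: (rat^3^3) set) (*) (trivial_rep :: _ \<Rightarrow> Qbeta \<Rightarrow> Qbeta) \<and>
    fin_dim_irrep (skew_matrices :: (rat^3^3) set) (*s)
      (natural_rep :: _ \<Rightarrow> Qbeta^3 \<Rightarrow> Qbeta^3) \<and>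
    \<not> rep_equiv (skew_matrices :: (rat^3^3) set) (*) (trivial_rep :: _ \<Rightarrow> Qbeta \<Rightarrow> Qbeta)
      (*s) (natural_rep :: _ \<Rightarrow> Qbeta^3 \<Rightarrow> Qbeta^3) \<and>
    (\<exists>\<rho>\<^sub>1 \<rho>\<^sub>2 :: rat^3^3 \<Rightarrow> Qbeta^3 \<Rightarrow> Qbeta^3. two_other_irreps \<rho>\<^sub>1 \<rho>\<^sub>2) \<and>
    (\<forall>\<rho>\<^sub>1 \<rho>\<^sub>2 :: rat^3^3 \<Rightarrow> Qbeta^3 \<Rightarrow> Qbeta^3. two_other_irreps \<rho>\<^sub>1 \<rho>\<^sub>2 \<longrightarrow>
      (\<forall>(s :: Qbeta \<Rightarrow> 'v::ab_group_add \<Rightarrow> 'v) \<sigma>. fin_dim_irrep skew_matrices s \<sigma> \<longrightarrow>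
        rep_equiv skew_matrices (*) trivial_rep s \<sigma> \<or>
        rep_equiv skew_matrices (*s) natural_rep s \<sigma> \<or>
        rep_equiv skew_matrices (*s) \<rho>\<^sub>1 s \<sigma> \<or>
        rep_equiv skew_matrices (*s) \<rho>\<^sub>2 s \<sigma>))"
proof (intro conjI allI impI)
  \<comment> \<open>The isomorphism was proved over any field of characteristic zero with a root of
    \<open>x^2 + x + 1\<close>; here that root is \<open>omega\<close>.\<close>
  interpret envelope_target B omega
    using assms omega by unfold_locales
  show "algebra_iso (extend_scalars (envelope B))
      ((field_algebra :: (Qbeta, Qbeta) module) \<oplus>\<^sub>a
       (matrix_algebra :: (Qbeta, Qbeta^3^3) module) \<oplus>\<^sub>a
       (matrix_algebra :: (Qbeta, Qbeta^3^3) module) \<oplus>\<^sub>a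
       (matrix_algebra :: (Qbeta, Qbeta^3^3) module))"
    by (rule envelope_algebra_iso)
  show "fin_dim_irrep (skew_matrices :: (rat^3^3) set) (*) (trivial_rep :: _ \<Rightarrow> Qbeta \<Rightarrow> Qbeta)"
    by (rule fin_dim_irrep_trivial)
  show "fin_dim_irrep (skew_matrices :: (rat^3^3) set) (*s) (natural_rep :: _ \<Rightarrow> Qbeta^3 \<Rightarrow> Qbeta^3)"
    unfolding twisted_rep_1[symmetric] by (rule fin_dim_irrep_twisted) simp
  show "\<not> rep_equiv (skew_matrices :: (rat^3^3) set) (*) (trivial_rep :: _ \<Rightarrow> Qbeta \<Rightarrow> Qbeta)
      (*s) (natural_rep :: _ \<Rightarrow> Qbeta^3 \<Rightarrow> Qbeta^3)"
    unfolding twisted_rep_1[symmetric] by (rule trivial_not_equiv_twisted) simp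
  show "\<exists>\<rho>\<^sub>1 \<rho>\<^sub>2 :: rat^3^3 \<Rightarrow> Qbeta^3 \<Rightarrow> Qbeta^3. two_other_irreps \<rho>\<^sub>1 \<rho>\<^sub>2"
    using two_other_irreps_twisted[OF omega] by blast
qed (rule irrep_classification_two_other[OF omega])

end
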